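(* Let $A$ be a finite dimensional algebra over a field which has at least one gap. Then $$\operatorname{findim}(A)<\lambda<\phi\dim(A)$$ for every gap $\lambda$ of $A$. Hence the finitistic conjecture holds for $A$, i.e. $\operatorname{findim}(A)<\infty$.
   Context: $\operatorname{mod}A$ is the category of finitely generated right $A$-modules. $K_0(A)$ denotes the abelian group generated by all symbols $[M]$, $M\in\operatorname{mod}A$, modulo the relations $[M]-[M']-[M'']$ whenever $M\cong M'\oplus M''$, and $[P]$ for each projective $P$. Let $\Omega(M)$ be the syzygy of $M$ (kernel of a projective cover), and let $\bar\Omega:K_0(A)\to K_0(A)$ be the induced group endomorphism, $\bar\Omega([M])=[\Omega(M)]$. For $M\in\operatorname{mod}A$, $\langle\operatorname{add}M\rangle$ is the subgroup of $K_0(A)$ generated by the classes of the indecomposable direct summands of $M$. The Igusa-Todorov function is $$\phi(M)=\min\{l\ge 0:\ \bar\Omega|_{\bar\Omega^{l+s}\langle\operatorname{add}M\rangle}\text{ is a monomorphism for all integers } s\ge 0\}.$$ The $\phi$-dimension is $\phi\dim(A)=\sup\{\phi(M):M\in\operatorname{mod}A\}\in\{0,1,2,\dots\}\cup\{\infty\}$. The finitistic dimension $\operatorname{findim}(A)$ is the supremum of the projective dimensions of modules in $\operatorname{mod}A$ of finite projective dimension. A natural number $t\le\phi\dim(A)$ is called admissible if there exists $M\in\operatorname{mod}A$ with $\phi(M)=t$; if $t\le\phi\dim(A)$ is not admissible, $t$ is called a gap of $A$. *)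

theory Defs
  imports
    "HOL-Algebra.Algebra"
    "HOL-Library.Extended_Nat"
begin

definition finitely_generated ::
    "('r, 'c) ring_scheme \<Rightarrow> ('r, 'm, 'd) module_scheme \<Rightarrow> bool" where
  "finitely_generated R M \<longleftrightarrow>
     (\<exists>S. finite S \<and> S \<subseteq> carrier M \<and>
          carrier M = {\<Oplus>\<^bsub>M\<^esub>s\<in>S. c s \<odot>\<^bsub>M\<^esub> s |c. c \<in> S \<rightarrow> carrier R})"

text \<open>A finite dimensional associative unital algebra. The library locale \<open>algebra\<close> is not
  used because it makes the algebra commutative.\<close>

locale fd_algebra = K: field K + A: ring A + V: module K A
  for K :: "('k, 'c) ring_scheme" and A :: "('k, 'a, 'b) module_scheme" +
  assumes smult_mult_left:
      "\<lbrakk>c \<in> carrier K; x \<in> carrier A; y \<in> carrier A\<rbrakk>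
       \<Longrightarrow> (c \<odot>\<^bsub>A\<^esub> x) \<otimes>\<^bsub>A\<^esub> y = c \<odot>\<^bsub>A\<^esub> (x \<otimes>\<^bsub>A\<^esub> y)"
    and smult_mult_right:
      "\<lbrakk>c \<in> carrier K; x \<in> carrier A; y \<in> carrier A\<rbrakk>
       \<Longrightarrow> x \<otimes>\<^bsub>A\<^esub> (c \<odot>\<^bsub>A\<^esub> y) = c \<odot>\<^bsub>A\<^esub> (x \<otimes>\<^bsub>A\<^esub> y)"
    and finite_dim: "finitely_generated K A"


section \<open>Right modules\<close>

text \<open>Right modules reuse the library record, whose fields \<open>mult\<close> and \<open>one\<close> are meaningless for
  modules. The ring element is written first: \<open>a \<odot> x\<close> is the right action \<open>x a\<close>,
  which shows in \<open>act_assoc\<close>. The library locale \<open>module\<close> requires a commutative ring.\<close>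

locale right_module = A: ring A + M: abelian_group M
  for A :: "('a, 'b) ring_scheme" and M :: "('a, 'm, 'd) module_scheme" +
  assumes act_closed:
      "\<lbrakk>a \<in> carrier A; x \<in> carrier M\<rbrakk> \<Longrightarrow> a \<odot>\<^bsub>M\<^esub> x \<in> carrier M"
    and act_l_distr:
      "\<lbrakk>a \<in> carrier A; b \<in> carrier A; x \<in> carrier M\<rbrakk>
       \<Longrightarrow> (a \<oplus>\<^bsub>A\<^esub> b) \<odot>\<^bsub>M\<^esub> x = a \<odot>\<^bsub>M\<^esub> x \<oplus>\<^bsub>M\<^esub> b \<odot>\<^bsub>M\<^esub> x"
    and act_r_distr:
      "\<lbrakk>a \<in> carrier A; x \<in> carrier M; y \<in> carrier M\<rbrakk>
       \<Longrightarrow> a \<odot>\<^bsub>M\<^esub> (x \<oplus>\<^bsub>M\<^esub> y) = a \<odot>\<^bsub>M\<^esub> x \<oplus>\<^bsub>M\<^esub> a \<odot>\<^bsub>M\<^esub> y"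
    and act_assoc:
      "\<lbrakk>a \<in> carrier A; b \<in> carrier A; x \<in> carrier M\<rbrakk>
       \<Longrightarrow> (a \<otimes>\<^bsub>A\<^esub> b) \<odot>\<^bsub>M\<^esub> x = b \<odot>\<^bsub>M\<^esub> (a \<odot>\<^bsub>M\<^esub> x)"
    and act_one:
      "x \<in> carrier M \<Longrightarrow> \<one>\<^bsub>A\<^esub> \<odot>\<^bsub>M\<^esub> x = x"

definition rmod_hom ::
    "('a, 'b) ring_scheme \<Rightarrow> ('a, 'm, 'd) module_scheme \<Rightarrow> ('a, 'n, 'e) module_scheme
     \<Rightarrow> ('m \<Rightarrow> 'n) set" where
  "rmod_hom A M N =
     {f \<in> hom (add_monoid M) (add_monoid N).
        \<forall>a\<in>carrier A. \<forall>x\<in>carrier M. f (a \<odot>\<^bsub>M\<^esub> x) = a \<odot>\<^bsub>N\<^esub> f x}"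

definition rmod_iso ::
    "('a, 'b) ring_scheme \<Rightarrow> ('a, 'm, 'd) module_scheme \<Rightarrow> ('a, 'n, 'e) module_scheme
     \<Rightarrow> bool" where
  "rmod_iso A M N \<longleftrightarrow> (\<exists>f \<in> rmod_hom A M N. bij_betw f (carrier M) (carrier N))"

definition direct_sum :: "('a, 'm) module \<Rightarrow> ('a, 'n) module \<Rightarrow> ('a, 'm \<times> 'n) module" where
  "direct_sum M N =
     \<lparr>carrier = carrier M \<times> carrier N,
      monoid.mult = undefined, monoid.one = undefined,
      ring.zero = (\<zero>\<^bsub>M\<^esub>, \<zero>\<^bsub>N\<^esub>),
      ring.add = (\<lambda>(x, y) (x', y'). (x \<oplus>\<^bsub>M\<^esub> x', y \<oplus>\<^bsub>N\<^esub> y')),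
      smult = (\<lambda>a (x, y). (a \<odot>\<^bsub>M\<^esub> x, a \<odot>\<^bsub>N\<^esub> y))\<rparr>"

text \<open>The elements of the modules in \<open>modA A\<close> live in the type \<open>nat \<Rightarrow> 'a\<close>. This is large enough
  for a copy of every finitely generated module; see \<open>modA_universal\<close>.\<close>

type_synonym 'a fgmod = "('a, nat \<Rightarrow> 'a) module"

definition modA :: "('a, 'b) ring_scheme \<Rightarrow> 'a fgmod set" where
  "modA A = {M. right_module A M \<and> finitely_generated A M}"

lemma modA_universal:
  fixes A :: "('a, 'b) ring_scheme" and M :: "('a, 'm, 'd) module_scheme"
  assumes M: "right_module A M" and fg: "finitely_generated A M"
  shows "\<exists>N \<in> modA A. rmod_iso A M N"
proof -
  interpret right_module A M by (rule M)
  obtain S where S: "finite S" "S \<subseteq> carrier M"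
    and gen: "carrier M = {\<Oplus>\<^bsub>M\<^esub>s\<in>S. c s \<odot>\<^bsub>M\<^esub> s |c. c \<in> S \<rightarrow> carrier A}"
    using fg unfolding finitely_generated_def by blast
  obtain i :: "'m \<Rightarrow> nat" where i: "inj_on i S"
    using S(1) finite_imp_inj_to_nat_seg by blast
  define val where "val g = (\<Oplus>\<^bsub>M\<^esub>s\<in>S. g (i s) \<odot>\<^bsub>M\<^esub> s)" for g :: "nat \<Rightarrow> 'a"
  have "\<exists>g. val g = x" if "x \<in> carrier M" for x
  proof -
    obtain c where c: "c \<in> S \<rightarrow> carrier A" "x = (\<Oplus>\<^bsub>M\<^esub>s\<in>S. c s \<odot>\<^bsub>M\<^esub> s)"
      using \<open>x \<in> carrier M\<close> unfolding gen by blast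
    have "val (c \<circ> inv_into S i) = x"
      unfolding val_def c(2)
      by (intro M.finsum_cong') (use i c S act_closed in \<open>auto simp: Pi_iff\<close>)
    then show ?thesis by blast
  qed
  then obtain e where e: "\<And>x. x \<in> carrier M \<Longrightarrow> val (e x) = x" by metis
  define N :: "'a fgmod" where "N =
     \<lparr>carrier = e ` carrier M, monoid.mult = undefined, monoid.one = undefined,
      ring.zero = e \<zero>\<^bsub>M\<^esub>, ring.add = (\<lambda>x y. e (val x \<oplus>\<^bsub>M\<^esub> val y)),
      smult = (\<lambda>a x. e (a \<odot>\<^bsub>M\<^esub> val x))\<rparr>"
  have N: "right_module A N"
  proof (intro right_module.intro abelian_groupI right_module_axioms.intro)
    show "ring A" by (rule A.ring_axioms)
    fix x assume "x \<in> carrier N"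
    then obtain u where u: "u \<in> carrier M" "x = e u" by (auto simp: N_def)
    show "\<exists>y\<in>carrier N. y \<oplus>\<^bsub>N\<^esub> x = \<zero>\<^bsub>N\<^esub>"
      by (rule bexI[of _ "e (\<ominus>\<^bsub>M\<^esub> u)"]) (use u in \<open>auto simp: N_def e M.l_neg\<close>)
  qed (auto simp: N_def e M.a_ac act_closed act_l_distr act_r_distr act_assoc act_one)
  interpret N: right_module A N by (rule N)
  have inj: "inj_on e (carrier M)" by (metis e inj_onI)
  have eN: "e x \<in> carrier N" if "x \<in> carrier M" for x
    using that by (simp add: N_def)
  have hom: "e \<in> rmod_hom A M N"
    by (auto simp: rmod_hom_def hom_def N_def e)
  have sum: "e (\<Oplus>\<^bsub>M\<^esub>s\<in>T. c s \<odot>\<^bsub>M\<^esub> s) = (\<Oplus>\<^bsub>N\<^esub>s\<in>T. c s \<odot>\<^bsub>N\<^esub> e s)"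
    if "finite T" "T \<subseteq> carrier M" "c \<in> T \<rightarrow> carrier A" for T c
    using that
  proof (induction T)
    case empty
    have "e \<zero>\<^bsub>M\<^esub> = \<zero>\<^bsub>N\<^esub>" by (simp add: N_def)
    then show ?case by simp
  next
    case (insert t T)
    have 1: "(\<lambda>s. c s \<odot>\<^bsub>M\<^esub> s) \<in> T \<rightarrow> carrier M" "c t \<odot>\<^bsub>M\<^esub> t \<in> carrier M"
      using insert.prems act_closed by auto
    have 2: "(\<lambda>s. c s \<odot>\<^bsub>N\<^esub> e s) \<in> T \<rightarrow> carrier N" "c t \<odot>\<^bsub>N\<^esub> e t \<in> carrier N"
      using insert.prems by (auto simp: Pi_iff subset_iff intro!: N.act_closed eN)
    have 3: "e (x \<oplus>\<^bsub>M\<^esub> y) = e x \<oplus>\<^bsub>N\<^esub> e y" if "x \<in> carrier M" "y \<in> carrier M" for x y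
      using that by (simp add: N_def e)
    have 4: "e (c t \<odot>\<^bsub>M\<^esub> t) = c t \<odot>\<^bsub>N\<^esub> e t"
      using insert.prems by (simp add: N_def e)
    show ?case
      using insert 1 2 by (simp add: 3 4)
  qed
  have "finitely_generated A N"
    unfolding finitely_generated_def
  proof (intro exI conjI)
    show "finite (e ` S)" using S by simp
    show "e ` S \<subseteq> carrier N" using S by (auto simp: N_def)
    have eS: "(\<Oplus>\<^bsub>N\<^esub>s\<in>e ` S. c s \<odot>\<^bsub>N\<^esub> s) = e (\<Oplus>\<^bsub>M\<^esub>s\<in>S. c (e s) \<odot>\<^bsub>M\<^esub> s)"
      if "c \<in> e ` S \<rightarrow> carrier A" for c
    proof -
      have "(\<Oplus>\<^bsub>N\<^esub>s\<in>e ` S. c s \<odot>\<^bsub>N\<^esub> s) = (\<Oplus>\<^bsub>N\<^esub>s\<in>S. c (e s) \<odot>\<^bsub>N\<^esub> e s)"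
      proof (rule N.M.finsum_reindex)
        show "inj_on e S" using inj S by (meson inj_on_subset)
        show "(\<lambda>s. c s \<odot>\<^bsub>N\<^esub> s) \<in> e ` S \<rightarrow> carrier N"
          using that S by (auto simp: Pi_iff subset_iff intro!: N.act_closed eN)
      qed
      also have "\<dots> = e (\<Oplus>\<^bsub>M\<^esub>s\<in>S. c (e s) \<odot>\<^bsub>M\<^esub> s)"
        using that S by (subst sum) auto
      finally show ?thesis .
    qed
    show "carrier N = {\<Oplus>\<^bsub>N\<^esub>s\<in>e ` S. c s \<odot>\<^bsub>N\<^esub> s |c. c \<in> e ` S \<rightarrow> carrier A}"
    proof (intro equalityI subsetI)
      fix x assume "x \<in> carrier N"
      then obtain c where c: "c \<in> S \<rightarrow> carrier A" "x = e (\<Oplus>\<^bsub>M\<^esub>s\<in>S. c s \<odot>\<^bsub>M\<^esub> s)"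
        using gen by (auto simp: N_def)
      let ?c = "\<lambda>y. c (val y)"
      have c': "?c \<in> e ` S \<rightarrow> carrier A" using c S e by (auto simp: Pi_iff subset_iff)
      have "(\<Oplus>\<^bsub>M\<^esub>s\<in>S. ?c (e s) \<odot>\<^bsub>M\<^esub> s) = (\<Oplus>\<^bsub>M\<^esub>s\<in>S. c s \<odot>\<^bsub>M\<^esub> s)"
        by (intro M.finsum_cong') (use c S act_closed e in \<open>auto simp: Pi_iff subset_iff\<close>)
      with eS[OF c'] c(2) have "x = (\<Oplus>\<^bsub>N\<^esub>s\<in>e ` S. ?c s \<odot>\<^bsub>N\<^esub> s)" by simp
      then show "x \<in> {\<Oplus>\<^bsub>N\<^esub>s\<in>e ` S. c s \<odot>\<^bsub>N\<^esub> s |c. c \<in> e ` S \<rightarrow> carrier A}"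
        using c' by (intro CollectI exI[of _ ?c] conjI)
    next
      fix x assume "x \<in> {\<Oplus>\<^bsub>N\<^esub>s\<in>e ` S. c s \<odot>\<^bsub>N\<^esub> s |c. c \<in> e ` S \<rightarrow> carrier A}"
      then obtain c where c: "c \<in> e ` S \<rightarrow> carrier A" "x = (\<Oplus>\<^bsub>N\<^esub>s\<in>e ` S. c s \<odot>\<^bsub>N\<^esub> s)"
        by blast
      have "(\<Oplus>\<^bsub>M\<^esub>s\<in>S. c (e s) \<odot>\<^bsub>M\<^esub> s) \<in> carrier M"
        by (rule M.finsum_closed) (use c S act_closed in \<open>auto simp: Pi_iff subset_iff\<close>)
      then show "x \<in> carrier N" using c eS by (auto simp: N_def)
    qed
  qed
  with N have "N \<in> modA A" by (simp add: modA_def)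
  moreover have "rmod_iso A M N"
    unfolding rmod_iso_def using hom inj by (auto simp: bij_betw_def N_def)
  ultimately show ?thesis by blast
qed

definition projective :: "('a, 'b) ring_scheme \<Rightarrow> 'a fgmod \<Rightarrow> bool" where
  "projective A P \<longleftrightarrow> P \<in> modA A \<and>
     (\<forall>M\<in>modA A. \<forall>N\<in>modA A. \<forall>g\<in>rmod_hom A M N. \<forall>f\<in>rmod_hom A P N.
        g ` carrier M = carrier N \<longrightarrow>
        (\<exists>h\<in>rmod_hom A P M. \<forall>x\<in>carrier P. g (h x) = f x))"

definition indecomposable :: "('a, 'b) ring_scheme \<Rightarrow> 'a fgmod \<Rightarrow> bool" where
  "indecomposable A N \<longleftrightarrow> N \<in> modA A \<and> carrier N \<noteq> {\<zero>\<^bsub>N\<^esub>} \<and>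
     (\<forall>N1\<in>modA A. \<forall>N2\<in>modA A. rmod_iso A N (direct_sum N1 N2) \<longrightarrow>
        carrier N1 = {\<zero>\<^bsub>N1\<^esub>} \<or> carrier N2 = {\<zero>\<^bsub>N2\<^esub>})"

definition direct_summand :: "('a, 'b) ring_scheme \<Rightarrow> 'a fgmod \<Rightarrow> 'a fgmod \<Rightarrow> bool" where
  "direct_summand A N M \<longleftrightarrow>
     N \<in> modA A \<and> (\<exists>N'\<in>modA A. rmod_iso A M (direct_sum N N'))"

definition projective_cover ::
    "('a, 'b) ring_scheme \<Rightarrow> 'a fgmod \<Rightarrow> 'a fgmod \<Rightarrow> ((nat \<Rightarrow> 'a) \<Rightarrow> (nat \<Rightarrow> 'a)) \<Rightarrow> bool" where
  "projective_cover A M P p \<longleftrightarrow>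
     projective A P \<and> p \<in> rmod_hom A P M \<and> p ` carrier P = carrier M \<and>
     (\<forall>U. submodule U A P \<and> U <+>\<^bsub>P\<^esub> a_kernel P M p = carrier P \<longrightarrow> U = carrier P)"

text \<open>The syzygy is determined only up to isomorphism; one value is chosen.\<close>

definition syzygy :: "('a, 'b) ring_scheme \<Rightarrow> 'a fgmod \<Rightarrow> 'a fgmod" where
  "syzygy A M =
     (SOME N. \<exists>P p. projective_cover A M P p \<and> N = P\<lparr>carrier := a_kernel P M p\<rparr>)"


section \<open>The group of classes of modules and the Igusa--Todorov function\<close>

definition K0_relators :: "('a, 'b) ring_scheme \<Rightarrow> ('a fgmod \<Rightarrow>\<^sub>0 int) set" where
  "K0_relators A =
     {frag_of M - frag_of M' - frag_of M'' | M M' M''.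
        M \<in> modA A \<and> M' \<in> modA A \<and> M'' \<in> modA A \<and> rmod_iso A M (direct_sum M' M'')} \<union>
     {frag_of P | P. projective A P}"

definition K0_subgroup :: "('a, 'b) ring_scheme \<Rightarrow> ('a fgmod \<Rightarrow>\<^sub>0 int) set" where
  "K0_subgroup A = generate (free_Abelian_group (modA A)) (K0_relators A)"

definition K0 :: "('a, 'b) ring_scheme \<Rightarrow> ('a fgmod \<Rightarrow>\<^sub>0 int) set monoid" where
  "K0 A = free_Abelian_group (modA A) Mod K0_subgroup A"

definition K0_class :: "('a, 'b) ring_scheme \<Rightarrow> 'a fgmod \<Rightarrow> ('a fgmod \<Rightarrow>\<^sub>0 int) set" where
  "K0_class A M = K0_subgroup A #>\<^bsub>free_Abelian_group (modA A)\<^esub> frag_of M"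

text \<open>The endomorphism of \<open>K0 A\<close> is fixed outside the carrier by extensionality, so that it
  is unique as a HOL function.\<close>

definition Omega_bar ::
    "('a, 'b) ring_scheme \<Rightarrow> ('a fgmod \<Rightarrow>\<^sub>0 int) set \<Rightarrow> ('a fgmod \<Rightarrow>\<^sub>0 int) set" where
  "Omega_bar A =
     (THE f. f \<in> hom (K0 A) (K0 A) \<and> f \<in> extensional (carrier (K0 A)) \<and>
             (\<forall>M\<in>modA A. f (K0_class A M) = K0_class A (syzygy A M)))"

definition add_subgroup ::
    "('a, 'b) ring_scheme \<Rightarrow> 'a fgmod \<Rightarrow> ('a fgmod \<Rightarrow>\<^sub>0 int) set set" where
  "add_subgroup A M =
     generate (K0 A) {K0_class A N | N. indecomposable A N \<and> direct_summand A N M}"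

definition IT_phi :: "('a, 'b) ring_scheme \<Rightarrow> 'a fgmod \<Rightarrow> nat" where
  "IT_phi A M =
     (LEAST l. \<forall>s. inj_on (Omega_bar A) ((Omega_bar A ^^ (l + s)) ` add_subgroup A M))"

definition phidim :: "('a, 'b) ring_scheme \<Rightarrow> enat" where
  "phidim A = (SUP M\<in>modA A. enat (IT_phi A M))"


section \<open>Finitistic dimension and gaps\<close>

text \<open>An exact sequence \<open>0 \<rightarrow> C (n+1) \<rightarrow> \<dots> \<rightarrow> C 1 \<rightarrow> C 0 = M \<rightarrow> 0\<close> with maps
  \<open>d i : C (i+1) \<rightarrow> C i\<close>; the projective in homological degree \<open>i\<close> is \<open>C (i+1)\<close>.\<close>

definition projective_resolution ::
    "('a, 'b) ring_scheme \<Rightarrow> 'a fgmod \<Rightarrow> nat \<Rightarrow> (nat \<Rightarrow> 'a fgmod)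
     \<Rightarrow> (nat \<Rightarrow> (nat \<Rightarrow> 'a) \<Rightarrow> (nat \<Rightarrow> 'a)) \<Rightarrow> bool" where
  "projective_resolution A M n C d \<longleftrightarrow>
     C 0 = M \<and>
     (\<forall>i\<le>n. projective A (C (Suc i)) \<and> d i \<in> rmod_hom A (C (Suc i)) (C i)) \<and>
     d 0 ` carrier (C (Suc 0)) = carrier M \<and>
     (\<forall>i<n. d (Suc i) ` carrier (C (Suc (Suc i))) = a_kernel (C (Suc i)) (C i) (d i)) \<and>
     inj_on (d n) (carrier (C (Suc n)))"

definition proj_dim :: "('a, 'b) ring_scheme \<Rightarrow> 'a fgmod \<Rightarrow> enat" where
  "proj_dim A M = Inf {enat n | n. \<exists>C d. projective_resolution A M n C d}"

definition findim :: "('a, 'b) ring_scheme \<Rightarrow> enat" where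
  "findim A = Sup {proj_dim A M | M. M \<in> modA A \<and> proj_dim A M < \<infinity>}"

definition admissible :: "('a, 'b) ring_scheme \<Rightarrow> nat \<Rightarrow> bool" where
  "admissible A t \<longleftrightarrow> enat t \<le> phidim A \<and> (\<exists>M\<in>modA A. IT_phi A M = t)"

definition gap :: "('a, 'b) ring_scheme \<Rightarrow> nat \<Rightarrow> bool" where
  "gap A t \<longleftrightarrow> enat t \<le> phidim A \<and> \<not> admissible A t"

end

theory Submission
  imports Defs
begin

text \<open>A module of projective dimension \<open>n\<close> has \<open>\<phi>\<close>-value \<open>n\<close>: \<open>\<Omega>\<^sup>n\<close> kills \<open>\<langle>add M\<rangle>\<close>, while
  \<open>\<Omega>\<^sup>n\<^sup>-\<^sup>1[M]\<close> is the class of a module that is not projective, hence is nonzero. Applied to the syzygies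
  of \<open>M\<close> this shows that every number up to the finitistic dimension is admissible. A gap therefore
  lies strictly above the finitistic dimension; it lies strictly below the \<open>\<phi>\<close>-dimension because
  a finite supremum of natural numbers is attained.

  That the class of a non-projective module is nonzero is seen without the Krull--Schmidt theorem:
  \<open>M \<mapsto> length (\<Omega> M)\<close> is additive on direct sums and vanishes exactly on the projective modules, so it
  induces a homomorphism from \<open>K\<^sub>0\<close> to the integers. The only property of the algebra that matters is
  that it has finite length as a right module over itself.\<close>

section \<open>Homomorphisms and submodules\<close>

text \<open>Plain length is additive but does not vanish on projectives, so it gives no map on
  \<open>K0\<close>; taking one syzygy first repairs this. The price is exactness. A projective
  presentation that is not a cover adds a projective summand to the kernel: it has trivial class in
  \<open>K0\<close>, but the length sees it. Additivity of the length of the syzygy therefore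
  requires that the direct sum of two projective covers is again a projective cover, and that the
  length of the kernel does not depend on the cover. The invariant is moreover nonnegative on
  classes of modules. If the classes of two modules add up to zero, then both classes are zero. This
  is what carries the vanishing of the \<open>n\<close>-th syzygy of \<open>M\<close> over to every
  direct summand of \<open>M\<close>, and so to the whole subgroup \<open>add_subgroup A M\<close>.
  The syzygy itself is a choice. Only its class is canonical, so iterated syzygies are compared in
  \<open>K0\<close> and not up to isomorphism.\<close>

lemma (in right_module) act_l_null: "x \<in> carrier M \<Longrightarrow> \<zero>\<^bsub>A\<^esub> \<odot>\<^bsub>M\<^esub> x = \<zero>\<^bsub>M\<^esub>"
  using act_l_distr[of "\<zero>\<^bsub>A\<^esub>" "\<zero>\<^bsub>A\<^esub>" x] act_closed[of "\<zero>\<^bsub>A\<^esub>" x] by simp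

lemma (in right_module) act_r_null: "a \<in> carrier A \<Longrightarrow> a \<odot>\<^bsub>M\<^esub> \<zero>\<^bsub>M\<^esub> = \<zero>\<^bsub>M\<^esub>"
  using act_r_distr[of a "\<zero>\<^bsub>M\<^esub>" "\<zero>\<^bsub>M\<^esub>"] act_closed[of a "\<zero>\<^bsub>M\<^esub>"] by simp

lemma (in right_module) act_r_minus:
  assumes "a \<in> carrier A" "x \<in> carrier M"
  shows "a \<odot>\<^bsub>M\<^esub> (\<ominus>\<^bsub>M\<^esub> x) = \<ominus>\<^bsub>M\<^esub> (a \<odot>\<^bsub>M\<^esub> x)"
proof (rule M.minus_equality[symmetric])
  show "a \<odot>\<^bsub>M\<^esub> (\<ominus>\<^bsub>M\<^esub> x) \<oplus>\<^bsub>M\<^esub> a \<odot>\<^bsub>M\<^esub> x = \<zero>\<^bsub>M\<^esub>"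
    using act_r_distr[of a "\<ominus>\<^bsub>M\<^esub> x" x] assms by (simp add: M.l_neg act_r_null)
qed (use assms act_closed in auto)

lemma (in right_module) act_minus_one:
  assumes "x \<in> carrier M"
  shows "(\<ominus>\<^bsub>A\<^esub> \<one>\<^bsub>A\<^esub>) \<odot>\<^bsub>M\<^esub> x = \<ominus>\<^bsub>M\<^esub> x"
proof (rule M.minus_equality[symmetric])
  show "(\<ominus>\<^bsub>A\<^esub> \<one>\<^bsub>A\<^esub>) \<odot>\<^bsub>M\<^esub> x \<oplus>\<^bsub>M\<^esub> x = \<zero>\<^bsub>M\<^esub>"
    using act_l_distr[of "\<ominus>\<^bsub>A\<^esub> \<one>\<^bsub>A\<^esub>" "\<one>\<^bsub>A\<^esub>" x] assms by (simp add: A.l_neg act_one act_l_null)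
qed (use assms act_closed in auto)

section \<open>Homomorphisms and isomorphisms of right modules\<close>

lemma rmod_hom_closed: "f \<in> rmod_hom A M N \<Longrightarrow> x \<in> carrier M \<Longrightarrow> f x \<in> carrier N"
  and rmod_hom_add: "f \<in> rmod_hom A M N \<Longrightarrow> x \<in> carrier M \<Longrightarrow> y \<in> carrier M \<Longrightarrow>
        f (x \<oplus>\<^bsub>M\<^esub> y) = f x \<oplus>\<^bsub>N\<^esub> f y"
  and rmod_hom_act: "f \<in> rmod_hom A M N \<Longrightarrow> a \<in> carrier A \<Longrightarrow> x \<in> carrier M \<Longrightarrow>
        f (a \<odot>\<^bsub>M\<^esub> x) = a \<odot>\<^bsub>N\<^esub> f x"
  by (auto simp: rmod_hom_def hom_def)

lemma rmod_homI:
  assumes "\<And>x. x \<in> carrier M \<Longrightarrow> f x \<in> carrier N"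
    and "\<And>x y. x \<in> carrier M \<Longrightarrow> y \<in> carrier M \<Longrightarrow> f (x \<oplus>\<^bsub>M\<^esub> y) = f x \<oplus>\<^bsub>N\<^esub> f y"
    and "\<And>a x. a \<in> carrier A \<Longrightarrow> x \<in> carrier M \<Longrightarrow> f (a \<odot>\<^bsub>M\<^esub> x) = a \<odot>\<^bsub>N\<^esub> f x"
  shows "f \<in> rmod_hom A M N"
  using assms by (auto simp: rmod_hom_def hom_def)

lemma rmod_hom_zero:
  assumes "right_module A M" "right_module A N" "f \<in> rmod_hom A M N"
  shows "f \<zero>\<^bsub>M\<^esub> = \<zero>\<^bsub>N\<^esub>"
proof -
  interpret M: right_module A M by fact
  interpret N: right_module A N by fact
  have "f \<zero>\<^bsub>M\<^esub> \<oplus>\<^bsub>N\<^esub> f \<zero>\<^bsub>M\<^esub> = f \<zero>\<^bsub>M\<^esub>"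
    using rmod_hom_add[OF assms(3), of "\<zero>\<^bsub>M\<^esub>" "\<zero>\<^bsub>M\<^esub>"] by simp
  then show ?thesis
    using rmod_hom_closed[OF assms(3), of "\<zero>\<^bsub>M\<^esub>"] by simp
qed

lemma rmod_hom_minus:
  assumes "right_module A M" "right_module A N" "f \<in> rmod_hom A M N"
    and x: "x \<in> carrier M" and y: "y \<in> carrier M"
  shows "f (x \<ominus>\<^bsub>M\<^esub> y) = f x \<ominus>\<^bsub>N\<^esub> f y"
proof -
  interpret M: right_module A M by fact
  interpret N: right_module A N by fact
  note f = rmod_hom_closed[OF assms(3)]
  have "f (x \<ominus>\<^bsub>M\<^esub> y) \<oplus>\<^bsub>N\<^esub> f y = f ((x \<ominus>\<^bsub>M\<^esub> y) \<oplus>\<^bsub>M\<^esub> y)"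
    using x y by (simp add: rmod_hom_add[OF assms(3)])
  also have "(x \<ominus>\<^bsub>M\<^esub> y) \<oplus>\<^bsub>M\<^esub> y = x"
    using x y by (simp add: a_minus_def M.M.a_assoc M.M.l_neg)
  finally have "f x \<ominus>\<^bsub>N\<^esub> f y = (f (x \<ominus>\<^bsub>M\<^esub> y) \<oplus>\<^bsub>N\<^esub> f y) \<ominus>\<^bsub>N\<^esub> f y"
    by simp
  also have "\<dots> = f (x \<ominus>\<^bsub>M\<^esub> y)"
    using x y f by (simp add: a_minus_def N.M.a_assoc N.M.r_neg)
  finally show ?thesis by simp
qed

lemma rmod_hom_id: "(\<lambda>x. x) \<in> rmod_hom A M M"
  by (auto intro: rmod_homI)

lemma rmod_hom_comp:
  assumes "f \<in> rmod_hom A L M" "g \<in> rmod_hom A M N"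
  shows "(\<lambda>x. g (f x)) \<in> rmod_hom A L N"
  by (rule rmod_homI)
    (use assms in \<open>auto simp: rmod_hom_closed rmod_hom_add rmod_hom_act\<close>)

lemma rmod_hom_plus:
  assumes "right_module A N" "f \<in> rmod_hom A M N" "g \<in> rmod_hom A M N"
  shows "(\<lambda>x. f x \<oplus>\<^bsub>N\<^esub> g x) \<in> rmod_hom A M N"
proof -
  interpret N: right_module A N by fact
  show ?thesis
  proof (rule rmod_homI)
    fix x y assume "x \<in> carrier M" "y \<in> carrier M"
    then show "f (x \<oplus>\<^bsub>M\<^esub> y) \<oplus>\<^bsub>N\<^esub> g (x \<oplus>\<^bsub>M\<^esub> y) = (f x \<oplus>\<^bsub>N\<^esub> g x) \<oplus>\<^bsub>N\<^esub> (f y \<oplus>\<^bsub>N\<^esub> g y)"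
      using assms by (simp add: rmod_hom_closed rmod_hom_add N.M.a_ac)
  qed (use assms in \<open>auto simp: rmod_hom_closed rmod_hom_act N.act_r_distr\<close>)
qed

lemma rmod_hom_diff:
  assumes "right_module A N" "f \<in> rmod_hom A M N" "g \<in> rmod_hom A M N"
  shows "(\<lambda>x. f x \<ominus>\<^bsub>N\<^esub> g x) \<in> rmod_hom A M N"
proof -
  interpret N: right_module A N by fact
  show ?thesis
  proof (rule rmod_homI)
    fix x y assume "x \<in> carrier M" "y \<in> carrier M"
    then show "f (x \<oplus>\<^bsub>M\<^esub> y) \<ominus>\<^bsub>N\<^esub> g (x \<oplus>\<^bsub>M\<^esub> y) = (f x \<ominus>\<^bsub>N\<^esub> g x) \<oplus>\<^bsub>N\<^esub> (f y \<ominus>\<^bsub>N\<^esub> g y)"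
      using assms by (simp add: a_minus_def rmod_hom_closed rmod_hom_add N.M.a_ac N.M.minus_add)
  qed (use assms in \<open>auto simp: a_minus_def rmod_hom_closed rmod_hom_act N.act_r_distr N.act_closed N.act_r_minus\<close>)
qed

lemma rmod_hom_inv_into:
  assumes "right_module A M" "right_module A N" "f \<in> rmod_hom A M N"
    and bij: "bij_betw f (carrier M) (carrier N)"
  shows "inv_into (carrier M) f \<in> rmod_hom A N M"
proof -
  interpret M: right_module A M by fact
  interpret N: right_module A N by fact
  let ?g = "inv_into (carrier M) f"
  have g: "?g y \<in> carrier M" "f (?g y) = y" if "y \<in> carrier N" for y
    using that bij by (auto simp: bij_betw_def inv_into_into f_inv_into_f)
  have gf: "?g (f x) = x" if "x \<in> carrier M" for x
    using that bij by (simp add: bij_betw_def)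
  show ?thesis
  proof (rule rmod_homI)
    fix x y assume xy: "x \<in> carrier N" "y \<in> carrier N"
    then have "f (?g x \<oplus>\<^bsub>M\<^esub> ?g y) = x \<oplus>\<^bsub>N\<^esub> y" by (simp add: rmod_hom_add[OF assms(3)] g)
    then show "?g (x \<oplus>\<^bsub>N\<^esub> y) = ?g x \<oplus>\<^bsub>M\<^esub> ?g y" using gf[of "?g x \<oplus>\<^bsub>M\<^esub> ?g y"] xy g by simp
  next
    fix a x assume ax: "a \<in> carrier A" "x \<in> carrier N"
    then have "f (a \<odot>\<^bsub>M\<^esub> ?g x) = a \<odot>\<^bsub>N\<^esub> x" by (simp add: rmod_hom_act[OF assms(3)] g)
    then show "?g (a \<odot>\<^bsub>N\<^esub> x) = a \<odot>\<^bsub>M\<^esub> ?g x"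
      using gf[of "a \<odot>\<^bsub>M\<^esub> ?g x"] ax g by (simp add: M.act_closed)
  qed (use g in auto)
qed

lemma rmod_isoI:
  assumes "f \<in> rmod_hom A M N" "g \<in> rmod_hom A N M"
    and "\<And>x. x \<in> carrier M \<Longrightarrow> g (f x) = x" "\<And>y. y \<in> carrier N \<Longrightarrow> f (g y) = y"
  shows "rmod_iso A M N"
  unfolding rmod_iso_def
proof (rule bexI[OF _ assms(1)])
  show "bij_betw f (carrier M) (carrier N)"
    by (rule bij_betw_byWitness[where f' = g])
      (use assms in \<open>auto simp: rmod_hom_closed[OF assms(1)] rmod_hom_closed[OF assms(2)]\<close>)
qed

lemma rmod_isoE:
  assumes "rmod_iso A M N" "right_module A M" "right_module A N"
  obtains f g where "f \<in> rmod_hom A M N" "g \<in> rmod_hom A N M"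
    "\<And>x. x \<in> carrier M \<Longrightarrow> g (f x) = x" "\<And>y. y \<in> carrier N \<Longrightarrow> f (g y) = y"
proof -
  obtain f where f: "f \<in> rmod_hom A M N" "bij_betw f (carrier M) (carrier N)"
    using assms(1) by (auto simp: rmod_iso_def)
  show thesis
    by (rule that[OF f(1) rmod_hom_inv_into[OF assms(2,3) f]])
      (use f(2) in \<open>auto simp: bij_betw_def f_inv_into_f\<close>)
qed

lemma rmod_iso_sym:
  "rmod_iso A M N \<Longrightarrow> right_module A M \<Longrightarrow> right_module A N \<Longrightarrow> rmod_iso A N M"
  by (erule rmod_isoE) (auto intro: rmod_isoI)

lemma rmod_iso_trans: "rmod_iso A L M \<Longrightarrow> rmod_iso A M N \<Longrightarrow> rmod_iso A L N"
proof -
  assume "rmod_iso A L M" "rmod_iso A M N"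
  then obtain f g where f: "f \<in> rmod_hom A L M" "bij_betw f (carrier L) (carrier M)"
    and g: "g \<in> rmod_hom A M N" "bij_betw g (carrier M) (carrier N)"
    by (auto simp: rmod_iso_def)
  show "rmod_iso A L N"
    unfolding rmod_iso_def
    using rmod_hom_comp[OF f(1) g(1)] bij_betw_trans[OF f(2) g(2)] by (auto simp: comp_def)
qed

section \<open>Submodules, images and kernels\<close>

lemma submoduleI_right:
  assumes "right_module A M" "U \<subseteq> carrier M" "\<zero>\<^bsub>M\<^esub> \<in> U"
    and add: "\<And>x y. x \<in> U \<Longrightarrow> y \<in> U \<Longrightarrow> x \<oplus>\<^bsub>M\<^esub> y \<in> U"
    and act: "\<And>a x. a \<in> carrier A \<Longrightarrow> x \<in> U \<Longrightarrow> a \<odot>\<^bsub>M\<^esub> x \<in> U"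
  shows "submodule U A M"
proof -
  interpret M: right_module A M by fact
  \<comment> \<open>Negation is the action of \<open>-1\<close>, so closure under the action covers
    it.\<close>
  have neg: "\<ominus>\<^bsub>M\<^esub> x \<in> U" if x: "x \<in> U" for x
    using act[of "\<ominus>\<^bsub>A\<^esub> \<one>\<^bsub>A\<^esub>" x] x assms(2) by (auto simp: M.act_minus_one)
  show ?thesis
  proof (intro submodule.intro subgroup.intro submodule_axioms.intro)
    fix x assume "x \<in> U"
    then show "inv\<^bsub>add_monoid M\<^esub> x \<in> U" using neg by (simp add: a_inv_def)
  qed (use assms in auto)
qed

lemma submodule_subset: "submodule U A M \<Longrightarrow> U \<subseteq> carrier M"
  and submodule_zero: "submodule U A M \<Longrightarrow> \<zero>\<^bsub>M\<^esub> \<in> U"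
  and submodule_add: "submodule U A M \<Longrightarrow> x \<in> U \<Longrightarrow> y \<in> U \<Longrightarrow> x \<oplus>\<^bsub>M\<^esub> y \<in> U"
  and submodule_neg: "submodule U A M \<Longrightarrow> x \<in> U \<Longrightarrow> \<ominus>\<^bsub>M\<^esub> x \<in> U"
  and submodule_act: "submodule U A M \<Longrightarrow> a \<in> carrier A \<Longrightarrow> x \<in> U \<Longrightarrow> a \<odot>\<^bsub>M\<^esub> x \<in> U"
proof -
  assume U: "submodule U A M"
  then interpret U: submodule U A M .
  show "U \<subseteq> carrier M" using U.subset by simp
  show "\<zero>\<^bsub>M\<^esub> \<in> U" using U.one_closed by simp
  show "x \<in> U \<Longrightarrow> y \<in> U \<Longrightarrow> x \<oplus>\<^bsub>M\<^esub> y \<in> U" using U.m_closed by simp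
  show "x \<in> U \<Longrightarrow> \<ominus>\<^bsub>M\<^esub> x \<in> U" using U.m_inv_closed by (simp add: a_inv_def)
  show "a \<in> carrier A \<Longrightarrow> x \<in> U \<Longrightarrow> a \<odot>\<^bsub>M\<^esub> x \<in> U" by simp
qed

lemma submodule_minus: "submodule U A M \<Longrightarrow> x \<in> U \<Longrightarrow> y \<in> U \<Longrightarrow> x \<ominus>\<^bsub>M\<^esub> y \<in> U"
  by (simp add: a_minus_def submodule_add submodule_neg)

lemma right_module_submodule:
  assumes "right_module A M" "submodule U A M"
  shows "right_module A (M\<lparr>carrier := U\<rparr>)"
proof -
  interpret M: right_module A M by fact
  note U = submodule_subset[OF assms(2)] submodule_zero[OF assms(2)] submodule_add[OF assms(2)]
    submodule_neg[OF assms(2)] submodule_act[OF assms(2)]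
  have U': "x \<in> U \<Longrightarrow> x \<in> carrier M" for x using U(1) by auto
  show ?thesis
  proof (intro right_module.intro abelian_groupI right_module_axioms.intro)
    show "ring A" by (rule M.A.ring_axioms)
    fix x assume "x \<in> carrier (M\<lparr>carrier := U\<rparr>)"
    then show "\<exists>y\<in>carrier (M\<lparr>carrier := U\<rparr>). y \<oplus>\<^bsub>M\<lparr>carrier := U\<rparr>\<^esub> x = \<zero>\<^bsub>M\<lparr>carrier := U\<rparr>\<^esub>"
      using U by (intro bexI[of _ "\<ominus>\<^bsub>M\<^esub> x"]) (auto simp: M.M.l_neg)
  qed (auto simp: U U' M.M.a_ac M.act_l_distr M.act_r_distr M.act_assoc M.act_one)
qed

text \<open>Lets a chain inside a submodule be read as a chain of the ambient module, where the
  lengths of different submodules can be compared.\<close>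

lemma submodule_of_submodule:
  assumes "right_module A M" "submodule U A M"
  shows "submodule V A (M\<lparr>carrier := U\<rparr>) \<longleftrightarrow> submodule V A M \<and> V \<subseteq> U"
proof
  assume V: "submodule V A (M\<lparr>carrier := U\<rparr>)"
  show "submodule V A M \<and> V \<subseteq> U"
  proof
    show VU: "V \<subseteq> U" using submodule_subset[OF V] by simp
    show "submodule V A M"
      by (rule submoduleI_right[OF assms(1)])
        (use VU submodule_subset[OF assms(2)] submodule_zero[OF V] submodule_add[OF V]
          submodule_act[OF V] in auto)
  qed
next
  assume V: "submodule V A M \<and> V \<subseteq> U"
  show "submodule V A (M\<lparr>carrier := U\<rparr>)"
    by (rule submoduleI_right[OF right_module_submodule[OF assms]])
      (use V in \<open>auto simp: submodule_zero submodule_add submodule_act\<close>)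
qed

lemma submodule_carrier: "right_module A M \<Longrightarrow> submodule (carrier M) A M"
  and submodule_zero_set: "right_module A M \<Longrightarrow> submodule {\<zero>\<^bsub>M\<^esub>} A M"
proof -
  assume M: "right_module A M"
  then interpret M: right_module A M .
  show "submodule (carrier M) A M" by (rule submoduleI_right[OF M]) (auto simp: M.act_closed)
  show "submodule {\<zero>\<^bsub>M\<^esub>} A M" by (rule submoduleI_right[OF M]) (auto simp: M.act_r_null)
qed

lemma submodule_image:
  assumes M: "right_module A M" and N: "right_module A N" and f: "f \<in> rmod_hom A M N"
    and U: "submodule U A M"
  shows "submodule (f ` U) A N"
proof (rule submoduleI_right[OF N])
  note Us = subsetD[OF submodule_subset[OF U]]
  show "f ` U \<subseteq> carrier N" using rmod_hom_closed[OF f] Us by auto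
  show "\<zero>\<^bsub>N\<^esub> \<in> f ` U"
    using rmod_hom_zero[OF M N f] submodule_zero[OF U] by (metis imageI)
  fix x y assume "x \<in> f ` U" "y \<in> f ` U"
  then obtain u v where "u \<in> U" "v \<in> U" "x = f u" "y = f v" by auto
  then show "x \<oplus>\<^bsub>N\<^esub> y \<in> f ` U"
    using rmod_hom_add[OF f, of u v] Us submodule_add[OF U, of u v]
    by (intro image_eqI[of _ _ "u \<oplus>\<^bsub>M\<^esub> v"]) auto
next
  fix a x assume a: "a \<in> carrier A" and "x \<in> f ` U"
  then obtain u where u: "u \<in> U" "x = f u" by auto
  then show "a \<odot>\<^bsub>N\<^esub> x \<in> f ` U"
    using rmod_hom_act[OF f a, of u] submodule_subset[OF U] submodule_act[OF U a]
    by (intro image_eqI[of _ _ "a \<odot>\<^bsub>M\<^esub> u"]) auto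
qed

lemma submodule_vimage:
  assumes M: "right_module A M" and N: "right_module A N" and f: "f \<in> rmod_hom A M N"
    and V: "submodule V A N"
  shows "submodule {x \<in> carrier M. f x \<in> V} A M"
proof -
  interpret M: right_module A M by fact
  show ?thesis
    by (rule submoduleI_right[OF M])
      (use f V in \<open>auto simp: rmod_hom_zero[OF M N f] rmod_hom_add rmod_hom_act M.act_closed
        submodule_zero submodule_add submodule_act\<close>)
qed

lemma a_kernel_eq: "a_kernel M N f = {x \<in> carrier M. f x = \<zero>\<^bsub>N\<^esub>}"
  by (simp add: a_kernel_def')

lemma submodule_kernel:
  assumes "right_module A M" "right_module A N" "f \<in> rmod_hom A M N"
  shows "submodule (a_kernel M N f) A M"
  using submodule_vimage[OF assms submodule_zero_set[OF assms(2)]] by (simp add: a_kernel_eq)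

lemma rmod_inj_iff_kernel:
  assumes M: "right_module A M" and N: "right_module A N" and f: "f \<in> rmod_hom A M N"
  shows "inj_on f (carrier M) \<longleftrightarrow> a_kernel M N f = {\<zero>\<^bsub>M\<^esub>}"
proof
  interpret M: right_module A M by fact
  show "a_kernel M N f = {\<zero>\<^bsub>M\<^esub>}" if "inj_on f (carrier M)"
  proof -
    have "x = \<zero>\<^bsub>M\<^esub>" if "x \<in> carrier M" "f x = \<zero>\<^bsub>N\<^esub>" for x
      using inj_onD[OF \<open>inj_on f (carrier M)\<close>, of x "\<zero>\<^bsub>M\<^esub>"] that rmod_hom_zero[OF assms] by simp
    then show ?thesis using rmod_hom_zero[OF assms] by (auto simp: a_kernel_eq)
  qed
  interpret N: right_module A N by fact
  show "inj_on f (carrier M)" if k: "a_kernel M N f = {\<zero>\<^bsub>M\<^esub>}"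
  proof (rule inj_onI)
    fix x y assume xy: "x \<in> carrier M" "y \<in> carrier M" "f x = f y"
    then have "f (x \<ominus>\<^bsub>M\<^esub> y) = \<zero>\<^bsub>N\<^esub>"
      using rmod_hom_closed[OF f, of y] rmod_hom_minus[OF assms, of x y]
      by (simp add: a_minus_def N.M.r_neg)
    then have "x \<ominus>\<^bsub>M\<^esub> y = \<zero>\<^bsub>M\<^esub>" using k xy by (auto simp: a_kernel_eq)
    moreover have "(x \<ominus>\<^bsub>M\<^esub> y) \<oplus>\<^bsub>M\<^esub> y = x"
      using xy by (simp add: a_minus_def M.M.a_assoc M.M.l_neg)
    ultimately show "x = y" using xy by simp
  qed
qed

lemma submodule_set_add:
  assumes M: "right_module A M" and U: "submodule U A M" and V: "submodule V A M"
  shows "submodule (U <+>\<^bsub>M\<^esub> V) A M"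
proof -
  interpret M: right_module A M by fact
  note s = subsetD[OF submodule_subset[OF U]] subsetD[OF submodule_subset[OF V]]
  show ?thesis
  proof (rule submoduleI_right[OF M])
    show "U <+>\<^bsub>M\<^esub> V \<subseteq> carrier M" by (auto simp: set_add_def' s)
    show "\<zero>\<^bsub>M\<^esub> \<in> U <+>\<^bsub>M\<^esub> V"
      using submodule_zero[OF U] submodule_zero[OF V]
      by (auto simp: set_add_def' intro!: bexI[of _ "\<zero>\<^bsub>M\<^esub>"])
  next
    fix x y assume "x \<in> U <+>\<^bsub>M\<^esub> V" "y \<in> U <+>\<^bsub>M\<^esub> V"
    then obtain u v u' v' where "u \<in> U" "v \<in> V" "x = u \<oplus>\<^bsub>M\<^esub> v" "u' \<in> U" "v' \<in> V" "y = u' \<oplus>\<^bsub>M\<^esub> v'"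
      by (auto simp: set_add_def')
    moreover from this have "x \<oplus>\<^bsub>M\<^esub> y = (u \<oplus>\<^bsub>M\<^esub> u') \<oplus>\<^bsub>M\<^esub> (v \<oplus>\<^bsub>M\<^esub> v')"
      by (simp add: s M.M.a_ac)
    ultimately show "x \<oplus>\<^bsub>M\<^esub> y \<in> U <+>\<^bsub>M\<^esub> V"
      using submodule_add[OF U, of u u'] submodule_add[OF V, of v v'] unfolding set_add_def' by blast
  next
    fix a x assume a: "a \<in> carrier A" and "x \<in> U <+>\<^bsub>M\<^esub> V"
    then obtain u v where "u \<in> U" "v \<in> V" "x = u \<oplus>\<^bsub>M\<^esub> v"
      by (auto simp: set_add_def')
    then show "a \<odot>\<^bsub>M\<^esub> x \<in> U <+>\<^bsub>M\<^esub> V"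
      using submodule_act[OF U a, of u] submodule_act[OF V a, of v] a
      by (auto simp: set_add_def' s M.act_r_distr)
  qed
qed

lemma rmod_hom_incl: "U \<subseteq> carrier M \<Longrightarrow> (\<lambda>x. x) \<in> rmod_hom A (M\<lparr>carrier := U\<rparr>) M"
  by (rule rmod_homI) auto

lemma rmod_hom_restrict:
  "f \<in> rmod_hom A M N \<Longrightarrow> U \<subseteq> carrier M \<Longrightarrow> f \<in> rmod_hom A (M\<lparr>carrier := U\<rparr>) N"
  using rmod_hom_comp[of "\<lambda>x. x" A "M\<lparr>carrier := U\<rparr>" M f N] rmod_hom_incl[of U M A] by simp

lemma rmod_hom_codomain:
  "f \<in> rmod_hom A M N \<Longrightarrow> f ` carrier M \<subseteq> V \<Longrightarrow> f \<in> rmod_hom A M (N\<lparr>carrier := V\<rparr>)"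
  by (auto simp: rmod_hom_def hom_def)

lemma rmod_hom_codomain_incl:
  "f \<in> rmod_hom A M (N\<lparr>carrier := V\<rparr>) \<Longrightarrow> V \<subseteq> carrier N \<Longrightarrow> f \<in> rmod_hom A M N"
  by (auto simp: rmod_hom_def hom_def)

section \<open>Direct sums\<close>

lemma direct_sum_simps [simp]:
  "carrier (direct_sum M N) = carrier M \<times> carrier N"
  "\<zero>\<^bsub>direct_sum M N\<^esub> = (\<zero>\<^bsub>M\<^esub>, \<zero>\<^bsub>N\<^esub>)"
  "z \<oplus>\<^bsub>direct_sum M N\<^esub> w = (fst z \<oplus>\<^bsub>M\<^esub> fst w, snd z \<oplus>\<^bsub>N\<^esub> snd w)"
  "a \<odot>\<^bsub>direct_sum M N\<^esub> z = (a \<odot>\<^bsub>M\<^esub> fst z, a \<odot>\<^bsub>N\<^esub> snd z)"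
  by (auto simp: direct_sum_def split: prod.split)

lemma right_module_direct_sum:
  assumes "right_module A M" "right_module A N"
  shows "right_module A (direct_sum M N)"
proof -
  interpret M: right_module A M by fact
  interpret N: right_module A N by fact
  show ?thesis
  proof (intro right_module.intro abelian_groupI right_module_axioms.intro)
    show "ring A" by (rule M.A.ring_axioms)
    fix x assume "x \<in> carrier (direct_sum M N)"
    then show "\<exists>y\<in>carrier (direct_sum M N). y \<oplus>\<^bsub>direct_sum M N\<^esub> x = \<zero>\<^bsub>direct_sum M N\<^esub>"
      by (intro bexI[of _ "(\<ominus>\<^bsub>M\<^esub> fst x, \<ominus>\<^bsub>N\<^esub> snd x)"]) (auto simp: M.M.l_neg N.M.l_neg)
  qed (auto simp: M.M.a_ac M.act_l_distr M.act_r_distr M.act_assoc M.act_one M.act_closed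
      N.M.a_ac N.act_l_distr N.act_r_distr N.act_assoc N.act_one N.act_closed)
qed

lemma rmod_hom_fst: "fst \<in> rmod_hom A (direct_sum M N) M"
  and rmod_hom_snd: "snd \<in> rmod_hom A (direct_sum M N) N"
  by (auto intro: rmod_homI)

lemma rmod_hom_Pair:
  "f \<in> rmod_hom A L M \<Longrightarrow> g \<in> rmod_hom A L N \<Longrightarrow> (\<lambda>x. (f x, g x)) \<in> rmod_hom A L (direct_sum M N)"
  by (rule rmod_homI) (auto simp: rmod_hom_closed rmod_hom_add rmod_hom_act)

lemma rmod_hom_zero_map:
  assumes "right_module A N"
  shows "(\<lambda>x. \<zero>\<^bsub>N\<^esub>) \<in> rmod_hom A M N"
proof -
  interpret N: right_module A N by fact
  show ?thesis by (rule rmod_homI) (auto simp: N.act_r_null)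
qed

lemma rmod_hom_inl: "right_module A N \<Longrightarrow> (\<lambda>x. (x, \<zero>\<^bsub>N\<^esub>)) \<in> rmod_hom A M (direct_sum M N)"
  and rmod_hom_inr: "right_module A M \<Longrightarrow> (\<lambda>x. (\<zero>\<^bsub>M\<^esub>, x)) \<in> rmod_hom A N (direct_sum M N)"
  by (auto intro!: rmod_hom_Pair rmod_hom_id rmod_hom_zero_map)

text \<open>Every \<open>x\<close> is \<open>i (r x)\<close> plus \<open>x - i (r x)\<close>, and
  \<open>r\<close> kills the second term; the complement of \<open>N\<close> is thus the kernel of
  the retraction. Splittings of projective presentations and direct summands are both obtained in
  this way.\<close>

lemma retract_direct_sum:
  assumes M: "right_module A M" and N: "right_module A N"
    and i: "i \<in> rmod_hom A N M" and r: "r \<in> rmod_hom A M N" and ri: "\<And>x. x \<in> carrier N \<Longrightarrow> r (i x) = x"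
  shows "rmod_iso A M (direct_sum N (M\<lparr>carrier := a_kernel M N r\<rparr>))"
proof -
  interpret M: right_module A M by (rule M)
  interpret N: right_module A N by (rule N)
  let ?K = "M\<lparr>carrier := a_kernel M N r\<rparr>"
  define s where "s = (\<lambda>x. x \<ominus>\<^bsub>M\<^esub> i (r x))"
  note cl = rmod_hom_closed[OF i] rmod_hom_closed[OF r]
  have s: "s \<in> rmod_hom A M M"
    unfolding s_def by (rule rmod_hom_diff[OF M rmod_hom_id rmod_hom_comp[OF r i]])
  have rs: "r (s x) = \<zero>\<^bsub>N\<^esub>" if "x \<in> carrier M" for x
    unfolding s_def using that rmod_hom_minus[OF M N r, of x "i (r x)"] cl
    by (simp add: ri a_minus_def N.M.r_neg)
  have rk: "r (i y \<oplus>\<^bsub>M\<^esub> k) = y" if "y \<in> carrier N" "k \<in> carrier ?K" for y k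
    using that cl rmod_hom_add[OF r, of "i y" k] by (simp add: ri a_kernel_eq)
  show ?thesis
  proof (rule rmod_isoI)
    have "s \<in> rmod_hom A M ?K"
      by (rule rmod_hom_codomain[OF s]) (use rs rmod_hom_closed[OF s] in \<open>auto simp: a_kernel_eq\<close>)
    then show "(\<lambda>x. (r x, s x)) \<in> rmod_hom A M (direct_sum N ?K)" by (rule rmod_hom_Pair[OF r])
    show "(\<lambda>z. i (fst z) \<oplus>\<^bsub>M\<^esub> snd z) \<in> rmod_hom A (direct_sum N ?K) M"
      by (intro rmod_hom_plus M rmod_hom_comp[OF rmod_hom_fst i] rmod_hom_codomain_incl[OF rmod_hom_snd])
        (auto simp: a_kernel_eq)
    show "i (fst (r x, s x)) \<oplus>\<^bsub>M\<^esub> snd (r x, s x) = x" if x: "x \<in> carrier M" for x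
    proof -
      have "i (r x) \<oplus>\<^bsub>M\<^esub> (x \<oplus>\<^bsub>M\<^esub> \<ominus>\<^bsub>M\<^esub> i (r x)) = x \<oplus>\<^bsub>M\<^esub> (i (r x) \<oplus>\<^bsub>M\<^esub> \<ominus>\<^bsub>M\<^esub> i (r x))"
        using x cl M.M.a_lcomm by simp
      then show ?thesis unfolding s_def using x cl by (simp add: a_minus_def M.M.r_neg)
    qed
    fix z assume "z \<in> carrier (direct_sum N ?K)"
    then have z: "fst z \<in> carrier N" "snd z \<in> carrier ?K" "snd z \<in> carrier M" by (auto simp: a_kernel_eq)
    have "s (i (fst z) \<oplus>\<^bsub>M\<^esub> snd z) = (i (fst z) \<oplus>\<^bsub>M\<^esub> snd z) \<ominus>\<^bsub>M\<^esub> i (fst z)"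
      unfolding s_def by (simp only: rk[OF z(1,2)])
    also have "\<dots> = snd z"
      using z cl by (simp add: a_minus_def M.M.a_comm[of "i (fst z)"] M.M.a_assoc M.M.r_neg)
    finally show "(r (i (fst z) \<oplus>\<^bsub>M\<^esub> snd z), s (i (fst z) \<oplus>\<^bsub>M\<^esub> snd z)) = z"
      using rk[OF z(1,2)] by simp
  qed
qed

section \<open>Length\<close>

text \<open>The number \<open>n\<close> counts strict steps, not submodules, and the end points are
  arbitrary. Length becomes the maximal number of steps: lengthening a chain proves monotonicity,
  and comparing chains proves additivity.\<close>

definition has_chain :: "('a, 'b) ring_scheme \<Rightarrow> ('a, 'm, 'd) module_scheme \<Rightarrow> nat \<Rightarrow> bool" where
  "has_chain A M n \<longleftrightarrow> (\<exists>U. (\<forall>i\<le>n. submodule (U i) A M) \<and> (\<forall>i<n. U i \<subset> U (Suc i)))"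

definition finite_length :: "('a, 'b) ring_scheme \<Rightarrow> ('a, 'm, 'd) module_scheme \<Rightarrow> bool" where
  "finite_length A M \<longleftrightarrow> (\<exists>b. \<forall>n. has_chain A M n \<longrightarrow> n \<le> b)"

text \<open>Meaningful under \<open>finite_length\<close>, where the numbers of steps are bounded; a
  chain with no step always exists.\<close>

definition len :: "('a, 'b) ring_scheme \<Rightarrow> ('a, 'm, 'd) module_scheme \<Rightarrow> nat" where
  "len A M = (GREATEST n. has_chain A M n)"

lemma has_chain_0: "right_module A M \<Longrightarrow> has_chain A M 0"
  unfolding has_chain_def by (rule exI[of _ "\<lambda>_. carrier M"]) (simp add: submodule_carrier)

lemma has_chain_len:
  assumes "right_module A M" "finite_length A M"
  shows "has_chain A M (len A M)"
  unfolding len_def using assms has_chain_0[OF assms(1)]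
  by (metis GreatestI_nat finite_length_def)

lemma has_chain_le_len: "finite_length A M \<Longrightarrow> has_chain A M n \<Longrightarrow> n \<le> len A M"
  unfolding len_def finite_length_def using Greatest_le_nat[of "has_chain A M"] by blast

lemma has_chain_submodule:
  assumes M: "right_module A M" and U: "submodule U A M" and "has_chain A (M\<lparr>carrier := U\<rparr>) n"
  obtains V where "\<And>i. i \<le> n \<Longrightarrow> submodule (V i) A M" "\<And>i. i \<le> n \<Longrightarrow> V i \<subseteq> U"
    "\<And>i. i < n \<Longrightarrow> V i \<subset> V (Suc i)"
  using assms(3) unfolding has_chain_def submodule_of_submodule[OF M U] by blast

lemma finite_length_submodule:
  assumes M: "right_module A M" and U: "submodule U A M" and fin: "finite_length A M"
  shows "finite_length A (M\<lparr>carrier := U\<rparr>)"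
proof -
  have "has_chain A M n" if n: "has_chain A (M\<lparr>carrier := U\<rparr>) n" for n
  proof -
    obtain V where V: "\<And>i. i \<le> n \<Longrightarrow> submodule (V i) A M" "\<And>i. i < n \<Longrightarrow> V i \<subset> V (Suc i)"
      by (rule has_chain_submodule[OF M U n]) blast
    show ?thesis unfolding has_chain_def by (rule exI[of _ V]) (simp add: V)
  qed
  with fin show ?thesis unfolding finite_length_def by blast
qed

lemma finite_length_subset:
  assumes M: "right_module A M" and UV: "submodule U A M" "submodule V A M" "U \<subseteq> V"
    and fin: "finite_length A (M\<lparr>carrier := V\<rparr>)"
  shows "finite_length A (M\<lparr>carrier := U\<rparr>)"
  using finite_length_submodule[OF right_module_submodule[OF M UV(2)], of U] fin UV
  by (simp add: submodule_of_submodule[OF M])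

text \<open>A longest chain inside \<open>U\<close> can be prolonged by \<open>V\<close> on
  top.\<close>

lemma len_strict_mono:
  assumes M: "right_module A M" and UV: "submodule U A M" "submodule V A M" "U \<subset> V"
    and fin: "finite_length A (M\<lparr>carrier := V\<rparr>)"
  shows "len A (M\<lparr>carrier := U\<rparr>) < len A (M\<lparr>carrier := V\<rparr>)"
proof -
  let ?n = "len A (M\<lparr>carrier := U\<rparr>)"
  have "finite_length A (M\<lparr>carrier := U\<rparr>)"
    using finite_length_subset[OF M UV(1,2)] UV(3) fin by auto
  then obtain W where W: "\<And>i. i \<le> ?n \<Longrightarrow> submodule (W i) A M" "\<And>i. i \<le> ?n \<Longrightarrow> W i \<subseteq> U"
      "\<And>i. i < ?n \<Longrightarrow> W i \<subset> W (Suc i)"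
    by (rule has_chain_submodule[OF M UV(1) has_chain_len[OF right_module_submodule[OF M UV(1)]]]) blast
  have "has_chain A (M\<lparr>carrier := V\<rparr>) (Suc ?n)"
    unfolding has_chain_def submodule_of_submodule[OF M UV(2)]
  proof (intro exI conjI allI impI)
    fix i
    show "submodule ((W(Suc ?n := V)) i) A M" if "i \<le> Suc ?n"
      using that W(1)[of i] UV(2) by auto
    show "(W(Suc ?n := V)) i \<subseteq> V" if "i \<le> Suc ?n"
      using that W(2)[of i] UV(3) by (cases "i = Suc ?n") auto
    show "(W(Suc ?n := V)) i \<subset> (W(Suc ?n := V)) (Suc i)" if "i < Suc ?n"
    proof (cases "i = ?n")
      case True
      then show ?thesis using W(2)[of ?n] UV(3) by auto
    next
      case False
      then show ?thesis using W(3)[of i] that by auto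
    qed
  qed
  then show ?thesis using has_chain_le_len[OF fin] by force
qed

lemma len_mono:
  assumes M: "right_module A M" and UV: "submodule U A M" "submodule V A M" "U \<subseteq> V"
    and fin: "finite_length A (M\<lparr>carrier := V\<rparr>)"
  shows "len A (M\<lparr>carrier := U\<rparr>) \<le> len A (M\<lparr>carrier := V\<rparr>)"
  using len_strict_mono[OF assms(1-3) _ fin] UV(3) by (cases "U = V") (simp_all add: psubsetI)

lemma len_submodule_le:
  assumes "right_module A M" "submodule U A M" "finite_length A M"
  shows "len A (M\<lparr>carrier := U\<rparr>) \<le> len A M"
  using len_mono[OF assms(1,2) submodule_carrier[OF assms(1)] submodule_subset[OF assms(2)]] assms(3)
  by simp

lemma submodule_eq_carrier:
  assumes "right_module A M" "submodule U A M" "finite_length A M"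
    and "len A M \<le> len A (M\<lparr>carrier := U\<rparr>)"
  shows "U = carrier M"
proof (rule ccontr)
  assume "U \<noteq> carrier M"
  then have "U \<subset> carrier M" using submodule_subset[OF assms(2)] by blast
  from len_strict_mono[OF assms(1,2) submodule_carrier[OF assms(1)] this] assms(3,4)
  show False by simp
qed

lemma submodule_Int:
  assumes M: "right_module A M" and U: "submodule U A M" and V: "submodule V A M"
  shows "submodule (U \<inter> V) A M"
  by (rule submoduleI_right[OF M])
    (use submodule_subset[OF U] in \<open>auto simp: submodule_zero[OF U] submodule_zero[OF V]
      submodule_add[OF U] submodule_add[OF V] submodule_act[OF U] submodule_act[OF V]\<close>)

text \<open>Each member \<open>U i\<close> of the chain is measured by the length \<open>a i\<close>
  of its intersection with the kernel and the length \<open>b i\<close> of its image. Both grow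
  weakly, and at every step at least one grows strictly, so \<open>a i + b i\<close> is at least
  \<open>i\<close>.\<close>

lemma chain_le_length_sum:
  assumes M: "right_module A M" and N: "right_module A N" and f: "f \<in> rmod_hom A M N"
    and finK: "finite_length A (M\<lparr>carrier := a_kernel M N f\<rparr>)" and finN: "finite_length A N"
    and chain: "has_chain A M n"
  shows "n \<le> len A (M\<lparr>carrier := a_kernel M N f\<rparr>) + len A N"
proof -
  interpret M: right_module A M by fact
  interpret N: right_module A N by fact
  let ?K = "a_kernel M N f"
  have K: "submodule ?K A M" by (rule submodule_kernel[OF M N f])
  obtain U where U: "\<And>i. i \<le> n \<Longrightarrow> submodule (U i) A M" "\<And>i. i < n \<Longrightarrow> U i \<subset> U (Suc i)"
    using chain unfolding has_chain_def by blast
  define a where "a i = len A (M\<lparr>carrier := U i \<inter> ?K\<rparr>)" for i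
  define b where "b i = len A (N\<lparr>carrier := f ` U i\<rparr>)" for i
  have UK: "submodule (U i \<inter> ?K) A M" if "i \<le> n" for i
    using submodule_Int[OF M U(1) K] that by simp
  have fU: "submodule (f ` U i) A N" if "i \<le> n" for i
    using submodule_image[OF M N f U(1)[OF that]] .
  have finUK: "finite_length A (M\<lparr>carrier := U i \<inter> ?K\<rparr>)" if "i \<le> n" for i
    by (rule finite_length_subset[OF M UK[OF that] K _ finK]) auto
  have finfU: "finite_length A (N\<lparr>carrier := f ` U i\<rparr>)" if "i \<le> n" for i
    by (rule finite_length_submodule[OF N fU[OF that] finN])
  have "i \<le> a i + b i" if "i \<le> n" for i
    using that
  proof (induction i)
    case (Suc i)
    have UU: "U i \<subset> U (Suc i)" using U(2) Suc.prems by simp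
    have le: "a i \<le> a (Suc i)" "b i \<le> b (Suc i)"
      unfolding a_def b_def using Suc.prems UU
      by (auto intro!: len_mono[OF M UK UK _ finUK] len_mono[OF N fU fU _ finfU])
    \<comment> \<open>The modular law: if traces on the kernel and images both agree, then
      \<open>x\<close> in the larger member has the image of some \<open>u\<close> in the smaller
      one, and \<open>x - u\<close> lies in the common trace.\<close>
    have "U i \<inter> ?K \<noteq> U (Suc i) \<inter> ?K \<or> f ` U i \<noteq> f ` U (Suc i)"
    proof (rule ccontr)
      assume eq: "\<not> ?thesis"
      have "x \<in> U i" if x: "x \<in> U (Suc i)" for x
      proof -
        have x': "x \<in> carrier M" using x submodule_subset[OF U(1)[OF Suc.prems]] by auto
        obtain u where u: "u \<in> U i" "f x = f u" using eq x by blast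
        have u': "u \<in> carrier M" using u submodule_subset[OF U(1), of i] Suc.prems by auto
        have "x \<ominus>\<^bsub>M\<^esub> u \<in> U (Suc i)"
          using submodule_minus[OF U(1)[OF Suc.prems]] x u UU by auto
        moreover have "f (x \<ominus>\<^bsub>M\<^esub> u) = \<zero>\<^bsub>N\<^esub>"
          using rmod_hom_minus[OF M N f x' u'] u rmod_hom_closed[OF f u'] by (simp add: a_minus_def N.M.r_neg)
        ultimately have "x \<ominus>\<^bsub>M\<^esub> u \<in> U (Suc i) \<inter> ?K" using x' u' by (auto simp: a_kernel_eq)
        then have "x \<ominus>\<^bsub>M\<^esub> u \<in> U i" using eq by auto
        then have "(x \<ominus>\<^bsub>M\<^esub> u) \<oplus>\<^bsub>M\<^esub> u \<in> U i" using submodule_add[OF U(1)] u Suc.prems by simp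
        then show ?thesis using x' u' by (simp add: a_minus_def M.M.a_assoc M.M.l_neg)
      qed
      then show False using UU by auto
    qed
    then have "a i < a (Suc i) \<or> b i < b (Suc i)"
    proof
      assume "U i \<inter> ?K \<noteq> U (Suc i) \<inter> ?K"
      then have "U i \<inter> ?K \<subset> U (Suc i) \<inter> ?K" using UU by auto
      then have "a i < a (Suc i)" unfolding a_def
        using Suc.prems by (intro len_strict_mono[OF M UK UK _ finUK]) auto
      then show ?thesis ..
    next
      assume "f ` U i \<noteq> f ` U (Suc i)"
      then have "f ` U i \<subset> f ` U (Suc i)" using UU by auto
      then have "b i < b (Suc i)" unfolding b_def
        using Suc.prems by (intro len_strict_mono[OF N fU fU _ finfU]) auto
      then show ?thesis ..
    qed
    then show ?case using Suc.IH Suc.prems le by linarith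
  qed simp
  moreover have "a n \<le> len A (M\<lparr>carrier := ?K\<rparr>)"
    unfolding a_def by (rule len_mono[OF M UK K _ finK]) auto
  moreover have "b n \<le> len A N" unfolding b_def by (rule len_submodule_le[OF N fU finN]) simp
  ultimately show ?thesis by (meson add_mono le_trans order_refl)
qed

text \<open>A chain in the kernel is continued by the preimages of a chain in \<open>N\<close>.
  Preimages stay strictly increasing because \<open>f\<close> is onto.\<close>

lemma has_chain_vimage:
  assumes M: "right_module A M" and N: "right_module A N" and f: "f \<in> rmod_hom A M N"
    and surj: "f ` carrier M = carrier N"
    and k: "has_chain A (M\<lparr>carrier := a_kernel M N f\<rparr>) k" and n: "has_chain A N n"
  shows "has_chain A M (k + n)"
proof -
  obtain V where V: "\<And>i. i \<le> k \<Longrightarrow> submodule (V i) A M" "\<And>i. i \<le> k \<Longrightarrow> V i \<subseteq> a_kernel M N f"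
      "\<And>i. i < k \<Longrightarrow> V i \<subset> V (Suc i)"
    by (rule has_chain_submodule[OF M submodule_kernel[OF M N f] k]) blast
  obtain W where W: "\<And>i. i \<le> n \<Longrightarrow> submodule (W i) A N" "\<And>i. i < n \<Longrightarrow> W i \<subset> W (Suc i)"
    using n unfolding has_chain_def by blast
  define P where "P i = {x \<in> carrier M. f x \<in> W i}" for i
  \<comment> \<open>The preimage \<open>P 0\<close> is left out, as it may coincide with
    \<open>V k\<close>. The step at the seam goes from \<open>V k\<close>, contained in
    \<open>P 0\<close>, to \<open>P 1\<close>, and is strict.\<close>
  define U where "U i = (if i \<le> k then V i else P (i - k))" for i
  have P: "submodule (P i) A M" if "i \<le> n" for i
    unfolding P_def by (rule submodule_vimage[OF M N f W(1)[OF that]])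
  have PP: "P i \<subset> P (Suc i)" if "i < n" for i
  proof -
    obtain y where "y \<in> W (Suc i)" "y \<notin> W i" using W(2)[OF \<open>i < n\<close>] by blast
    moreover from this obtain x where "x \<in> carrier M" "y = f x"
      using surj submodule_subset[OF W(1), of "Suc i"] \<open>i < n\<close> by auto
    ultimately show ?thesis using W(2)[OF that] unfolding P_def by auto
  qed
  have VP: "V k \<subseteq> P 0"
    using V(2)[of k] submodule_zero[OF W(1), of 0] by (auto simp: P_def a_kernel_eq)
  show ?thesis
    unfolding has_chain_def
  proof (intro exI conjI allI impI)
    show "submodule (U i) A M" if "i \<le> k + n" for i
      using that V(1) P by (auto simp: U_def)
    show "U i \<subset> U (Suc i)" if i: "i < k + n" for i
    proof (cases rule: linorder_cases[of i k])
      case less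
      then show ?thesis using V(3) by (simp add: U_def)
    next
      case equal
      then show ?thesis using VP PP[of 0] i by (auto simp: U_def)
    next
      case greater
      then have "Suc i - k = Suc (i - k)" "i - k < n" using i by auto
      then show ?thesis using PP[of "i - k"] greater by (simp add: U_def)
    qed
  qed
qed

lemma finite_length_extension:
  assumes M: "right_module A M" and N: "right_module A N" and f: "f \<in> rmod_hom A M N"
    and "finite_length A (M\<lparr>carrier := a_kernel M N f\<rparr>)" "finite_length A N"
  shows "finite_length A M"
  using chain_le_length_sum[OF assms] unfolding finite_length_def[of A M] by blast

lemma finite_length_quotient:
  assumes M: "right_module A M" and N: "right_module A N" and f: "f \<in> rmod_hom A M N"
    and surj: "f ` carrier M = carrier N" and fin: "finite_length A M"
  shows "finite_length A N"
proof -
  have "has_chain A M n" if "has_chain A N n" for n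
    using has_chain_vimage[OF M N f surj has_chain_0[OF right_module_submodule] that]
      M submodule_kernel[OF M N f] by simp
  then show ?thesis using fin unfolding finite_length_def by blast
qed

lemma len_additive:
  assumes M: "right_module A M" and N: "right_module A N" and f: "f \<in> rmod_hom A M N"
    and surj: "f ` carrier M = carrier N" and fin: "finite_length A M"
  shows "len A M = len A (M\<lparr>carrier := a_kernel M N f\<rparr>) + len A N"
proof (rule antisym)
  note K = submodule_kernel[OF M N f]
  have finK: "finite_length A (M\<lparr>carrier := a_kernel M N f\<rparr>)"
    by (rule finite_length_submodule[OF M K fin])
  have finN: "finite_length A N" by (rule finite_length_quotient[OF assms])
  show "len A M \<le> len A (M\<lparr>carrier := a_kernel M N f\<rparr>) + len A N"
    by (rule chain_le_length_sum[OF M N f finK finN has_chain_len[OF M fin]])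
  show "len A (M\<lparr>carrier := a_kernel M N f\<rparr>) + len A N \<le> len A M"
    by (rule has_chain_le_len[OF fin has_chain_vimage[OF M N f surj
      has_chain_len[OF right_module_submodule[OF M K] finK] has_chain_len[OF N finN]]])
qed

lemma has_chain_zero_module:
  assumes "right_module A M" "carrier M = {\<zero>\<^bsub>M\<^esub>}" "has_chain A M n"
  shows "n = 0"
proof (rule ccontr)
  assume "n \<noteq> 0"
  with assms(3) obtain U V where UV: "submodule U A M" "submodule V A M" "U \<subset> V"
    unfolding has_chain_def using Suc_leI[of 0 n] by blast
  then show False
    using submodule_subset[OF UV(2)] submodule_zero[OF UV(1)] assms(2) by auto
qed

lemma finite_length_zero_module:
  "right_module A M \<Longrightarrow> carrier M = {\<zero>\<^bsub>M\<^esub>} \<Longrightarrow> finite_length A M"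
  unfolding finite_length_def using has_chain_zero_module by blast

lemma len_zero_module: "right_module A M \<Longrightarrow> carrier M = {\<zero>\<^bsub>M\<^esub>} \<Longrightarrow> len A M = 0"
  using has_chain_zero_module has_chain_len finite_length_zero_module by blast

text \<open>By additivity the kernel has length \<open>len A M - len A N\<close>, and only the zero
  submodule has length 0. For endomorphisms: onto implies injective.\<close>

lemma len_inj_surj:
  assumes M: "right_module A M" and N: "right_module A N" and f: "f \<in> rmod_hom A M N"
    and surj: "f ` carrier M = carrier N" and fin: "finite_length A M"
  shows "inj_on f (carrier M) \<longleftrightarrow> len A N = len A M"
proof -
  note K = submodule_kernel[OF M N f]
  let ?K = "M\<lparr>carrier := a_kernel M N f\<rparr>"
  have "a_kernel M N f = {\<zero>\<^bsub>M\<^esub>} \<longleftrightarrow> len A ?K = 0"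
  proof
    show "len A ?K = 0" if "a_kernel M N f = {\<zero>\<^bsub>M\<^esub>}"
      using len_zero_module[OF right_module_submodule[OF M K]] that by simp
    show "a_kernel M N f = {\<zero>\<^bsub>M\<^esub>}" if "len A ?K = 0"
      using len_strict_mono[OF M submodule_zero_set[OF M] K _ finite_length_submodule[OF M K fin]]
        submodule_zero[OF K] that by auto
  qed
  then show ?thesis
    unfolding rmod_inj_iff_kernel[OF M N f] using len_additive[OF assms] by simp
qed

lemma finite_length_iso:
  assumes "rmod_iso A M N" "right_module A M" "right_module A N" "finite_length A M"
  shows "finite_length A N"
proof -
  obtain f where "f \<in> rmod_hom A M N" "f ` carrier M = carrier N"
    using assms(1) by (auto simp: rmod_iso_def bij_betw_def)
  from finite_length_quotient[OF assms(2,3) this assms(4)] show ?thesis .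
qed

lemma len_iso:
  assumes "rmod_iso A M N" "right_module A M" "right_module A N" "finite_length A M"
  shows "len A M = len A N"
proof -
  obtain f where "f \<in> rmod_hom A M N" "f ` carrier M = carrier N" "inj_on f (carrier M)"
    using assms(1) by (auto simp: rmod_iso_def bij_betw_def)
  with len_inj_surj[OF assms(2,3) this(1,2) assms(4)] show ?thesis by simp
qed

lemma direct_sum_kernel:
  assumes M: "right_module A M" and N: "right_module A N"
  shows "rmod_iso A ((direct_sum M N)\<lparr>carrier := a_kernel (direct_sum M N) M fst\<rparr>) N"
proof (rule rmod_isoI)
  let ?K = "a_kernel (direct_sum M N) M fst"
  interpret M: right_module A M by fact
  have K: "?K = {\<zero>\<^bsub>M\<^esub>} \<times> carrier N" by (auto simp: a_kernel_eq)
  show "snd \<in> rmod_hom A ((direct_sum M N)\<lparr>carrier := ?K\<rparr>) N"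
    by (rule rmod_hom_restrict[OF rmod_hom_snd]) (auto simp: a_kernel_eq)
  show "(\<lambda>x. (\<zero>\<^bsub>M\<^esub>, x)) \<in> rmod_hom A N ((direct_sum M N)\<lparr>carrier := ?K\<rparr>)"
    by (rule rmod_hom_codomain[OF rmod_hom_inr[OF M]]) (auto simp: K)
qed (auto simp: a_kernel_eq)

lemma finite_length_direct_sum:
  assumes M: "right_module A M" and N: "right_module A N"
    and fin: "finite_length A M" "finite_length A N"
  shows "finite_length A (direct_sum M N)"
proof -
  note MN = right_module_direct_sum[OF M N]
  note K = right_module_submodule[OF MN submodule_kernel[OF MN M rmod_hom_fst]]
  show ?thesis
    by (rule finite_length_extension[OF MN M rmod_hom_fst _ fin(1)])
      (rule finite_length_iso[OF rmod_iso_sym[OF direct_sum_kernel[OF M N] K N] N K fin(2)])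
qed

lemma len_direct_sum:
  assumes M: "right_module A M" and N: "right_module A N"
    and fin: "finite_length A M" "finite_length A N"
  shows "len A (direct_sum M N) = len A M + len A N"
proof -
  interpret N: right_module A N by fact
  note MN = right_module_direct_sum[OF M N]
  note K = submodule_kernel[OF MN M rmod_hom_fst]
  note finMN = finite_length_direct_sum[OF assms]
  have "fst ` carrier (direct_sum M N) = carrier M"
    using N.M.zero_closed by (auto simp: image_iff)
  from len_additive[OF MN M rmod_hom_fst this finMN] show ?thesis
    using len_iso[OF direct_sum_kernel[OF M N] right_module_submodule[OF MN K] N
        finite_length_submodule[OF MN K finMN]] by simp
qed

section \<open>Finite generation\<close>

lemma (in right_module) act_finsum:
  assumes "finite S" "a \<in> carrier A" "f \<in> S \<rightarrow> carrier M"
  shows "a \<odot>\<^bsub>M\<^esub> (\<Oplus>\<^bsub>M\<^esub>s\<in>S. f s) = (\<Oplus>\<^bsub>M\<^esub>s\<in>S. a \<odot>\<^bsub>M\<^esub> f s)"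
  using assms(1,3)
proof (induction S)
  case empty
  show ?case using assms(2) by (simp add: act_r_null)
next
  case (insert s S)
  then have "f s \<in> carrier M" "f \<in> S \<rightarrow> carrier M" "(\<lambda>s. a \<odot>\<^bsub>M\<^esub> f s) \<in> S \<rightarrow> carrier M"
      "a \<odot>\<^bsub>M\<^esub> f s \<in> carrier M"
    using assms(2) by (auto intro!: act_closed)
  with insert assms(2) show ?case by (simp add: act_r_distr)
qed

text \<open>The set from \<open>finitely_generated_def\<close> as an operator, to be recognised
  below as the least submodule containing a finite \<open>S\<close>.\<close>

definition lin_span :: "('a, 'b) ring_scheme \<Rightarrow> ('a, 'm, 'd) module_scheme \<Rightarrow> 'm set \<Rightarrow> 'm set" where
  "lin_span A M S = {\<Oplus>\<^bsub>M\<^esub>s\<in>S. c s \<odot>\<^bsub>M\<^esub> s |c. c \<in> S \<rightarrow> carrier A}"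

lemma lin_span_submodule:
  assumes M: "right_module A M" and S: "finite S" "S \<subseteq> carrier M"
  shows "submodule (lin_span A M S) A M"
proof -
  interpret M: right_module A M by fact
  have cl: "(\<lambda>s. c s \<odot>\<^bsub>M\<^esub> s) \<in> S \<rightarrow> carrier M" if "c \<in> S \<rightarrow> carrier A" for c
    using that S by (auto intro!: M.act_closed)
  show ?thesis
  proof (rule submoduleI_right[OF M])
    show "lin_span A M S \<subseteq> carrier M"
      using cl by (auto simp: lin_span_def intro!: M.M.finsum_closed)
    have "(\<Oplus>\<^bsub>M\<^esub>s\<in>S. \<zero>\<^bsub>A\<^esub> \<odot>\<^bsub>M\<^esub> s) = \<zero>\<^bsub>M\<^esub>"
      using S by (intro M.M.add.finprod_one_eqI) (auto simp: M.act_l_null)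
    then show "\<zero>\<^bsub>M\<^esub> \<in> lin_span A M S"
      unfolding lin_span_def by (intro CollectI exI[of _ "\<lambda>_. \<zero>\<^bsub>A\<^esub>"]) auto
  next
    fix x y assume "x \<in> lin_span A M S" "y \<in> lin_span A M S"
    then obtain c d where cd: "c \<in> S \<rightarrow> carrier A" "x = (\<Oplus>\<^bsub>M\<^esub>s\<in>S. c s \<odot>\<^bsub>M\<^esub> s)"
        "d \<in> S \<rightarrow> carrier A" "y = (\<Oplus>\<^bsub>M\<^esub>s\<in>S. d s \<odot>\<^bsub>M\<^esub> s)"
      unfolding lin_span_def by blast
    have "x \<oplus>\<^bsub>M\<^esub> y = (\<Oplus>\<^bsub>M\<^esub>s\<in>S. c s \<odot>\<^bsub>M\<^esub> s \<oplus>\<^bsub>M\<^esub> d s \<odot>\<^bsub>M\<^esub> s)"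
      unfolding cd using cl cd by (simp add: M.M.finsum_addf)
    also have "\<dots> = (\<Oplus>\<^bsub>M\<^esub>s\<in>S. (c s \<oplus>\<^bsub>A\<^esub> d s) \<odot>\<^bsub>M\<^esub> s)"
      using cd S by (intro M.M.finsum_cong') (auto simp: Pi_iff subset_iff M.act_l_distr intro!: M.act_closed)
    finally show "x \<oplus>\<^bsub>M\<^esub> y \<in> lin_span A M S"
      unfolding lin_span_def using cd by (intro CollectI exI[of _ "\<lambda>s. c s \<oplus>\<^bsub>A\<^esub> d s"]) auto
  next
    fix a x assume a: "a \<in> carrier A" and "x \<in> lin_span A M S"
    then obtain c where c: "c \<in> S \<rightarrow> carrier A" "x = (\<Oplus>\<^bsub>M\<^esub>s\<in>S. c s \<odot>\<^bsub>M\<^esub> s)"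
      unfolding lin_span_def by blast
    have "a \<odot>\<^bsub>M\<^esub> x = (\<Oplus>\<^bsub>M\<^esub>s\<in>S. a \<odot>\<^bsub>M\<^esub> (c s \<odot>\<^bsub>M\<^esub> s))"
      unfolding c by (rule M.act_finsum[OF S(1) a cl[OF c(1)]])
    \<comment> \<open>For a right action, \<open>c s\<close> followed by \<open>a\<close> is the
      action of \<open>c s \<otimes> a\<close>, with the new factor on the right.\<close>
    also have "\<dots> = (\<Oplus>\<^bsub>M\<^esub>s\<in>S. (c s \<otimes>\<^bsub>A\<^esub> a) \<odot>\<^bsub>M\<^esub> s)"
      using c S a by (intro M.M.finsum_cong') (auto simp: Pi_iff subset_iff M.act_assoc intro!: M.act_closed)
    finally show "a \<odot>\<^bsub>M\<^esub> x \<in> lin_span A M S"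
      unfolding lin_span_def using c a by (intro CollectI exI[of _ "\<lambda>s. c s \<otimes>\<^bsub>A\<^esub> a"]) auto
  qed
qed

lemma lin_span_superset:
  assumes M: "right_module A M" and S: "finite S" "S \<subseteq> carrier M"
  shows "S \<subseteq> lin_span A M S"
proof
  interpret M: right_module A M by fact
  fix t assume t: "t \<in> S"
  let ?c = "\<lambda>s. if t = s then \<one>\<^bsub>A\<^esub> else \<zero>\<^bsub>A\<^esub>"
  have "(\<Oplus>\<^bsub>M\<^esub>s\<in>S. ?c s \<odot>\<^bsub>M\<^esub> s) = (\<Oplus>\<^bsub>M\<^esub>s\<in>S. if t = s then s else \<zero>\<^bsub>M\<^esub>)"
    using S by (intro M.M.finsum_cong') (auto simp: subset_iff M.act_one M.act_l_null)
  also have "\<dots> = t" using M.M.finsum_singleton[OF t S(1), of "\<lambda>s. s"] S by auto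
  finally show "t \<in> lin_span A M S"
    unfolding lin_span_def by (intro CollectI exI[of _ ?c]) auto
qed

lemma lin_span_least:
  assumes M: "right_module A M" and S: "finite S" and U: "submodule U A M" and SU: "S \<subseteq> U"
  shows "lin_span A M S \<subseteq> U"
proof
  interpret M: right_module A M by fact
  fix x assume "x \<in> lin_span A M S"
  then obtain c where c: "c \<in> S \<rightarrow> carrier A" "x = (\<Oplus>\<^bsub>M\<^esub>s\<in>S. c s \<odot>\<^bsub>M\<^esub> s)"
    unfolding lin_span_def by blast
  have "(\<Oplus>\<^bsub>M\<^esub>s\<in>S. c s \<odot>\<^bsub>M\<^esub> s) \<in> U"
    using S SU c(1)
  proof (induction S)
    case empty
    then show ?case using submodule_zero[OF U] by simp
  next
    case (insert s S)
    have cs: "c t \<odot>\<^bsub>M\<^esub> t \<in> U" if "t \<in> insert s S" for t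
      using submodule_act[OF U] insert.prems that by auto
    then have cl: "c t \<odot>\<^bsub>M\<^esub> t \<in> carrier M" if "t \<in> insert s S" for t
      using submodule_subset[OF U] that by auto
    have "(\<Oplus>\<^bsub>M\<^esub>t\<in>insert s S. c t \<odot>\<^bsub>M\<^esub> t) = c s \<odot>\<^bsub>M\<^esub> s \<oplus>\<^bsub>M\<^esub> (\<Oplus>\<^bsub>M\<^esub>t\<in>S. c t \<odot>\<^bsub>M\<^esub> t)"
      using insert.hyps cl by (intro M.M.finsum_insert) auto
    moreover have "\<dots> \<in> U"
      using submodule_add[OF U cs] insert by auto
    ultimately show ?case by simp
  qed
  then show "x \<in> U" unfolding c(2) .
qed

lemma finitely_generated_iff_span:
  "finitely_generated A M \<longleftrightarrow> (\<exists>S. finite S \<and> S \<subseteq> carrier M \<and> lin_span A M S = carrier M)"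
  unfolding finitely_generated_def lin_span_def by (metis (no_types, lifting))

text \<open>Lengths of spans of finite sets are bounded by \<open>len A M\<close>, so some finite
  \<open>S\<close> has a span of maximal length. An element outside that span would lengthen
  it.\<close>

lemma finite_length_imp_fg:
  assumes M: "right_module A M" and fin: "finite_length A M"
  shows "finitely_generated A M"
proof -
  define l where "l S = len A (M\<lparr>carrier := lin_span A M S\<rparr>)" for S
  have bound: "l S \<le> len A M" if "finite S" "S \<subseteq> carrier M" for S
    unfolding l_def by (rule len_submodule_le[OF M lin_span_submodule[OF M that] fin])
  let ?P = "\<lambda>n. \<exists>S. finite S \<and> S \<subseteq> carrier M \<and> l S = n"
  have "?P (l {})" by auto
  then have "?P (GREATEST n. ?P n)"
    by (rule GreatestI_nat[where b = "len A M"]) (use bound in auto)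
  then obtain S where S: "finite S" "S \<subseteq> carrier M" "l S = (GREATEST n. ?P n)" by blast
  have max: "l T \<le> l S" if "finite T" "T \<subseteq> carrier M" for T
    unfolding S(3) by (rule Greatest_le_nat[where b = "len A M"]) (use that bound in auto)
  have "x \<in> lin_span A M S" if x: "x \<in> carrier M" for x
  proof (rule ccontr)
    assume nx: "x \<notin> lin_span A M S"
    have T: "finite (insert x S)" "insert x S \<subseteq> carrier M" using x S by auto
    note sub = lin_span_superset[OF M T]
    have "lin_span A M S \<subset> lin_span A M (insert x S)"
      using lin_span_least[OF M S(1) lin_span_submodule[OF M T]] sub nx by blast
    then have "l S < l (insert x S)"
      unfolding l_def by (intro len_strict_mono[OF M] lin_span_submodule M S(1,2) T
        finite_length_submodule[OF M _ fin]) auto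
    then show False using max[OF T] by simp
  qed
  then have "lin_span A M S = carrier M"
    using submodule_subset[OF lin_span_submodule[OF M S(1,2)]] by auto
  then show ?thesis using S by (auto simp: finitely_generated_iff_span)
qed

section \<open>The regular right module and rings of finite length\<close>

definition regular_module :: "('a, 'b) ring_scheme \<Rightarrow> ('a, 'a) module" where
  "regular_module A = \<lparr>carrier = carrier A, monoid.mult = undefined, monoid.one = undefined,
     ring.zero = \<zero>\<^bsub>A\<^esub>, ring.add = add A, smult = (\<lambda>a x. x \<otimes>\<^bsub>A\<^esub> a)\<rparr>"

lemma regular_module_simps [simp]:
  "carrier (regular_module A) = carrier A" "\<zero>\<^bsub>regular_module A\<^esub> = \<zero>\<^bsub>A\<^esub>"
  "x \<oplus>\<^bsub>regular_module A\<^esub> y = x \<oplus>\<^bsub>A\<^esub> y" "a \<odot>\<^bsub>regular_module A\<^esub> x = x \<otimes>\<^bsub>A\<^esub> a"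
  by (simp_all add: regular_module_def)

lemma (in ring) right_module_regular: "right_module R (regular_module R)"
proof (intro right_module.intro abelian_groupI right_module_axioms.intro ring_axioms)
  fix x assume "x \<in> carrier (regular_module R)"
  then show "\<exists>y\<in>carrier (regular_module R). y \<oplus>\<^bsub>regular_module R\<^esub> x = \<zero>\<^bsub>regular_module R\<^esub>"
    by (intro bexI[of _ "\<ominus> x"]) (auto simp: l_neg)
qed (auto simp: a_ac m_assoc l_distr r_distr)

lemma rmod_hom_regular:
  assumes "right_module A M" "x \<in> carrier M"
  shows "(\<lambda>a. a \<odot>\<^bsub>M\<^esub> x) \<in> rmod_hom A (regular_module A) M"
proof -
  interpret M: right_module A M by fact
  show ?thesis
    by (rule rmod_homI) (use assms in \<open>auto simp: M.act_closed M.act_l_distr M.act_assoc\<close>)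
qed

text \<open>By the Hopkins--Levitzki theorem these are the right artinian rings. Over them finite
  generation and finite length coincide, which opens all arguments by induction or minimality on
  \<open>len\<close>.\<close>

locale finite_length_ring = ring A for A :: "('a, 'b) ring_scheme" +
  assumes finite_length_regular: "finite_length A (regular_module A)"
begin

text \<open>Adding a generator \<open>x\<close> enlarges the span at most to the image of the direct
  sum of the old span with the regular module under \<open>(z, a) \<mapsto> z + x a\<close>. The
  type of \<open>M\<close> is the record without further fields because \<open>direct_sum\<close>
  takes such records.\<close>

lemma finite_length_span:
  fixes M :: "('a, 'm) module"
  assumes M: "right_module A M" and S: "finite S" "S \<subseteq> carrier M"
  shows "finite_length A (M\<lparr>carrier := lin_span A M S\<rparr>)"
  using S
proof (induction S)
  case empty
  have "lin_span A M {} = {\<zero>\<^bsub>M\<^esub>}"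
    using lin_span_least[OF M _ submodule_zero_set[OF M], of "{}"]
      submodule_zero[OF lin_span_submodule[OF M, of "{}"]] by auto
  then show ?case
    using finite_length_zero_module[OF right_module_submodule[OF M submodule_zero_set[OF M]]] by simp
next
  case (insert x S)
  let ?U = "M\<lparr>carrier := lin_span A M S\<rparr>"
  have S: "finite S" "S \<subseteq> carrier M" and x: "x \<in> carrier M" using insert by auto
  have T: "finite (insert x S)" "insert x S \<subseteq> carrier M" using insert by auto
  note U = lin_span_submodule[OF M S]
  note U' = right_module_submodule[OF M U]
  interpret M: right_module A M by fact
  define f where "f = (\<lambda>z. fst z \<oplus>\<^bsub>M\<^esub> snd z \<odot>\<^bsub>M\<^esub> x)"
  let ?D = "direct_sum ?U (regular_module A)"
  have D: "right_module A ?D" by (rule right_module_direct_sum[OF U' right_module_regular])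
  have "fst \<in> rmod_hom A ?D M"
    by (rule rmod_hom_codomain_incl[OF rmod_hom_fst submodule_subset[OF U]])
  moreover have "(\<lambda>z. snd z \<odot>\<^bsub>M\<^esub> x) \<in> rmod_hom A ?D M"
    by (rule rmod_hom_comp[OF rmod_hom_snd rmod_hom_regular[OF M x]])
  ultimately have f: "f \<in> rmod_hom A ?D M"
    unfolding f_def by (rule rmod_hom_plus[OF M])
  let ?I = "f ` carrier ?D"
  have I: "submodule ?I A M" by (rule submodule_image[OF D M f submodule_carrier[OF D]])
  have "finite_length A (M\<lparr>carrier := ?I\<rparr>)"
    by (rule finite_length_quotient[OF D right_module_submodule[OF M I] rmod_hom_codomain[OF f]])
      (auto intro!: finite_length_direct_sum U' right_module_regular insert.IH S finite_length_regular)
  moreover have "lin_span A M (insert x S) \<subseteq> ?I"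
  proof (rule lin_span_least[OF M T(1) I], rule insert_subsetI)
    have "f (\<zero>\<^bsub>M\<^esub>, \<one>\<^bsub>A\<^esub>) = x" using x by (simp add: f_def M.act_one)
    moreover have "(\<zero>\<^bsub>M\<^esub>, \<one>\<^bsub>A\<^esub>) \<in> carrier ?D" using submodule_zero[OF U] by simp
    ultimately show "x \<in> ?I" by (metis imageI)
    show "S \<subseteq> ?I"
    proof
      fix s assume s: "s \<in> S"
      then have "s \<in> carrier M" using S by auto
      then have "f (s, \<zero>\<^bsub>A\<^esub>) = s" using x by (simp add: f_def M.act_l_null)
      moreover have "(s, \<zero>\<^bsub>A\<^esub>) \<in> carrier ?D" using lin_span_superset[OF M S] s by auto
      ultimately show "s \<in> ?I" by (metis imageI)
    qed
  qed
  ultimately show ?case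
    using finite_length_subset[OF M lin_span_submodule[OF M T] I] by blast
qed

lemma fg_iff_finite_length:
  fixes M :: "('a, 'm) module"
  assumes M: "right_module A M"
  shows "finitely_generated A M \<longleftrightarrow> finite_length A M"
proof
  assume "finitely_generated A M"
  then obtain S where S: "finite S" "S \<subseteq> carrier M" "lin_span A M S = carrier M"
    by (auto simp: finitely_generated_iff_span)
  from finite_length_span[OF M S(1,2)] show "finite_length A M" by (simp add: S(3))
qed (rule finite_length_imp_fg[OF M])

lemma modA_iff: "M \<in> modA A \<longleftrightarrow> right_module A M \<and> finite_length A M"
  unfolding modA_def using fg_iff_finite_length by auto

end

text \<open>After one strict step a subspace contains some \<open>x \<noteq> 0\<close>, hence every
  \<open>y = x (inv x y)\<close>, and there is no room for a second step.\<close>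

lemma (in field) finite_length_ring: "finite_length_ring R"
proof
  have "\<not> has_chain R (regular_module R) (Suc (Suc n))" for n
  proof
    assume "has_chain R (regular_module R) (Suc (Suc n))"
    then obtain U where U: "\<And>i. i \<le> Suc (Suc n) \<Longrightarrow> submodule (U i) R (regular_module R)"
        "\<And>i. i < Suc (Suc n) \<Longrightarrow> U i \<subset> U (Suc i)"
      unfolding has_chain_def by blast
    obtain x where x: "x \<in> U 1" "x \<notin> U 0" using U(2)[of 0] by auto
    have xR: "x \<in> carrier R" "x \<noteq> \<zero>"
      using x submodule_subset[OF U(1)[of 1]] submodule_zero[OF U(1)[of 0]] by auto
    have "y \<in> U 1" if y: "y \<in> carrier R" for y
    proof -
      have "(inv x \<otimes> y) \<odot>\<^bsub>regular_module R\<^esub> x \<in> U 1"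
        using submodule_act[OF U(1)[of 1] _ x(1)] xR y by (simp add: field_Units)
      moreover have "x \<otimes> (inv x \<otimes> y) = y"
        using xR y by (simp add: field_Units m_assoc[symmetric])
      ultimately show ?thesis by simp
    qed
    moreover have "U 2 \<subseteq> carrier R" using submodule_subset[OF U(1)[of 2]] by simp
    moreover have "U 1 \<subset> U 2" using U(2)[of 1] by (simp add: numeral_2_eq_2)
    ultimately show False by auto
  qed
  then have "n \<le> 1" if "has_chain R (regular_module R) n" for n
    using that by (metis One_nat_def Suc_le_D not_less_eq_eq)
  then show "finite_length R (regular_module R)"
    unfolding finite_length_def by blast
qed

text \<open>Since \<open>c x = x (c 1)\<close> for scalars \<open>c\<close>, right ideals are
  subspaces. A chain of right ideals is thus a chain of subspaces of \<open>A\<close>, and these are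
  bounded because \<open>A\<close> has finite length over \<open>K\<close>.\<close>

lemma (in fd_algebra) finite_length_ring: "finite_length_ring A"
proof
  \<comment> \<open>A left vector space satisfies the right-module law \<open>act_assoc\<close>
    because \<open>K\<close> is commutative.\<close>
  have KA: "right_module K A"
    by (intro right_module.intro right_module_axioms.intro K.ring_axioms A.abelian_group_axioms)
      (auto simp: V.smult_l_distr V.smult_r_distr V.smult_assoc1[symmetric] K.m_comm)
  \<comment> \<open>The record \<open>A\<close> may carry further fields, while
    \<open>modA_iff\<close> speaks of members of \<open>modA K\<close>; finite length is established
    for the copy \<open>N\<close> and carried back.\<close>
  obtain N where N: "N \<in> modA K" "rmod_iso K A N"
    using modA_universal[OF KA finite_dim] by blast
  interpret FK: finite_length_ring K by (rule K.finite_length_ring)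
  have N': "right_module K N" "finite_length K N" using N(1) by (auto simp: FK.modA_iff)
  have fin: "finite_length K A"
    by (rule finite_length_iso[OF rmod_iso_sym[OF N(2) KA N'(1)] N'(1) KA N'(2)])
  have "submodule U K A" if U: "submodule U A (regular_module A)" for U
  proof (rule submoduleI_right[OF KA])
    show UA: "U \<subseteq> carrier A" using submodule_subset[OF U] by simp
    show "\<zero>\<^bsub>A\<^esub> \<in> U" using submodule_zero[OF U] by simp
    show "x \<oplus>\<^bsub>A\<^esub> y \<in> U" if "x \<in> U" "y \<in> U" for x y
      using submodule_add[OF U that] by simp
    fix c x assume c: "c \<in> carrier K" and x: "x \<in> U"
    then have "c \<odot>\<^bsub>A\<^esub> x = (c \<odot>\<^bsub>A\<^esub> \<one>\<^bsub>A\<^esub>) \<odot>\<^bsub>regular_module A\<^esub> x"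
      using UA by (auto simp: smult_mult_right)
    then show "c \<odot>\<^bsub>A\<^esub> x \<in> U" using submodule_act[OF U, of "c \<odot>\<^bsub>A\<^esub> \<one>\<^bsub>A\<^esub>" x] c x by simp
  qed
  then have "has_chain K A n" if "has_chain A (regular_module A) n" for n
    using that unfolding has_chain_def by blast
  then show "finite_length A (regular_module A)"
    using fin unfolding finite_length_def by blast
qed

section \<open>Projective modules and projective covers\<close>

context finite_length_ring
begin

lemma modA_right_module: "M \<in> modA A \<Longrightarrow> right_module A M"
  and modA_finite_length: "M \<in> modA A \<Longrightarrow> finite_length A M"
  by (auto simp: modA_iff)

lemma modA_submodule: "M \<in> modA A \<Longrightarrow> submodule U A M \<Longrightarrow> M\<lparr>carrier := U\<rparr> \<in> modA A"
  by (auto simp: modA_iff right_module_submodule finite_length_submodule)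

lemma modA_kernel:
  "M \<in> modA A \<Longrightarrow> N \<in> modA A \<Longrightarrow> f \<in> rmod_hom A M N \<Longrightarrow> M\<lparr>carrier := a_kernel M N f\<rparr> \<in> modA A"
  by (simp add: modA_submodule submodule_kernel modA_right_module)

text \<open>Direct sums and the regular module have other element types than the members of
  \<open>modA A\<close>. Wherever a construction must stay in \<open>modA A\<close>, it is replaced
  by such a copy.\<close>

lemma modA_copy:
  assumes "right_module A D" "finite_length A D"
  obtains N where "N \<in> modA A" "rmod_iso A N D"
  using modA_universal[OF assms(1) finite_length_imp_fg[OF assms]]
    rmod_iso_sym[OF _ assms(1) modA_right_module] by blast

lemma modA_direct_sum_copy:
  assumes "M \<in> modA A" "N \<in> modA A"
  obtains D where "D \<in> modA A" "rmod_iso A D (direct_sum M N)"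
proof (rule modA_copy)
  show "right_module A (direct_sum M N)" "finite_length A (direct_sum M N)"
    by (intro right_module_direct_sum finite_length_direct_sum modA_right_module modA_finite_length assms)+
qed (rule that)

lemma projective_modA: "projective A P \<Longrightarrow> P \<in> modA A"
  by (simp add: projective_def)

lemma projective_lift:
  assumes "projective A P" "M \<in> modA A" "N \<in> modA A" "g \<in> rmod_hom A M N" "f \<in> rmod_hom A P N"
    and "g ` carrier M = carrier N"
  obtains h where "h \<in> rmod_hom A P M" "\<And>x. x \<in> carrier P \<Longrightarrow> g (h x) = f x"
proof -
  have "\<forall>M\<in>modA A. \<forall>N\<in>modA A. \<forall>g\<in>rmod_hom A M N. \<forall>f\<in>rmod_hom A P N.
      g ` carrier M = carrier N \<longrightarrow> (\<exists>h\<in>rmod_hom A P M. \<forall>x\<in>carrier P. g (h x) = f x)"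
    using assms(1) unfolding projective_def by (rule conjunct2)
  from this[rule_format, OF assms(2-6)] show thesis using that by auto
qed

lemma projectiveI:
  assumes "P \<in> modA A"
    and "\<And>M N g f. M \<in> modA A \<Longrightarrow> N \<in> modA A \<Longrightarrow> g \<in> rmod_hom A M N \<Longrightarrow> f \<in> rmod_hom A P N \<Longrightarrow>
      g ` carrier M = carrier N \<Longrightarrow> \<exists>h\<in>rmod_hom A P M. \<forall>x\<in>carrier P. g (h x) = f x"
  shows "projective A P"
  unfolding projective_def by (intro conjI ballI impI assms)

text \<open>A map \<open>f\<close> on \<open>N\<close> is lifted by lifting its composite with
  \<open>r\<close> on \<open>P\<close> and restricting the lift along \<open>i\<close>.\<close>

lemma projective_retract:
  assumes P: "projective A P" and N: "N \<in> modA A"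
    and i: "i \<in> rmod_hom A N P" and r: "r \<in> rmod_hom A P N"
    and ri: "\<And>x. x \<in> carrier N \<Longrightarrow> r (i x) = x"
  shows "projective A N"
proof (rule projectiveI[OF N])
  fix M L g f
  assume M: "M \<in> modA A" and L: "L \<in> modA A" and g: "g \<in> rmod_hom A M L"
    and f: "f \<in> rmod_hom A N L" and surj: "g ` carrier M = carrier L"
  obtain h where h: "h \<in> rmod_hom A P M" "\<And>x. x \<in> carrier P \<Longrightarrow> g (h x) = f (r x)"
    by (rule projective_lift[OF P M L g rmod_hom_comp[OF r f] surj]) blast
  show "\<exists>h\<in>rmod_hom A N M. \<forall>x\<in>carrier N. g (h x) = f x"
    by (rule bexI[OF _ rmod_hom_comp[OF i h(1)]])
      (simp add: h(2) ri rmod_hom_closed[OF i])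
qed

lemma projective_iso:
  assumes "rmod_iso A M N" "projective A N" "M \<in> modA A"
  shows "projective A M"
proof -
  obtain f g where "f \<in> rmod_hom A M N" "g \<in> rmod_hom A N M" "\<And>x. x \<in> carrier M \<Longrightarrow> g (f x) = x"
    by (rule rmod_isoE[OF assms(1) modA_right_module[OF assms(3)]
      modA_right_module[OF projective_modA[OF assms(2)]]]) blast
  from projective_retract[OF assms(2,3) this] show ?thesis .
qed

lemma projective_summand:
  assumes P: "projective A P" and M: "M \<in> modA A" and N: "N \<in> modA A"
    and iso: "rmod_iso A P (direct_sum M N)"
  shows "projective A N"
proof -
  note rP = modA_right_module[OF projective_modA[OF P]]
  note rM = modA_right_module[OF M] and rN = modA_right_module[OF N]
  interpret M: right_module A M by (rule rM)
  obtain u v where u: "u \<in> rmod_hom A P (direct_sum M N)" and v: "v \<in> rmod_hom A (direct_sum M N) P"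
    and uv: "\<And>z. z \<in> carrier (direct_sum M N) \<Longrightarrow> u (v z) = z"
    by (rule rmod_isoE[OF iso rP right_module_direct_sum[OF rM rN]]) blast
  show ?thesis
    by (rule projective_retract[OF P N rmod_hom_comp[OF rmod_hom_inr[OF rM] v] rmod_hom_comp[OF u rmod_hom_snd]])
      (simp add: uv)
qed

text \<open>The restrictions of \<open>f\<close> to the two summands are lifted separately, to
  \<open>h\<close> and \<open>k\<close>, and the lifts are added.\<close>

lemma projective_direct_sum:
  assumes P: "projective A P" and Q: "projective A Q" and N: "N \<in> modA A"
    and iso: "rmod_iso A N (direct_sum P Q)"
  shows "projective A N"
proof (rule projectiveI[OF N])
  fix M L g f
  assume M: "M \<in> modA A" and L: "L \<in> modA A" and g: "g \<in> rmod_hom A M L"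
    and f: "f \<in> rmod_hom A N L" and surj: "g ` carrier M = carrier L"
  note rm = modA_right_module[OF M] modA_right_module[OF L] modA_right_module[OF N]
    modA_right_module[OF projective_modA[OF P]] modA_right_module[OF projective_modA[OF Q]]
  interpret P: right_module A P by fact
  interpret Q: right_module A Q by fact
  obtain u v where u: "u \<in> rmod_hom A N (direct_sum P Q)" and v: "v \<in> rmod_hom A (direct_sum P Q) N"
    and vu: "\<And>x. x \<in> carrier N \<Longrightarrow> v (u x) = x"
    by (rule rmod_isoE[OF iso rm(3) right_module_direct_sum[OF rm(4,5)]]) blast
  obtain h where h: "h \<in> rmod_hom A P M" "\<And>x. x \<in> carrier P \<Longrightarrow> g (h x) = f (v (x, \<zero>\<^bsub>Q\<^esub>))"
    by (rule projective_lift[OF P M L g rmod_hom_comp[OF rmod_hom_comp[OF rmod_hom_inl[OF rm(5)] v] f] surj]) blast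
  obtain k where k: "k \<in> rmod_hom A Q M" "\<And>x. x \<in> carrier Q \<Longrightarrow> g (k x) = f (v (\<zero>\<^bsub>P\<^esub>, x))"
    by (rule projective_lift[OF Q M L g rmod_hom_comp[OF rmod_hom_comp[OF rmod_hom_inr[OF rm(4)] v] f] surj]) blast
  define l where "l = (\<lambda>x. h (fst (u x)) \<oplus>\<^bsub>M\<^esub> k (snd (u x)))"
  have l: "l \<in> rmod_hom A N M"
    unfolding l_def
    by (intro rmod_hom_plus rm(1) rmod_hom_comp[OF rmod_hom_comp[OF u rmod_hom_fst] h(1)]
        rmod_hom_comp[OF rmod_hom_comp[OF u rmod_hom_snd] k(1)])
  have "g (l x) = f x" if x: "x \<in> carrier N" for x
  proof -
    have ux: "u x \<in> carrier (direct_sum P Q)" by (rule rmod_hom_closed[OF u x])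
    then have c: "fst (u x) \<in> carrier P" "snd (u x) \<in> carrier Q" by auto
    then have "g (l x) = f (v (fst (u x), \<zero>\<^bsub>Q\<^esub>)) \<oplus>\<^bsub>L\<^esub> f (v (\<zero>\<^bsub>P\<^esub>, snd (u x)))"
      unfolding l_def using rmod_hom_add[OF g] rmod_hom_closed[OF h(1)] rmod_hom_closed[OF k(1)]
      by (simp add: h k)
    also have "\<dots> = f (v ((fst (u x), \<zero>\<^bsub>Q\<^esub>) \<oplus>\<^bsub>direct_sum P Q\<^esub> (\<zero>\<^bsub>P\<^esub>, snd (u x))))"
      using c by (intro rmod_hom_add[OF rmod_hom_comp[OF v f], symmetric]) auto
    also have "\<dots> = f x" using c vu[OF x] by simp
    finally show ?thesis .
  qed
  then show "\<exists>h\<in>rmod_hom A N M. \<forall>x\<in>carrier N. g (h x) = f x" using l by blast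
qed

text \<open>The regular module is free on its unit: a preimage \<open>m\<close> of the value at the
  unit determines the lift \<open>a \<mapsto> m a\<close>.\<close>

lemma projective_regular:
  assumes N: "N \<in> modA A" and iso: "rmod_iso A N (regular_module A)"
  shows "projective A N"
proof (rule projectiveI[OF N])
  fix M L g f
  assume M: "M \<in> modA A" and L: "L \<in> modA A" and g: "g \<in> rmod_hom A M L"
    and f: "f \<in> rmod_hom A N L" and surj: "g ` carrier M = carrier L"
  note rm = modA_right_module[OF M] modA_right_module[OF L] modA_right_module[OF N]
  obtain u v where u: "u \<in> rmod_hom A N (regular_module A)" and v: "v \<in> rmod_hom A (regular_module A) N"
    and vu: "\<And>x. x \<in> carrier N \<Longrightarrow> v (u x) = x"
    by (rule rmod_isoE[OF iso rm(3) right_module_regular]) blast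
  have e: "v \<one>\<^bsub>A\<^esub> \<in> carrier N" by (rule rmod_hom_closed[OF v]) simp
  obtain m where m: "m \<in> carrier M" "g m = f (v \<one>\<^bsub>A\<^esub>)"
    using surj rmod_hom_closed[OF f e] by (metis imageE)
  have "g (u x \<odot>\<^bsub>M\<^esub> m) = f x" if x: "x \<in> carrier N" for x
  proof -
    have ux: "u x \<in> carrier A" using rmod_hom_closed[OF u x] by simp
    have "g (u x \<odot>\<^bsub>M\<^esub> m) = u x \<odot>\<^bsub>L\<^esub> f (v \<one>\<^bsub>A\<^esub>)"
      using rmod_hom_act[OF g ux m(1)] m(2) by simp
    also have "\<dots> = f (v (u x \<odot>\<^bsub>regular_module A\<^esub> \<one>\<^bsub>A\<^esub>))"
      using rmod_hom_act[OF rmod_hom_comp[OF v f] ux, of "\<one>\<^bsub>A\<^esub>"] by simp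
    also have "\<dots> = f x" using ux vu[OF x] by simp
    finally show ?thesis .
  qed
  then show "\<exists>h\<in>rmod_hom A N M. \<forall>x\<in>carrier N. g (h x) = f x"
    by (intro bexI[OF _ rmod_hom_comp[OF u rmod_hom_regular[OF rm(1) m(1)]]]) simp
qed

lemma projective_zero_module:
  assumes N: "N \<in> modA A" and zero: "carrier N = {\<zero>\<^bsub>N\<^esub>}"
  shows "projective A N"
proof (rule projectiveI[OF N])
  fix M L g f
  assume M: "M \<in> modA A" and L: "L \<in> modA A" and g: "g \<in> rmod_hom A M L" and f: "f \<in> rmod_hom A N L"
  note rm = modA_right_module[OF M] modA_right_module[OF L] modA_right_module[OF N]
  show "\<exists>h\<in>rmod_hom A N M. \<forall>x\<in>carrier N. g (h x) = f x"
    by (rule bexI[OF _ rmod_hom_zero_map[OF rm(1)]])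
      (simp add: zero rmod_hom_zero[OF rm(1,2) g] rmod_hom_zero[OF rm(3,2) f])
qed

lemma zero_module_exists:
  obtains Z where "projective A Z" "carrier Z = {\<zero>\<^bsub>Z\<^esub>}"
proof -
  let ?Z0 = "(regular_module A)\<lparr>carrier := {\<zero>\<^bsub>A\<^esub>}\<rparr>"
  have rm: "right_module A ?Z0"
    using right_module_submodule[OF right_module_regular submodule_zero_set[OF right_module_regular]] by simp
  obtain Z where Z: "Z \<in> modA A" "rmod_iso A Z ?Z0"
    using modA_copy[OF rm finite_length_zero_module[OF rm]] by auto
  from Z(2) obtain f where "bij_betw f (carrier Z) {\<zero>\<^bsub>A\<^esub>}" by (auto simp: rmod_iso_def)
  then have "card (carrier Z) = 1" by (simp add: bij_betw_same_card)
  moreover have "\<zero>\<^bsub>Z\<^esub> \<in> carrier Z"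
    using submodule_zero[OF submodule_carrier[OF modA_right_module[OF Z(1)]]] .
  ultimately have zero: "carrier Z = {\<zero>\<^bsub>Z\<^esub>}" by (auto simp: card_1_singleton_iff)
  show thesis by (rule that[OF projective_zero_module[OF Z(1) zero] zero])
qed

text \<open>A free module is built one generator at a time, by adding a copy \<open>R\<close> of the
  regular module for each new \<open>x\<close>. The unit of that copy is sent to \<open>x\<close>,
  and the old part keeps the old images.\<close>

lemma projective_presentation:
  assumes M: "M \<in> modA A"
  obtains P p where "projective A P" "p \<in> rmod_hom A P M" "p ` carrier P = carrier M"
proof -
  note rM = modA_right_module[OF M]
  interpret M: right_module A M by (rule rM)
  have pres: "\<exists>P p. projective A P \<and> p \<in> rmod_hom A P M \<and> S \<subseteq> p ` carrier P"
    if "finite S" "S \<subseteq> carrier M" for S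
    using that
  proof (induction S)
    case empty
    obtain Z where "projective A Z" by (rule zero_module_exists)
    with rmod_hom_zero_map[OF rM] show ?case by (intro exI conjI) auto
  next
    case (insert x S)
    then obtain P p where P: "projective A P" and p: "p \<in> rmod_hom A P M" and S: "S \<subseteq> p ` carrier P"
      by auto
    have x: "x \<in> carrier M" using insert.prems by simp
    obtain R where R: "R \<in> modA A" "rmod_iso A R (regular_module A)"
      by (rule modA_copy[OF right_module_regular finite_length_regular]) blast
    note rR = modA_right_module[OF R(1)]
    obtain u v where u: "u \<in> rmod_hom A R (regular_module A)" and v: "v \<in> rmod_hom A (regular_module A) R"
      and uv: "\<And>a. a \<in> carrier A \<Longrightarrow> u (v a) = a"
      by (rule rmod_isoE[OF R(2) rR right_module_regular]) (auto simp: that)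
    obtain Q where Q: "Q \<in> modA A" "rmod_iso A Q (direct_sum P R)"
      by (rule modA_direct_sum_copy[OF projective_modA[OF P] R(1)]) blast
    note rP = modA_right_module[OF projective_modA[OF P]]
    interpret P: right_module A P by (rule rP)
    interpret R: right_module A R by (rule rR)
    obtain s t where s: "s \<in> rmod_hom A Q (direct_sum P R)" and t: "t \<in> rmod_hom A (direct_sum P R) Q"
      and st: "\<And>z. z \<in> carrier (direct_sum P R) \<Longrightarrow> s (t z) = z"
      by (rule rmod_isoE[OF Q(2) modA_right_module[OF Q(1)] right_module_direct_sum[OF rP rR]]) blast
    define q where "q = (\<lambda>z. p (fst (s z)) \<oplus>\<^bsub>M\<^esub> u (snd (s z)) \<odot>\<^bsub>M\<^esub> x)"
    have q: "q \<in> rmod_hom A Q M"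
      unfolding q_def
      by (intro rmod_hom_plus rM rmod_hom_comp[OF rmod_hom_comp[OF s rmod_hom_fst] p]
        rmod_hom_comp[OF rmod_hom_comp[OF rmod_hom_comp[OF s rmod_hom_snd] u] rmod_hom_regular[OF rM x]])
    have qt: "p y \<oplus>\<^bsub>M\<^esub> u z \<odot>\<^bsub>M\<^esub> x \<in> q ` carrier Q" if "y \<in> carrier P" "z \<in> carrier R" for y z
      using that st[of "(y, z)"] rmod_hom_closed[OF t, of "(y, z)"]
      by (intro image_eqI[of _ _ "t (y, z)"]) (auto simp: q_def)
    have "x = p \<zero>\<^bsub>P\<^esub> \<oplus>\<^bsub>M\<^esub> u (v \<one>\<^bsub>A\<^esub>) \<odot>\<^bsub>M\<^esub> x"
      using x by (simp add: uv M.act_one rmod_hom_zero[OF rP rM p])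
    moreover have "v \<one>\<^bsub>A\<^esub> \<in> carrier R" by (rule rmod_hom_closed[OF v]) simp
    ultimately have "x \<in> q ` carrier Q" using qt[OF P.M.zero_closed] by metis
    moreover have "y \<in> q ` carrier Q" if y: "y \<in> S" for y
    proof -
      obtain z where z: "z \<in> carrier P" "y = p z" using S y by auto
      have "y = p z \<oplus>\<^bsub>M\<^esub> u \<zero>\<^bsub>R\<^esub> \<odot>\<^bsub>M\<^esub> x"
        using x z rmod_hom_closed[OF p] rmod_hom_zero[OF rR right_module_regular u]
        by (simp add: M.act_l_null)
      then show ?thesis using qt[OF z(1) R.M.zero_closed] by simp
    qed
    ultimately have "insert x S \<subseteq> q ` carrier Q" by auto
    moreover have "projective A Q"
      by (rule projective_direct_sum[OF P projective_regular[OF R] Q])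
    ultimately show ?case using q by blast
  qed
  obtain S where S: "finite S" "S \<subseteq> carrier M" "lin_span A M S = carrier M"
    using M by (auto simp: modA_def finitely_generated_iff_span)
  obtain P p where P: "projective A P" and p: "p \<in> rmod_hom A P M" and Sp: "S \<subseteq> p ` carrier P"
    using pres[OF S(1,2)] by (elim exE conjE)
  note rP = modA_right_module[OF projective_modA[OF P]]
  have "carrier M \<subseteq> p ` carrier P"
    using lin_span_least[OF rM S(1) submodule_image[OF rP rM p submodule_carrier[OF rP]] Sp] S(3) by simp
  moreover have "p ` carrier P \<subseteq> carrier M" using rmod_hom_closed[OF p] by auto
  ultimately show thesis using that[OF P p] by blast
qed

text \<open>Among the projectives mapping onto \<open>M\<close> one of minimal length is a projective cover: an
  endomorphism \<open>h\<close> over \<open>M\<close> with image of minimal length is bijective on its image, which is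
  therefore a direct summand mapping onto \<open>M\<close>.\<close>

lemma projective_cover_exists:
  assumes M: "M \<in> modA A"
  obtains P p where "projective_cover A M P p"
proof -
  define pres where "pres P p \<longleftrightarrow> projective A P \<and> p \<in> rmod_hom A P M \<and> p ` carrier P = carrier M" for P p
  have "\<exists>z. pres (fst z) (snd z)"
    using projective_presentation[OF M] unfolding pres_def by (metis fst_conv snd_conv)
  then obtain z where z: "pres (fst z) (snd z)"
      and zmin: "\<And>y. pres (fst y) (snd y) \<Longrightarrow> len A (fst z) \<le> len A (fst y)"
    using ex_has_least_nat[of "\<lambda>z. pres (fst z) (snd z)" _ "\<lambda>z. len A (fst z)"] by blast
  define P p where "P = fst z" and "p = snd z"
  have P: "projective A P" and p: "p \<in> rmod_hom A P M" and surj: "p ` carrier P = carrier M"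
    using z by (auto simp: pres_def P_def p_def)
  have min: "len A P \<le> len A Q"
    if "projective A Q" "q \<in> rmod_hom A Q M" "q ` carrier Q = carrier M" for Q q
    using zmin[of "(Q, q)"] that by (simp add: pres_def P_def)
  note mP = projective_modA[OF P]
  note rP = modA_right_module[OF mP] and rM = modA_right_module[OF M] and fP = modA_finite_length[OF mP]
  \<comment> \<open>The endomorphisms of \<open>P\<close> over \<open>M\<close>. The cover property
    will follow once all of them are known to be onto.\<close>
  define H where "H = {h \<in> rmod_hom A P P. \<forall>x\<in>carrier P. p (h x) = p x}"
  have sub: "submodule (h ` carrier P) A P" if "h \<in> H" for h
    using that submodule_image[OF rP rP _ submodule_carrier[OF rP]] by (simp add: H_def)
  have id: "(\<lambda>x. x) \<in> H" by (simp add: H_def rmod_hom_id)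
  obtain h where h: "h \<in> H"
    and hmin: "\<And>g. g \<in> H \<Longrightarrow> len A (P\<lparr>carrier := h ` carrier P\<rparr>) \<le> len A (P\<lparr>carrier := g ` carrier P\<rparr>)"
    using ex_has_least_nat[of "\<lambda>h. h \<in> H" _ "\<lambda>h. len A (P\<lparr>carrier := h ` carrier P\<rparr>)"] id by blast
  define E where "E = h ` carrier P"
  have E: "submodule E A P" unfolding E_def by (rule sub[OF h])
  have hP: "h \<in> rmod_hom A P P" and ph: "\<And>x. x \<in> carrier P \<Longrightarrow> p (h x) = p x"
    using h by (auto simp: H_def)
  note rE = right_module_submodule[OF rP E]
  note EP = submodule_subset[OF E]
  have fE: "finite_length A (P\<lparr>carrier := E\<rparr>)" by (rule finite_length_submodule[OF rP E fP])
  \<comment> \<open>The square of \<open>h\<close> also lies in \<open>H\<close> and has its image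
    inside \<open>E\<close>, so minimality forces equality. By \<open>len_inj_surj\<close> the map
    that \<open>h\<close> induces on \<open>E\<close> is then bijective.\<close>
  have hE: "h ` E = E"
  proof (rule ccontr)
    assume "h ` E \<noteq> E"
    then have "h ` E \<subset> E" using EP by (auto simp: E_def)
    moreover have "(\<lambda>x. h (h x)) \<in> H"
      using rmod_hom_comp[OF hP hP] rmod_hom_closed[OF hP] by (auto simp: H_def ph)
    ultimately show False
      using hmin[of "\<lambda>x. h (h x)"] len_strict_mono[OF rP submodule_image[OF rP rP hP E] E _ fE]
      by (simp add: E_def image_image)
  qed
  let ?E = "P\<lparr>carrier := E\<rparr>"
  have hEE: "h \<in> rmod_hom A ?E ?E"
    using rmod_hom_codomain[OF rmod_hom_restrict[OF hP EP]] hE by simp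
  have "inj_on h (carrier ?E)" using len_inj_surj[OF rE rE hEE] hE fE by simp
  then have bij: "bij_betw h (carrier ?E) (carrier ?E)" using hE by (simp add: bij_betw_def)
  let ?k = "inv_into (carrier ?E) h"
  have k: "?k \<in> rmod_hom A ?E ?E" by (rule rmod_hom_inv_into[OF rE rE hEE bij])
  have hPE: "h \<in> rmod_hom A P ?E" by (rule rmod_hom_codomain[OF hP]) (simp add: E_def)
  have "projective A ?E"
  proof (rule projective_retract[OF P modA_submodule[OF mP E] rmod_hom_incl[OF EP] rmod_hom_comp[OF hPE k]])
    show "?k (h x) = x" if "x \<in> carrier ?E" for x
      using bij that by (simp add: bij_betw_def inv_into_f_f)
  qed
  moreover have "p ` carrier ?E = carrier M" using ph surj by (force simp: E_def image_image)
  ultimately have "len A P \<le> len A ?E"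
    using min[of ?E p] rmod_hom_restrict[OF p EP] by blast
  then have "E = carrier P" by (rule submodule_eq_carrier[OF rP E fP])
  then have Hsurj: "g ` carrier P = carrier P" if "g \<in> H" for g
    using hmin[OF that] submodule_eq_carrier[OF rP sub[OF that] fP] by (simp add: E_def)
  \<comment> \<open>If \<open>U\<close> and the kernel span \<open>P\<close>, then \<open>p\<close>
    already maps \<open>U\<close> onto \<open>M\<close>. Lifting \<open>p\<close> through
    \<open>U\<close> gives a member of \<open>H\<close> with image inside \<open>U\<close>, and this
    member is onto.\<close>
  have "U = carrier P" if U: "submodule U A P" and sum: "U <+>\<^bsub>P\<^esub> a_kernel P M p = carrier P" for U
  proof -
    interpret M: right_module A M by (rule rM)
    note UP = submodule_subset[OF U]
    have "p ` carrier P \<subseteq> p ` U"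
    proof (rule image_subsetI)
      fix x assume "x \<in> carrier P"
      then obtain y z where yz: "y \<in> U" "z \<in> carrier P" "p z = \<zero>\<^bsub>M\<^esub>" "x = y \<oplus>\<^bsub>P\<^esub> z"
        using sum unfolding set_add_def' a_kernel_eq by blast
      then have "p x = p y" using UP rmod_hom_closed[OF p, of y] rmod_hom_add[OF p, of y z] by auto
      then show "p x \<in> p ` U" using yz(1) by blast
    qed
    then have pU: "p ` carrier (P\<lparr>carrier := U\<rparr>) = carrier M" using UP surj by auto
    obtain g where g: "g \<in> rmod_hom A P (P\<lparr>carrier := U\<rparr>)" "\<And>x. x \<in> carrier P \<Longrightarrow> p (g x) = p x"
      by (rule projective_lift[OF P modA_submodule[OF mP U] M rmod_hom_restrict[OF p UP] p pU]) blast
    then have "g \<in> H" using rmod_hom_codomain_incl[OF g(1) UP] by (simp add: H_def)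
    then have "carrier P \<subseteq> U" using Hsurj rmod_hom_closed[OF g(1)] by force
    then show ?thesis using UP by auto
  qed
  then have "projective_cover A M P p" using P p surj by (auto simp: projective_cover_def)
  then show thesis by (rule that)
qed

section \<open>Syzygies and comparison of projective covers\<close>

lemma syzygy_cover:
  assumes "M \<in> modA A"
  obtains P p where "projective_cover A M P p" "syzygy A M = P\<lparr>carrier := a_kernel P M p\<rparr>"
proof -
  obtain P p where "projective_cover A M P p" by (rule projective_cover_exists[OF assms])
  then have "\<exists>N P p. projective_cover A M P p \<and> N = P\<lparr>carrier := a_kernel P M p\<rparr>" by blast
  from someI_ex[OF this] show thesis using that unfolding syzygy_def by blast
qed

lemma projective_coverD:
  assumes "projective_cover A M P p"
  shows "projective A P" "p \<in> rmod_hom A P M" "p ` carrier P = carrier M"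
    and "\<And>U. submodule U A P \<Longrightarrow> U <+>\<^bsub>P\<^esub> a_kernel P M p = carrier P \<Longrightarrow> U = carrier P"
  using assms by (auto simp: projective_cover_def)

lemma syzygy_modA:
  assumes M: "M \<in> modA A"
  shows "syzygy A M \<in> modA A"
proof -
  obtain P p where cov: "projective_cover A M P p" and syz: "syzygy A M = P\<lparr>carrier := a_kernel P M p\<rparr>"
    by (rule syzygy_cover[OF M]) blast
  note c = projective_coverD[OF cov]
  show ?thesis unfolding syz by (rule modA_kernel[OF projective_modA[OF c(1)] M c(2)])
qed

lemma projective_cover_factor_surj:
  assumes M: "M \<in> modA A" and cov: "projective_cover A M P p"
    and Q: "Q \<in> modA A" and h: "h \<in> rmod_hom A Q P"
    and surj: "(\<lambda>x. p (h x)) ` carrier Q = carrier M"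
  shows "h ` carrier Q = carrier P"
proof -
  note c = projective_coverD[OF cov]
  note rm = modA_right_module[OF M] modA_right_module[OF Q] modA_right_module[OF projective_modA[OF c(1)]]
  interpret P: right_module A P by fact
  interpret M: right_module A M by fact
  have "x \<in> h ` carrier Q <+>\<^bsub>P\<^esub> a_kernel P M p" if x: "x \<in> carrier P" for x
  proof -
    obtain y where y: "y \<in> carrier Q" "p x = p (h y)"
      using surj rmod_hom_closed[OF c(2) x] by (metis imageE)
    have hy: "h y \<in> carrier P" by (rule rmod_hom_closed[OF h y(1)])
    have "p (x \<ominus>\<^bsub>P\<^esub> h y) = \<zero>\<^bsub>M\<^esub>"
      using rmod_hom_minus[OF rm(3,1) c(2) x hy] rmod_hom_closed[OF c(2) hy] y(2)
      by (simp add: a_minus_def M.M.r_neg)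
    then have "x \<ominus>\<^bsub>P\<^esub> h y \<in> a_kernel P M p" using x hy by (simp add: a_kernel_eq)
    moreover have "x = h y \<oplus>\<^bsub>P\<^esub> (x \<ominus>\<^bsub>P\<^esub> h y)"
    proof -
      have "h y \<oplus>\<^bsub>P\<^esub> (x \<oplus>\<^bsub>P\<^esub> \<ominus>\<^bsub>P\<^esub> h y) = x \<oplus>\<^bsub>P\<^esub> (h y \<oplus>\<^bsub>P\<^esub> \<ominus>\<^bsub>P\<^esub> h y)"
        using x hy P.M.a_lcomm by simp
      then show ?thesis using x hy by (simp add: a_minus_def P.M.r_neg)
    qed
    ultimately show ?thesis using y(1) unfolding set_add_def' by blast
  qed
  moreover have "h ` carrier Q <+>\<^bsub>P\<^esub> a_kernel P M p \<subseteq> carrier P"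
    using rmod_hom_closed[OF h] by (auto simp: set_add_def' a_kernel_eq)
  ultimately have "h ` carrier Q <+>\<^bsub>P\<^esub> a_kernel P M p = carrier P" by (intro equalityI subsetI) auto
  then show ?thesis by (rule c(4)[OF submodule_image[OF rm(2,3) h submodule_carrier[OF rm(2)]]])
qed

text \<open>The lift \<open>h\<close> from \<open>Q\<close> to \<open>P\<close> is onto since
  \<open>P\<close> is a cover, and splits since \<open>P\<close> is projective. Its kernel
  \<open>Z\<close> is a summand of \<open>Q\<close>, hence projective, and complements the kernel of
  \<open>p\<close> in the kernel of \<open>q\<close>. The bound on \<open>len\<close> makes a cover
  the shortest presentation.\<close>

lemma projective_cover_kernel_split:
  assumes M: "M \<in> modA A" and cov: "projective_cover A M P p"
    and Q: "projective A Q" and q: "q \<in> rmod_hom A Q M" and surj: "q ` carrier Q = carrier M"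
  obtains Z where "projective A Z"
    "rmod_iso A (Q\<lparr>carrier := a_kernel Q M q\<rparr>) (direct_sum (P\<lparr>carrier := a_kernel P M p\<rparr>) Z)"
    "len A P \<le> len A Q"
proof -
  note c = projective_coverD[OF cov]
  note mP = projective_modA[OF c(1)] and mQ = projective_modA[OF Q]
  note rM = modA_right_module[OF M] and rQ = modA_right_module[OF mQ] and rP = modA_right_module[OF mP]
  obtain h where h: "h \<in> rmod_hom A Q P" and ph: "\<And>x. x \<in> carrier Q \<Longrightarrow> p (h x) = q x"
    by (rule projective_lift[OF Q mP M c(2) q c(3)]) blast
  have hs: "h ` carrier Q = carrier P"
    by (rule projective_cover_factor_surj[OF M cov mQ h]) (simp add: ph surj cong: image_cong)
  obtain s where s: "s \<in> rmod_hom A P Q" and sh: "\<And>x. x \<in> carrier P \<Longrightarrow> h (s x) = x"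
    by (rule projective_lift[OF c(1) mQ mP h rmod_hom_id hs]) blast
  let ?Z = "Q\<lparr>carrier := a_kernel Q P h\<rparr>"
  let ?Kq = "Q\<lparr>carrier := a_kernel Q M q\<rparr>" and ?Kp = "P\<lparr>carrier := a_kernel P M p\<rparr>"
  have Kq: "a_kernel Q M q \<subseteq> carrier Q" and Kp: "a_kernel P M p \<subseteq> carrier P" by (auto simp: a_kernel_eq)
  have "rmod_iso A Q (direct_sum P ?Z)" by (rule retract_direct_sum[OF rQ rP s h]) (rule sh)
  then have Z: "projective A ?Z" by (rule projective_summand[OF Q mP modA_kernel[OF mQ mP h]])
  have hK: "h \<in> rmod_hom A ?Kq ?Kp"
    by (rule rmod_hom_codomain[OF rmod_hom_restrict[OF h Kq]])
      (auto simp: a_kernel_eq ph rmod_hom_closed[OF h])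
  have "q (s x) = p x" if "x \<in> carrier P" for x
    using ph[OF rmod_hom_closed[OF s that]] sh[OF that] by simp
  then have sK: "s \<in> rmod_hom A ?Kp ?Kq"
    by (intro rmod_hom_codomain[OF rmod_hom_restrict[OF s Kp]])
      (auto simp: a_kernel_eq rmod_hom_closed[OF s])
  \<comment> \<open>As \<open>q\<close> is \<open>p\<close> after \<open>h\<close>, the kernel of
    \<open>h\<close> lies inside that of \<open>q\<close>. Restricting \<open>h\<close> leaves its
    kernel unchanged, so the same \<open>Z\<close> appears in both splittings.\<close>
  have "a_kernel ?Kq ?Kp h = a_kernel Q P h"
    using rmod_hom_zero[OF rP rM c(2)] by (auto simp: a_kernel_eq simp flip: ph)
  moreover have "rmod_iso A ?Kq (direct_sum ?Kp (?Kq\<lparr>carrier := a_kernel ?Kq ?Kp h\<rparr>))"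
    using mP mQ M q c(2) sh
    by (intro retract_direct_sum[OF _ _ sK hK] modA_right_module modA_kernel) (auto simp: a_kernel_eq)
  ultimately have iso: "rmod_iso A ?Kq (direct_sum ?Kp ?Z)" by simp
  have "len A P \<le> len A Q"
    using len_additive[OF rQ rP h hs modA_finite_length[OF mQ]] by simp
  then show thesis using that[OF Z iso] by blast
qed

lemma direct_sum_superfluous:
  assumes P: "right_module A P" and Q: "right_module A Q" and U: "submodule U A (direct_sum P Q)"
    and Kl: "submodule K A P" and L: "submodule L A Q"
    and sK: "\<And>V. submodule V A P \<Longrightarrow> V <+>\<^bsub>P\<^esub> K = carrier P \<Longrightarrow> V = carrier P"
    and sL: "\<And>V. submodule V A Q \<Longrightarrow> V <+>\<^bsub>Q\<^esub> L = carrier Q \<Longrightarrow> V = carrier Q"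
    and sum: "\<And>x y. x \<in> carrier P \<Longrightarrow> y \<in> carrier Q \<Longrightarrow> \<exists>k\<in>K. \<exists>l\<in>L. (x \<oplus>\<^bsub>P\<^esub> k, y \<oplus>\<^bsub>Q\<^esub> l) \<in> U"
  shows "U = carrier (direct_sum P Q)"
proof -
  interpret P: right_module A P by fact
  interpret Q: right_module A Q by fact
  note UPQ = subsetD[OF submodule_subset[OF U]]
  note KP = subsetD[OF submodule_subset[OF Kl]] and LQ = subsetD[OF submodule_subset[OF L]]
  have add: "(x \<oplus>\<^bsub>P\<^esub> x', y \<oplus>\<^bsub>Q\<^esub> y') \<in> U" if "(x, y) \<in> U" "(x', y') \<in> U" for x y x' y'
    using submodule_add[OF U that] by simp
  have act: "(a \<odot>\<^bsub>P\<^esub> x, a \<odot>\<^bsub>Q\<^esub> y) \<in> U" if "a \<in> carrier A" "(x, y) \<in> U" for a x y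
    using submodule_act[OF U that] by simp
  have minus: "(x \<ominus>\<^bsub>P\<^esub> x', y \<ominus>\<^bsub>Q\<^esub> y') \<in> U" if "(x, y) \<in> U" "(x', y') \<in> U" for x y x' y'
  proof -
    have "(x, y) \<ominus>\<^bsub>direct_sum P Q\<^esub> (x', y') \<in> U" by (rule submodule_minus[OF U that])
    moreover have "fst ((x, y) \<ominus>\<^bsub>direct_sum P Q\<^esub> (x', y')) = x \<ominus>\<^bsub>P\<^esub> x'"
      "snd ((x, y) \<ominus>\<^bsub>direct_sum P Q\<^esub> (x', y')) = y \<ominus>\<^bsub>Q\<^esub> y'"
      using rmod_hom_minus[OF right_module_direct_sum[OF P Q] P rmod_hom_fst UPQ[OF that(1)] UPQ[OF that(2)]]
        rmod_hom_minus[OF right_module_direct_sum[OF P Q] Q rmod_hom_snd UPQ[OF that(1)] UPQ[OF that(2)]]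
      by simp_all
    ultimately show ?thesis by (metis prod.collapse)
  qed
  define V where "V = {x \<in> carrier P. \<exists>l\<in>L. (x, l) \<in> U}"
  have V: "submodule V A P"
  proof (rule submoduleI_right[OF P])
    show "\<zero>\<^bsub>P\<^esub> \<in> V" using submodule_zero[OF U] submodule_zero[OF L] by (auto simp: V_def)
    show "x \<oplus>\<^bsub>P\<^esub> y \<in> V" if "x \<in> V" "y \<in> V" for x y
      using that add submodule_add[OF L] unfolding V_def by blast
    show "a \<odot>\<^bsub>P\<^esub> x \<in> V" if "a \<in> carrier A" "x \<in> V" for a x
      using that act submodule_act[OF L] P.act_closed unfolding V_def by blast
  qed (auto simp: V_def)
  have "x \<in> V <+>\<^bsub>P\<^esub> K" if x: "x \<in> carrier P" for x
  proof -
    obtain k l where kl: "k \<in> K" "l \<in> L" "(x \<oplus>\<^bsub>P\<^esub> k, \<zero>\<^bsub>Q\<^esub> \<oplus>\<^bsub>Q\<^esub> l) \<in> U"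
      using sum[OF x Q.M.zero_closed] by blast
    then have "x \<oplus>\<^bsub>P\<^esub> k \<in> V" using x KP LQ by (auto simp: V_def)
    moreover have "x = (x \<oplus>\<^bsub>P\<^esub> k) \<oplus>\<^bsub>P\<^esub> \<ominus>\<^bsub>P\<^esub> k" using x KP[OF kl(1)] by (simp add: P.M.a_assoc P.M.r_neg)
    ultimately show ?thesis using submodule_neg[OF Kl kl(1)] unfolding set_add_def' by blast
  qed
  then have VP: "V = carrier P"
    using submodule_subset[OF submodule_set_add[OF P V Kl]] by (intro sK[OF V]) blast
  define W where "W = {y \<in> carrier Q. (\<zero>\<^bsub>P\<^esub>, y) \<in> U}"
  have W: "submodule W A Q"
  proof (rule submoduleI_right[OF Q])
    show "\<zero>\<^bsub>Q\<^esub> \<in> W" using submodule_zero[OF U] by (auto simp: W_def)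
    show "x \<oplus>\<^bsub>Q\<^esub> y \<in> W" if "x \<in> W" "y \<in> W" for x y
      using that add[of "\<zero>\<^bsub>P\<^esub>" x "\<zero>\<^bsub>P\<^esub>" y] unfolding W_def by auto
    show "a \<odot>\<^bsub>Q\<^esub> x \<in> W" if "a \<in> carrier A" "x \<in> W" for a x
      using that act[of a "\<zero>\<^bsub>P\<^esub>" x] submodule_act[OF submodule_zero_set[OF P], of a "\<zero>\<^bsub>P\<^esub>"]
      unfolding W_def by (auto simp: Q.act_closed)
  qed (auto simp: W_def)
  have "y \<in> W <+>\<^bsub>Q\<^esub> L" if y: "y \<in> carrier Q" for y
  proof -
    obtain k l where kl: "k \<in> K" "l \<in> L" "(\<zero>\<^bsub>P\<^esub> \<oplus>\<^bsub>P\<^esub> k, y \<oplus>\<^bsub>Q\<^esub> l) \<in> U"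
      using sum[OF P.M.zero_closed y] by blast
    \<comment> \<open>Since \<open>V\<close> is everything, \<open>U\<close> contains a pair with
      first coordinate \<open>k\<close> and second coordinate in \<open>L\<close>. Subtracting it
      clears \<open>k\<close> and changes \<open>y\<close> only by elements of
      \<open>L\<close>.\<close>
    obtain l' where l': "l' \<in> L" "(k, l') \<in> U" using VP KP[OF kl(1)] by (auto simp: V_def)
    have "(k \<ominus>\<^bsub>P\<^esub> k, (y \<oplus>\<^bsub>Q\<^esub> l) \<ominus>\<^bsub>Q\<^esub> l') \<in> U" using minus[OF kl(3) l'(2)] KP[OF kl(1)] by simp
    then have "(y \<oplus>\<^bsub>Q\<^esub> l) \<ominus>\<^bsub>Q\<^esub> l' \<in> W"
      using y LQ[OF kl(2)] LQ[OF l'(1)] KP[OF kl(1)] by (simp add: W_def a_minus_def P.M.r_neg)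
    moreover have "y = ((y \<oplus>\<^bsub>Q\<^esub> l) \<ominus>\<^bsub>Q\<^esub> l') \<oplus>\<^bsub>Q\<^esub> (l' \<ominus>\<^bsub>Q\<^esub> l)"
    proof -
      have "((y \<oplus>\<^bsub>Q\<^esub> l) \<ominus>\<^bsub>Q\<^esub> l') \<oplus>\<^bsub>Q\<^esub> (l' \<ominus>\<^bsub>Q\<^esub> l) = (y \<oplus>\<^bsub>Q\<^esub> l) \<oplus>\<^bsub>Q\<^esub> ((\<ominus>\<^bsub>Q\<^esub> l' \<oplus>\<^bsub>Q\<^esub> l') \<oplus>\<^bsub>Q\<^esub> \<ominus>\<^bsub>Q\<^esub> l)"
        using y LQ[OF kl(2)] LQ[OF l'(1)] by (simp add: a_minus_def Q.M.a_assoc)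
      also have "\<dots> = y" using y LQ[OF kl(2)] LQ[OF l'(1)] by (simp add: Q.M.l_neg Q.M.r_neg Q.M.a_assoc)
      finally show ?thesis by simp
    qed
    ultimately show ?thesis using submodule_minus[OF L l'(1) kl(2)] unfolding set_add_def' by blast
  qed
  then have WQ: "W = carrier Q"
    using submodule_subset[OF submodule_set_add[OF Q W L]] by (intro sL[OF W]) blast
  have "(x, y) \<in> U" if x: "x \<in> carrier P" and y: "y \<in> carrier Q" for x y
  proof -
    obtain l where l: "l \<in> L" "(x, l) \<in> U" using VP x by (auto simp: V_def)
    have "(\<zero>\<^bsub>P\<^esub>, y \<ominus>\<^bsub>Q\<^esub> l) \<in> U" using WQ y LQ[OF l(1)] by (auto simp: W_def)
    from add[OF l(2) this] have "(x, l \<oplus>\<^bsub>Q\<^esub> (y \<ominus>\<^bsub>Q\<^esub> l)) \<in> U" using x by simp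
    moreover have "l \<oplus>\<^bsub>Q\<^esub> (y \<ominus>\<^bsub>Q\<^esub> l) = y"
      using y LQ[OF l(1)] Q.M.a_lcomm[of l y "\<ominus>\<^bsub>Q\<^esub> l"] by (simp add: a_minus_def Q.M.r_neg)
    ultimately show ?thesis by simp
  qed
  then show ?thesis using submodule_subset[OF U] by auto
qed

lemma projective_cover_direct_sum:
  assumes M1: "M1 \<in> modA A" and M2: "M2 \<in> modA A" and N: "N \<in> modA A"
    and iso: "rmod_iso A N (direct_sum M1 M2)"
    and cov1: "projective_cover A M1 P1 p1" and cov2: "projective_cover A M2 P2 p2"
  obtains P p where "projective_cover A N P p"
    "rmod_iso A (P\<lparr>carrier := a_kernel P N p\<rparr>)
      (direct_sum (P1\<lparr>carrier := a_kernel P1 M1 p1\<rparr>) (P2\<lparr>carrier := a_kernel P2 M2 p2\<rparr>))"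
proof -
  note c1 = projective_coverD[OF cov1] and c2 = projective_coverD[OF cov2]
  note mP = projective_modA[OF c1(1)] projective_modA[OF c2(1)]
  note rP1 = modA_right_module[OF mP(1)] and rP2 = modA_right_module[OF mP(2)]
  note rM1 = modA_right_module[OF M1] and rM2 = modA_right_module[OF M2] and rN = modA_right_module[OF N]
  note rP12 = right_module_direct_sum[OF rP1 rP2] and rM12 = right_module_direct_sum[OF rM1 rM2]
  obtain P where P: "P \<in> modA A" "rmod_iso A P (direct_sum P1 P2)"
    by (rule modA_direct_sum_copy[OF mP]) blast
  have projP: "projective A P" by (rule projective_direct_sum[OF c1(1) c2(1) P])
  note rP = modA_right_module[OF P(1)]
  obtain u v where u: "u \<in> rmod_hom A P (direct_sum P1 P2)" and v: "v \<in> rmod_hom A (direct_sum P1 P2) P"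
    and vu: "\<And>x. x \<in> carrier P \<Longrightarrow> v (u x) = x" and uv: "\<And>z. z \<in> carrier (direct_sum P1 P2) \<Longrightarrow> u (v z) = z"
    by (rule rmod_isoE[OF P(2) rP rP12]) blast
  obtain s t where s: "s \<in> rmod_hom A N (direct_sum M1 M2)" and t: "t \<in> rmod_hom A (direct_sum M1 M2) N"
    and ts: "\<And>x. x \<in> carrier N \<Longrightarrow> t (s x) = x" and st: "\<And>z. z \<in> carrier (direct_sum M1 M2) \<Longrightarrow> s (t z) = z"
    by (rule rmod_isoE[OF iso rN rM12]) blast
  define p12 where "p12 = (\<lambda>z. (p1 (fst z), p2 (snd z)))"
  have p12: "p12 \<in> rmod_hom A (direct_sum P1 P2) (direct_sum M1 M2)"
    unfolding p12_def by (intro rmod_hom_Pair rmod_hom_comp[OF rmod_hom_fst c1(2)] rmod_hom_comp[OF rmod_hom_snd c2(2)])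
  define p where "p = (\<lambda>x. t (p12 (u x)))"
  have p: "p \<in> rmod_hom A P N"
    unfolding p_def by (rule rmod_hom_comp[OF rmod_hom_comp[OF u p12] t])
  have surj: "p ` carrier P = carrier N"
  proof
    show "p ` carrier P \<subseteq> carrier N" using rmod_hom_closed[OF p] by auto
    show "carrier N \<subseteq> p ` carrier P"
    proof
      fix y assume y: "y \<in> carrier N"
      have "s y \<in> carrier (direct_sum M1 M2)" by (rule rmod_hom_closed[OF s y])
      then have "fst (s y) \<in> p1 ` carrier P1" "snd (s y) \<in> p2 ` carrier P2"
        using c1(3) c2(3) by auto
      then obtain a b where ab: "a \<in> carrier P1" "fst (s y) = p1 a" "b \<in> carrier P2" "snd (s y) = p2 b"
        by blast
      then have "p (v (a, b)) = t (fst (s y), snd (s y))" using uv[of "(a, b)"] by (simp add: p_def p12_def)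
      then have "y = p (v (a, b))" using ts[OF y] by simp
      then show "y \<in> p ` carrier P" using rmod_hom_closed[OF v, of "(a, b)"] ab by (intro image_eqI) auto
    qed
  qed
  let ?K1 = "a_kernel P1 M1 p1" and ?K2 = "a_kernel P2 M2 p2"
  have p0: "p x = \<zero>\<^bsub>N\<^esub> \<longleftrightarrow> u x \<in> ?K1 \<times> ?K2" if x: "x \<in> carrier P" for x
  proof -
    have ux: "u x \<in> carrier (direct_sum P1 P2)" by (rule rmod_hom_closed[OF u x])
    have "p x = \<zero>\<^bsub>N\<^esub> \<longleftrightarrow> p12 (u x) = \<zero>\<^bsub>direct_sum M1 M2\<^esub>"
      unfolding p_def using st[OF rmod_hom_closed[OF p12 ux]] rmod_hom_zero[OF rM12 rN t] rmod_hom_zero[OF rN rM12 s]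
      by metis
    also have "\<dots> \<longleftrightarrow> u x \<in> ?K1 \<times> ?K2" using ux by (auto simp: p12_def a_kernel_eq mem_Times_iff)
    finally show ?thesis .
  qed
  have "projective_cover A N P p"
    unfolding projective_cover_def
  proof (intro conjI allI impI projP p surj)
    fix U assume "submodule U A P \<and> U <+>\<^bsub>P\<^esub> a_kernel P N p = carrier P"
    then have U: "submodule U A P" and sum: "U <+>\<^bsub>P\<^esub> a_kernel P N p = carrier P" by auto
    interpret P: right_module A P by (rule rP)
    let ?V = "{z \<in> carrier (direct_sum P1 P2). v z \<in> U}"
    have V: "submodule ?V A (direct_sum P1 P2)" by (rule submodule_vimage[OF rP12 rP v U])
    have "?V = carrier (direct_sum P1 P2)"
    proof (rule direct_sum_superfluous[OF rP1 rP2 V submodule_kernel[OF rP1 rM1 c1(2)]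
          submodule_kernel[OF rP2 rM2 c2(2)] c1(4) c2(4)])
      fix x y assume xy: "x \<in> carrier P1" "y \<in> carrier P2"
      have "v (x, y) \<in> carrier P" using rmod_hom_closed[OF v] xy by simp
      then obtain w k where wk: "w \<in> U" "k \<in> a_kernel P N p" "v (x, y) = w \<oplus>\<^bsub>P\<^esub> k"
        using sum unfolding set_add_def' by blast
      have k: "k \<in> carrier P" "p k = \<zero>\<^bsub>N\<^esub>" using wk(2) by (auto simp: a_kernel_eq)
      have w: "w \<in> carrier P" using wk(1) submodule_subset[OF U] by auto
      \<comment> \<open>From \<open>v (x, y) = w + k\<close> it is \<open>v (x, y) + (-k)\<close>
        that lies in \<open>U\<close>; by \<open>p0\<close> the coordinates of \<open>-k\<close> lie
        in \<open>?K1\<close> and \<open>?K2\<close>.\<close>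
      have nk: "\<ominus>\<^bsub>P\<^esub> k \<in> a_kernel P N p"
        using submodule_neg[OF submodule_kernel[OF rP rN p] wk(2)] .
      then have nk': "\<ominus>\<^bsub>P\<^esub> k \<in> carrier P" "u (\<ominus>\<^bsub>P\<^esub> k) \<in> ?K1 \<times> ?K2"
        using p0[of "\<ominus>\<^bsub>P\<^esub> k"] by (auto simp: a_kernel_eq)
      obtain k1 k2 where k12: "u (\<ominus>\<^bsub>P\<^esub> k) = (k1, k2)" "k1 \<in> ?K1" "k2 \<in> ?K2"
        using nk'(2) by auto
      have k12': "k1 \<in> carrier P1" "k2 \<in> carrier P2" using k12 by (auto simp: a_kernel_eq)
      have "v (x \<oplus>\<^bsub>P1\<^esub> k1, y \<oplus>\<^bsub>P2\<^esub> k2) = v (x, y) \<oplus>\<^bsub>P\<^esub> v (k1, k2)"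
        using rmod_hom_add[OF v, of "(x, y)" "(k1, k2)"] xy k12' by simp
      also have "v (k1, k2) = \<ominus>\<^bsub>P\<^esub> k" using vu[OF nk'(1)] k12(1) by simp
      also have "v (x, y) \<oplus>\<^bsub>P\<^esub> \<ominus>\<^bsub>P\<^esub> k = w"
        unfolding wk(3) using w k(1) by (simp add: P.M.a_assoc P.M.r_neg)
      finally have "v (x \<oplus>\<^bsub>P1\<^esub> k1, y \<oplus>\<^bsub>P2\<^esub> k2) \<in> U" using wk(1) by simp
      moreover have "(x \<oplus>\<^bsub>P1\<^esub> k1, y \<oplus>\<^bsub>P2\<^esub> k2) \<in> carrier (direct_sum P1 P2)"
        using submodule_add[OF submodule_carrier[OF rP12], of "(x, y)" "(k1, k2)"] xy k12' by simp
      ultimately show "\<exists>k\<in>?K1. \<exists>l\<in>?K2. (x \<oplus>\<^bsub>P1\<^esub> k, y \<oplus>\<^bsub>P2\<^esub> l) \<in> ?V"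
        using k12 by blast
    qed
    then have "x \<in> U" if x: "x \<in> carrier P" for x
      using rmod_hom_closed[OF u x] vu[OF x] by auto
    then show "U = carrier P" using submodule_subset[OF U] by auto
  qed
  moreover have "rmod_iso A (P\<lparr>carrier := a_kernel P N p\<rparr>)
      (direct_sum (P1\<lparr>carrier := ?K1\<rparr>) (P2\<lparr>carrier := ?K2\<rparr>))" (is "rmod_iso A ?K ?D")
  proof (rule rmod_isoI)
    have DD: "carrier ?D \<subseteq> carrier (direct_sum P1 P2)" by (auto simp: a_kernel_eq)
    have D: "?D = (direct_sum P1 P2)\<lparr>carrier := ?K1 \<times> ?K2\<rparr>" by (simp add: direct_sum_def)
    show "u \<in> rmod_hom A ?K ?D"
      unfolding D
      by (rule rmod_hom_codomain[OF rmod_hom_restrict[OF u]]) (use p0 in \<open>auto simp: a_kernel_eq\<close>)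
    show "v \<in> rmod_hom A ?D ?K"
      unfolding D
    proof (rule rmod_hom_codomain[OF rmod_hom_restrict[OF v]])
      show "?K1 \<times> ?K2 \<subseteq> carrier (direct_sum P1 P2)" using DD by simp
      then show "v ` carrier ((direct_sum P1 P2)\<lparr>carrier := ?K1 \<times> ?K2\<rparr>) \<subseteq> a_kernel P N p"
        using p0 uv rmod_hom_closed[OF v] by (auto simp: a_kernel_eq[of P])
    qed
    show "u (v z) = z" if "z \<in> carrier ?D" for z using uv that DD by blast
  qed (auto simp: vu a_kernel_eq)
  ultimately show thesis by (rule that)
qed

text \<open>Each of two covers is a presentation for the other, so they have equal length, and
  either kernel has the length of the cover minus \<open>len A M\<close>.\<close>

lemma len_projective_cover_kernel:
  assumes M: "M \<in> modA A" and cov: "projective_cover A M P p"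
  shows "len A (P\<lparr>carrier := a_kernel P M p\<rparr>) = len A (syzygy A M)"
proof -
  obtain Q q where cov': "projective_cover A M Q q" and syz: "syzygy A M = Q\<lparr>carrier := a_kernel Q M q\<rparr>"
    by (rule syzygy_cover[OF M]) blast
  note c = projective_coverD[OF cov] and c' = projective_coverD[OF cov']
  have le: "len A P \<le> len A Q" "len A Q \<le> len A P"
    using projective_cover_kernel_split[OF M cov c'(1-3)] projective_cover_kernel_split[OF M cov' c(1-3)]
    by blast+
  have "len A P = len A (P\<lparr>carrier := a_kernel P M p\<rparr>) + len A M"
    using len_additive[OF _ _ c(2,3)] M projective_modA[OF c(1)]
    by (simp add: modA_right_module modA_finite_length)
  moreover have "len A Q = len A (syzygy A M) + len A M"
    unfolding syz using len_additive[OF _ _ c'(2,3)] M projective_modA[OF c'(1)]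
    by (simp add: modA_right_module modA_finite_length)
  ultimately show ?thesis using le by simp
qed

lemma len_syzygy_direct_sum:
  assumes M1: "M1 \<in> modA A" and M2: "M2 \<in> modA A" and N: "N \<in> modA A"
    and iso: "rmod_iso A N (direct_sum M1 M2)"
  shows "len A (syzygy A N) = len A (syzygy A M1) + len A (syzygy A M2)"
proof -
  obtain P1 p1 where 1: "projective_cover A M1 P1 p1" "syzygy A M1 = P1\<lparr>carrier := a_kernel P1 M1 p1\<rparr>"
    by (rule syzygy_cover[OF M1]) blast
  obtain P2 p2 where 2: "projective_cover A M2 P2 p2" "syzygy A M2 = P2\<lparr>carrier := a_kernel P2 M2 p2\<rparr>"
    by (rule syzygy_cover[OF M2]) blast
  obtain P p where P: "projective_cover A N P p"
      "rmod_iso A (P\<lparr>carrier := a_kernel P N p\<rparr>) (direct_sum (syzygy A M1) (syzygy A M2))"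
    using projective_cover_direct_sum[OF M1 M2 N iso 1(1) 2(1)] unfolding 1(2) 2(2) by blast
  note c = projective_coverD[OF P(1)]
  have mK: "P\<lparr>carrier := a_kernel P N p\<rparr> \<in> modA A"
    by (rule modA_kernel[OF projective_modA[OF c(1)] N c(2)])
  have "len A (syzygy A N) = len A (P\<lparr>carrier := a_kernel P N p\<rparr>)"
    by (rule len_projective_cover_kernel[OF N P(1), symmetric])
  also have "\<dots> = len A (direct_sum (syzygy A M1) (syzygy A M2))"
    using mK M1 M2 by (intro len_iso[OF P(2)] right_module_direct_sum modA_right_module
        modA_finite_length syzygy_modA)
  also have "\<dots> = len A (syzygy A M1) + len A (syzygy A M2)"
    using M1 M2 by (intro len_direct_sum modA_right_module modA_finite_length syzygy_modA)
  finally show ?thesis .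
qed

text \<open>A projective module is its own cover, with zero kernel. Conversely a cover whose kernel
  has length 0 is an isomorphism.\<close>

lemma len_syzygy_eq_0_iff:
  assumes M: "M \<in> modA A"
  shows "len A (syzygy A M) = 0 \<longleftrightarrow> projective A M"
proof
  note rM = modA_right_module[OF M]
  assume P: "projective A M"
  have ker: "a_kernel M M (\<lambda>x. x) = {\<zero>\<^bsub>M\<^esub>}"
    using submodule_zero[OF submodule_carrier[OF rM]] by (auto simp: a_kernel_eq)
  have "projective_cover A M M (\<lambda>x. x)"
    unfolding projective_cover_def
  proof (intro conjI allI impI P rmod_hom_id)
    interpret M: right_module A M by (rule rM)
    fix U assume U: "submodule U A M \<and> U <+>\<^bsub>M\<^esub> a_kernel M M (\<lambda>x. x) = carrier M"
    have UM: "U \<subseteq> carrier M" using U submodule_subset by blast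
    have "carrier M = (\<lambda>x. x \<oplus>\<^bsub>M\<^esub> \<zero>\<^bsub>M\<^esub>) ` U" using U by (auto simp: ker set_add_def')
    also have "\<dots> = (\<lambda>x. x) ` U" by (rule image_cong) (use UM in auto)
    finally show "U = carrier M" by simp
  qed simp
  from len_projective_cover_kernel[OF M this] show "len A (syzygy A M) = 0"
    using len_zero_module[OF right_module_submodule[OF rM submodule_zero_set[OF rM]]] by (simp add: ker)
next
  assume 0: "len A (syzygy A M) = 0"
  obtain P p where cov: "projective_cover A M P p" and syz: "syzygy A M = P\<lparr>carrier := a_kernel P M p\<rparr>"
    by (rule syzygy_cover[OF M]) blast
  note c = projective_coverD[OF cov]
  note rM = modA_right_module[OF M] and rP = modA_right_module[OF projective_modA[OF c(1)]]
  have "inj_on p (carrier P)"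
    using len_inj_surj[OF rP rM c(2,3)] len_additive[OF rP rM c(2,3)] 0
      modA_finite_length[OF projective_modA[OF c(1)]] by (simp add: syz)
  then have "rmod_iso A P M" using c(2,3) by (auto simp: rmod_iso_def bij_betw_def)
  then show "projective A M"
    using projective_iso[OF rmod_iso_sym[OF _ rP rM] c(1) M] by blast
qed

end

section \<open>The group of classes\<close>

context finite_length_ring
begin

abbreviation free_modA where "free_modA \<equiv> free_Abelian_group (modA A)"

lemma K0_relators_subset: "K0_relators A \<subseteq> carrier free_modA"
proof
  fix x assume "x \<in> K0_relators A"
  then consider M M' M'' where "x = frag_of M - frag_of M' - frag_of M''" "M \<in> modA A" "M' \<in> modA A" "M'' \<in> modA A"
    | P where "x = frag_of P" "projective A P"
    unfolding K0_relators_def by blast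
  then show "x \<in> carrier free_modA"
  proof cases
    case (1 M M' M'')
    then show ?thesis
      using keys_diff[of "frag_of M" "frag_of M'"] keys_diff[of "frag_of M - frag_of M'" "frag_of M''"] by auto
  qed (simp add: projective_modA)
qed

lemma K0_subgroup_subgroup: "subgroup (K0_subgroup A) free_modA"
  unfolding K0_subgroup_def by (rule group.generate_is_subgroup[OF group_free_Abelian_group K0_relators_subset])

lemma K0_subgroup_normal: "K0_subgroup A \<lhd> free_modA"
  by (rule comm_group.subgroup_imp_normal[OF abelian_free_Abelian_group K0_subgroup_subgroup])

lemma comm_group_K0: "comm_group (K0 A)"
  unfolding K0_def by (rule comm_group.abelian_FactGroup[OF abelian_free_Abelian_group K0_subgroup_subgroup])

sublocale K0: comm_group "K0 A"
  by (rule comm_group_K0)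

lemma K0_proj_hom: "(\<lambda>x. K0_subgroup A #>\<^bsub>free_modA\<^esub> x) \<in> hom free_modA (K0 A)"
  unfolding K0_def by (rule normal.r_coset_hom_Mod[OF K0_subgroup_normal])

lemma K0_proj_eq_one: "x \<in> K0_subgroup A \<Longrightarrow> K0_subgroup A #>\<^bsub>free_modA\<^esub> x = \<one>\<^bsub>K0 A\<^esub>"
  using group.coset_join2[OF group_free_Abelian_group _ K0_subgroup_subgroup, of x]
    subgroup.mem_carrier[OF K0_subgroup_subgroup, of x] by (simp add: K0_def)

lemma K0_class_closed: "M \<in> modA A \<Longrightarrow> K0_class A M \<in> carrier (K0 A)"
  unfolding K0_class_def by (rule hom_in_carrier[OF K0_proj_hom]) simp

lemma K0_class_projective:
  assumes "projective A P"
  shows "K0_class A P = \<one>\<^bsub>K0 A\<^esub>"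
  unfolding K0_class_def
proof (rule K0_proj_eq_one)
  have "frag_of P \<in> K0_relators A" using assms by (auto simp: K0_relators_def)
  then show "frag_of P \<in> K0_subgroup A" unfolding K0_subgroup_def by (rule generate.incl)
qed

lemma K0_class_direct_sum:
  assumes M: "M \<in> modA A" and M': "M' \<in> modA A" and M'': "M'' \<in> modA A"
    and iso: "rmod_iso A M (direct_sum M' M'')"
  shows "K0_class A M = K0_class A M' \<otimes>\<^bsub>K0 A\<^esub> K0_class A M''"
proof -
  let ?r = "frag_of M - frag_of M' - frag_of M''"
  have "?r \<in> K0_relators A" unfolding K0_relators_def using assms by blast
  then have r: "?r \<in> K0_subgroup A" unfolding K0_subgroup_def by (rule generate.incl)
  then have rF: "?r \<in> carrier free_modA" by (rule subgroup.mem_carrier[OF K0_subgroup_subgroup])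
  let ?q = "\<lambda>x. K0_subgroup A #>\<^bsub>free_modA\<^esub> x"
  have MM: "frag_of M' + frag_of M'' \<in> carrier free_modA"
    using M' M'' keys_add[of "frag_of M'" "frag_of M''"] by auto
  have "?q (frag_of M) = ?q (?r \<otimes>\<^bsub>free_modA\<^esub> (frag_of M' + frag_of M''))" by simp
  also have "\<dots> = ?q ?r \<otimes>\<^bsub>K0 A\<^esub> ?q (frag_of M' + frag_of M'')"
    by (rule hom_mult[OF K0_proj_hom rF MM])
  also have "\<dots> = ?q (frag_of M' + frag_of M'')"
    using hom_in_carrier[OF K0_proj_hom MM] by (simp add: K0_proj_eq_one[OF r])
  also have "\<dots> = ?q (frag_of M') \<otimes>\<^bsub>K0 A\<^esub> ?q (frag_of M'')"
    using hom_mult[OF K0_proj_hom, of "frag_of M'" "frag_of M''"] M' M'' by simp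
  finally show ?thesis unfolding K0_class_def .
qed

text \<open>A function on modules extends to the free abelian group, and the two conditions place
  all relators in the kernel of the extension. Both the length invariant and the syzygy endomorphism
  arise from this lemma.\<close>

lemma K0_universal:
  assumes H: "comm_group H" and u: "\<And>M. M \<in> modA A \<Longrightarrow> u M \<in> carrier H"
    and add: "\<And>M M' M''. M \<in> modA A \<Longrightarrow> M' \<in> modA A \<Longrightarrow> M'' \<in> modA A \<Longrightarrow>
      rmod_iso A M (direct_sum M' M'') \<Longrightarrow> u M = u M' \<otimes>\<^bsub>H\<^esub> u M''"
    and proj: "\<And>P. projective A P \<Longrightarrow> u P = \<one>\<^bsub>H\<^esub>"
  obtains g where "g \<in> hom (K0 A) H" "\<And>M. M \<in> modA A \<Longrightarrow> g (K0_class A M) = u M"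
proof -
  interpret H: comm_group H by (rule H)
  obtain h where h: "h \<in> hom free_modA H" and hu: "\<And>M. M \<in> modA A \<Longrightarrow> h (frag_of M) = u M"
    using H.free_Abelian_group_universal[of u "modA A"] u by (metis image_subsetI)
  interpret h: group_hom free_modA H h
    by (intro group_hom.intro group_hom_axioms.intro group_free_Abelian_group H.group_axioms h)
  have hdiff: "h (x - y) = h x \<otimes>\<^bsub>H\<^esub> inv\<^bsub>H\<^esub> h y" if "x \<in> carrier free_modA" "y \<in> carrier free_modA" for x y
    using h.hom_mult[of x "inv\<^bsub>free_modA\<^esub> y"] h.hom_inv[of y] that by simp
  have "h x = \<one>\<^bsub>H\<^esub>" if "x \<in> K0_relators A" for x
    using that unfolding K0_relators_def
  proof
    assume "x \<in> {frag_of M - frag_of M' - frag_of M'' | M M' M''.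
        M \<in> modA A \<and> M' \<in> modA A \<and> M'' \<in> modA A \<and> rmod_iso A M (direct_sum M' M'')}"
    then obtain M M' M'' where x: "x = frag_of M - frag_of M' - frag_of M''"
      and M: "M \<in> modA A" "M' \<in> modA A" "M'' \<in> modA A" "rmod_iso A M (direct_sum M' M'')" by blast
    have "frag_of M - frag_of M' \<in> carrier free_modA"
      using keys_diff[of "frag_of M" "frag_of M'"] M by auto
    then have "h x = (h (frag_of M) \<otimes>\<^bsub>H\<^esub> inv\<^bsub>H\<^esub> h (frag_of M')) \<otimes>\<^bsub>H\<^esub> inv\<^bsub>H\<^esub> h (frag_of M'')"
      unfolding x using hdiff M by simp
    then show ?thesis
      using M u by (simp add: hu add[OF M] H.m_ac H.inv_mult_group)
  next
    assume "x \<in> {frag_of P |P. projective A P}"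
    then show ?thesis using hu projective_modA proj by auto
  qed
  then have "K0_relators A \<subseteq> kernel free_modA H h"
    using K0_relators_subset unfolding kernel_def by blast
  then have "K0_subgroup A \<subseteq> kernel free_modA H h"
    unfolding K0_subgroup_def by (rule group.generate_subgroup_incl[OF group_free_Abelian_group _ h.subgroup_kernel])
  then obtain g where "g \<in> hom (K0 A) H" "\<And>x. x \<in> carrier free_modA \<Longrightarrow> g (K0_subgroup A #>\<^bsub>free_modA\<^esub> x) = h x"
    unfolding K0_def by (rule h.FactGroup_universal_kernel[OF K0_subgroup_normal]) blast
  then show thesis using hu by (intro that[of g]) (auto simp: K0_class_def)
qed

text \<open>Classes of modules generate \<open>K0 A\<close>: every element comes from a formal sum,
  obtained from single modules by differences.\<close>

lemma K0_hom_eqI: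
  assumes H: "group H" and f: "f \<in> hom (K0 A) H" and g: "g \<in> hom (K0 A) H"
    and eq: "\<And>M. M \<in> modA A \<Longrightarrow> f (K0_class A M) = g (K0_class A M)" and x: "x \<in> carrier (K0 A)"
  shows "f x = g x"
proof -
  let ?q = "\<lambda>x. K0_subgroup A #>\<^bsub>free_modA\<^esub> x"
  have fq: "(\<lambda>x. f (?q x)) \<in> hom free_modA H" and gq: "(\<lambda>x. g (?q x)) \<in> hom free_modA H"
    using hom_compose[OF K0_proj_hom f] hom_compose[OF K0_proj_hom g] by (simp_all add: comp_def)
  interpret f: group_hom free_modA H "\<lambda>x. f (?q x)"
    by (intro group_hom.intro group_hom_axioms.intro group_free_Abelian_group H fq)
  interpret g: group_hom free_modA H "\<lambda>x. g (?q x)"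
    by (intro group_hom.intro group_hom_axioms.intro group_free_Abelian_group H gq)
  have "f (?q y) = g (?q y)" if "Poly_Mapping.keys y \<subseteq> modA A" for y
    using that
  proof (rule free_Abelian_group_induct)
    show "f (?q 0) = g (?q 0)" using f.hom_one g.hom_one by simp
    show "f (?q (frag_of M)) = g (?q (frag_of M))" if "M \<in> modA A" for M
      using eq[OF that] by (simp add: K0_class_def)
    fix y z :: "('a fgmod) \<Rightarrow>\<^sub>0 int"
    assume yz: "Poly_Mapping.keys y \<subseteq> modA A" "Poly_Mapping.keys z \<subseteq> modA A"
      "f (?q y) = g (?q y)" "f (?q z) = g (?q z)"
    then show "f (?q (y - z)) = g (?q (y - z))"
      using f.hom_mult[of y "inv\<^bsub>free_modA\<^esub> z"] g.hom_mult[of y "inv\<^bsub>free_modA\<^esub> z"] f.hom_inv[of z] g.hom_inv[of z] by simp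
  qed
  then show ?thesis using x by (auto simp: K0_def carrier_FactGroup)
qed

section \<open>Detecting nonzero classes by the length of the syzygy\<close>

lemma syzygy_length_hom:
  obtains g where "g \<in> hom (K0 A) integer_group"
    "\<And>M. M \<in> modA A \<Longrightarrow> g (K0_class A M) = int (len A (syzygy A M))"
proof (rule K0_universal[where H = integer_group and u = "\<lambda>M. int (len A (syzygy A M))"])
  show "comm_group integer_group" by (rule abelian_integer_group)
  show "int (len A (syzygy A P)) = \<one>\<^bsub>integer_group\<^esub>" if "projective A P" for P
    using len_syzygy_eq_0_iff[OF projective_modA[OF that]] that by simp
qed (auto simp: len_syzygy_direct_sum that)

lemma K0_class_eq_one_iff:
  assumes M: "M \<in> modA A"
  shows "K0_class A M = \<one>\<^bsub>K0 A\<^esub> \<longleftrightarrow> projective A M"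
proof
  assume 1: "K0_class A M = \<one>\<^bsub>K0 A\<^esub>"
  obtain g where g: "g \<in> hom (K0 A) integer_group" "\<And>M. M \<in> modA A \<Longrightarrow> g (K0_class A M) = int (len A (syzygy A M))"
    by (rule syzygy_length_hom) blast
  have "int (len A (syzygy A M)) = 0"
    using g(2)[OF M] hom_one[OF g(1) K0.group_axioms] 1 by simp
  then show "projective A M" using len_syzygy_eq_0_iff[OF M] by simp
qed (rule K0_class_projective)

text \<open>The invariant is nonnegative on classes of modules, so two of its values can add up to 0
  only if both are 0.\<close>

lemma K0_class_summand:
  assumes M: "M \<in> modA A" and M': "M' \<in> modA A"
    and eq: "K0_class A M \<otimes>\<^bsub>K0 A\<^esub> K0_class A M' = \<one>\<^bsub>K0 A\<^esub>"
  shows "K0_class A M = \<one>\<^bsub>K0 A\<^esub>"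
proof -
  obtain g where g: "g \<in> hom (K0 A) integer_group" "\<And>M. M \<in> modA A \<Longrightarrow> g (K0_class A M) = int (len A (syzygy A M))"
    by (rule syzygy_length_hom) blast
  have "int (len A (syzygy A M)) + int (len A (syzygy A M')) = 0"
    using hom_mult[OF g(1) K0_class_closed[OF M] K0_class_closed[OF M']] hom_one[OF g(1) K0.group_axioms]
      eq g(2)[OF M] g(2)[OF M'] by simp
  then show ?thesis
    using len_syzygy_eq_0_iff[OF M] K0_class_projective by simp
qed

text \<open>Schanuel's lemma, at the level of classes.\<close>

lemma K0_class_kernel:
  assumes M: "M \<in> modA A" and Q: "projective A Q" and q: "q \<in> rmod_hom A Q M"
    and surj: "q ` carrier Q = carrier M"
  shows "K0_class A (Q\<lparr>carrier := a_kernel Q M q\<rparr>) = K0_class A (syzygy A M)"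
proof -
  obtain P p where cov: "projective_cover A M P p" and syz: "syzygy A M = P\<lparr>carrier := a_kernel P M p\<rparr>"
    by (rule syzygy_cover[OF M]) blast
  obtain Z where Z: "projective A Z"
    and iso: "rmod_iso A (Q\<lparr>carrier := a_kernel Q M q\<rparr>) (direct_sum (syzygy A M) Z)"
    unfolding syz by (rule projective_cover_kernel_split[OF M cov Q q surj]) blast
  show ?thesis
    using K0_class_direct_sum[OF modA_kernel[OF projective_modA[OF Q] M q] syzygy_modA[OF M] projective_modA[OF Z] iso]
      K0_class_closed[OF syzygy_modA[OF M]] K0_class_projective[OF Z] by simp
qed

text \<open>The identity is a projective presentation with zero kernel, and by
  \<open>K0_class_kernel\<close> the chosen syzygy has the class of that kernel.\<close>

lemma K0_class_syzygy_projective: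
  assumes P: "projective A P"
  shows "K0_class A (syzygy A P) = \<one>\<^bsub>K0 A\<^esub>"
proof -
  note mP = projective_modA[OF P]
  note rP = modA_right_module[OF mP]
  have ker: "a_kernel P P (\<lambda>x. x) = {\<zero>\<^bsub>P\<^esub>}"
    using submodule_zero[OF submodule_carrier[OF rP]] by (auto simp: a_kernel_eq)
  have "projective A (P\<lparr>carrier := a_kernel P P (\<lambda>x. x)\<rparr>)"
    by (rule projective_zero_module[OF modA_kernel[OF mP mP rmod_hom_id]]) (simp add: ker)
  then show ?thesis
    using K0_class_kernel[OF mP P rmod_hom_id] K0_class_projective by simp
qed

text \<open>The two chosen covers combine to a cover of \<open>N\<close> whose kernel is the sum of
  the two syzygies; \<open>K0_class_kernel\<close> then exchanges this kernel for the chosen syzygy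
  of \<open>N\<close>.\<close>

lemma K0_class_syzygy_direct_sum:
  assumes N: "N \<in> modA A" and M1: "M1 \<in> modA A" and M2: "M2 \<in> modA A"
    and iso: "rmod_iso A N (direct_sum M1 M2)"
  shows "K0_class A (syzygy A N) = K0_class A (syzygy A M1) \<otimes>\<^bsub>K0 A\<^esub> K0_class A (syzygy A M2)"
proof -
  obtain P1 p1 where 1: "projective_cover A M1 P1 p1" "syzygy A M1 = P1\<lparr>carrier := a_kernel P1 M1 p1\<rparr>"
    by (rule syzygy_cover[OF M1]) blast
  obtain P2 p2 where 2: "projective_cover A M2 P2 p2" "syzygy A M2 = P2\<lparr>carrier := a_kernel P2 M2 p2\<rparr>"
    by (rule syzygy_cover[OF M2]) blast
  obtain P p where P: "projective_cover A N P p"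
      and ker: "rmod_iso A (P\<lparr>carrier := a_kernel P N p\<rparr>) (direct_sum (syzygy A M1) (syzygy A M2))"
    unfolding 1(2) 2(2) by (rule projective_cover_direct_sum[OF M1 M2 N iso 1(1) 2(1)]) blast
  note c = projective_coverD[OF P]
  show ?thesis
    using K0_class_direct_sum[OF modA_kernel[OF projective_modA[OF c(1)] N c(2)] syzygy_modA[OF M1]
        syzygy_modA[OF M2] ker] K0_class_kernel[OF N c(1-3)] by simp
qed

section \<open>The syzygy endomorphism of \<open>K0\<close>\<close>

lemma Omega_bar_unique:
  "\<exists>!f. f \<in> hom (K0 A) (K0 A) \<and> f \<in> extensional (carrier (K0 A)) \<and>
    (\<forall>M\<in>modA A. f (K0_class A M) = K0_class A (syzygy A M))"
proof (rule ex_ex1I)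
  obtain g where g: "g \<in> hom (K0 A) (K0 A)" "\<And>M. M \<in> modA A \<Longrightarrow> g (K0_class A M) = K0_class A (syzygy A M)"
  proof (rule K0_universal[OF comm_group_K0])
    show "K0_class A (syzygy A M) \<in> carrier (K0 A)" if "M \<in> modA A" for M
      by (rule K0_class_closed[OF syzygy_modA[OF that]])
  qed ((rule K0_class_syzygy_direct_sum; assumption), (rule K0_class_syzygy_projective; assumption), blast)
  \<comment> \<open>Restriction to the carrier supplies the extensionality that the definite
    description in \<open>Omega_bar_def\<close> asks for.\<close>
  have "restrict g (carrier (K0 A)) \<in> hom (K0 A) (K0 A)"
    using g(1) by (auto simp: hom_def Pi_iff)
  then show "\<exists>f. f \<in> hom (K0 A) (K0 A) \<and> f \<in> extensional (carrier (K0 A)) \<and>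
      (\<forall>M\<in>modA A. f (K0_class A M) = K0_class A (syzygy A M))"
    using g(2) K0_class_closed by (intro exI[of _ "restrict g (carrier (K0 A))"]) auto
next
  fix f g
  assume f: "f \<in> hom (K0 A) (K0 A) \<and> f \<in> extensional (carrier (K0 A)) \<and>
      (\<forall>M\<in>modA A. f (K0_class A M) = K0_class A (syzygy A M))"
    and g: "g \<in> hom (K0 A) (K0 A) \<and> g \<in> extensional (carrier (K0 A)) \<and>
      (\<forall>M\<in>modA A. g (K0_class A M) = K0_class A (syzygy A M))"
  show "f = g"
  proof (rule extensionalityI)
    show "f \<in> extensional (carrier (K0 A))" "g \<in> extensional (carrier (K0 A))" using f g by auto
    show "f x = g x" if "x \<in> carrier (K0 A)" for x
      by (rule K0_hom_eqI[OF K0.group_axioms _ _ _ that]) (use f g in auto)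
  qed
qed

lemma Omega_bar_hom: "Omega_bar A \<in> hom (K0 A) (K0 A)"
  and Omega_bar_class: "M \<in> modA A \<Longrightarrow> Omega_bar A (K0_class A M) = K0_class A (syzygy A M)"
  using theI'[OF Omega_bar_unique] unfolding Omega_bar_def by auto

lemma Omega_bar_pow_hom: "(Omega_bar A ^^ n) \<in> hom (K0 A) (K0 A)"
proof (induction n)
  case 0
  show ?case by (auto simp: hom_def)
next
  case (Suc n)
  show ?case using hom_compose[OF Suc Omega_bar_hom] by (simp add: comp_def)
qed

lemma Omega_bar_pow_one: "(Omega_bar A ^^ n) \<one>\<^bsub>K0 A\<^esub> = \<one>\<^bsub>K0 A\<^esub>"
  by (rule hom_one[OF Omega_bar_pow_hom K0.group_axioms K0.group_axioms])

lemma syzygy_pow_modA: "M \<in> modA A \<Longrightarrow> (syzygy A ^^ n) M \<in> modA A"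
  by (induction n) (auto simp: syzygy_modA)

lemma Omega_bar_pow_class:
  "M \<in> modA A \<Longrightarrow> (Omega_bar A ^^ n) (K0_class A M) = K0_class A ((syzygy A ^^ n) M)"
  by (induction n) (auto simp: Omega_bar_class syzygy_pow_modA)

text \<open>The right-hand side depends on the class of \<open>M\<close> alone. Iterated syzygies of
  modules with equal classes can thus be compared although every syzygy is a choice.\<close>

lemma projective_syzygy_pow_iff:
  "M \<in> modA A \<Longrightarrow> projective A ((syzygy A ^^ n) M) \<longleftrightarrow> (Omega_bar A ^^ n) (K0_class A M) = \<one>\<^bsub>K0 A\<^esub>"
  by (simp add: Omega_bar_pow_class K0_class_eq_one_iff syzygy_pow_modA)

section \<open>Projective dimension\<close>

lemma projective_resolution_0:
  assumes "projective A M"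
  shows "projective_resolution A M 0 (\<lambda>_. M) (\<lambda>_ x. x)"
  using assms by (simp add: projective_resolution_def rmod_hom_id)

text \<open>Splicing: the kernel at position 0 of the given resolution disappears, and
  \<open>P\<close> takes the place between its first projective and \<open>M\<close>.\<close>

lemma projective_resolution_Suc:
  assumes P: "projective A P" and p: "p \<in> rmod_hom A P M" and surj: "p ` carrier P = carrier M"
    and res: "projective_resolution A (P\<lparr>carrier := a_kernel P M p\<rparr>) n C d"
  shows "projective_resolution A M (Suc n)
    (\<lambda>i. case i of 0 \<Rightarrow> M | Suc 0 \<Rightarrow> P | Suc (Suc j) \<Rightarrow> C (Suc j)) (\<lambda>i. case i of 0 \<Rightarrow> p | Suc j \<Rightarrow> d j)"
    (is "projective_resolution A M (Suc n) ?C ?d")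
proof -
  let ?L = "P\<lparr>carrier := a_kernel P M p\<rparr>"
  have C0: "C 0 = ?L" and C: "\<And>i. i \<le> n \<Longrightarrow> projective A (C (Suc i))"
    and d: "\<And>i. i \<le> n \<Longrightarrow> d i \<in> rmod_hom A (C (Suc i)) (C i)"
    and d0: "d 0 ` carrier (C (Suc 0)) = carrier ?L"
    and ex: "\<And>i. i < n \<Longrightarrow> d (Suc i) ` carrier (C (Suc (Suc i))) = a_kernel (C (Suc i)) (C i) (d i)"
    and inj: "inj_on (d n) (carrier (C (Suc n)))"
    using res by (auto simp: projective_resolution_def)
  \<comment> \<open>The old first map ends in the kernel \<open>C 0\<close>; followed by the
    inclusion it ends in \<open>P\<close>.\<close>
  have dP: "d 0 \<in> rmod_hom A (C (Suc 0)) P"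
    using d[of 0] C0 by (intro rmod_hom_codomain_incl[where N = P and V = "a_kernel P M p"]) (auto simp: a_kernel_eq)
  show ?thesis
    unfolding projective_resolution_def
  proof (intro conjI allI impI)
    fix i assume i: "i \<le> Suc n"
    show "projective A (?C (Suc i))" using i P C by (cases i) auto
    show "?d i \<in> rmod_hom A (?C (Suc i)) (?C i)"
    proof (cases i)
      case (Suc j)
      then show ?thesis using d[of j] dP i by (cases j) auto
    qed (simp add: p)
  next
    fix i assume i: "i < Suc n"
    show "?d (Suc i) ` carrier (?C (Suc (Suc i))) = a_kernel (?C (Suc i)) (?C i) (?d i)"
    proof (cases i)
      case 0
      then show ?thesis using d0 by simp
    next
      case (Suc j)
      \<comment> \<open>For \<open>j = 0\<close> the codomain of \<open>d 0\<close> has changed from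
        the kernel to \<open>P\<close>. Both have the same zero, so \<open>a_kernel\<close> is
        unchanged.\<close>
      then show ?thesis using ex[of j] i C0 by (cases j) (auto simp: a_kernel_eq)
    qed
  qed (use surj inj in auto)
qed

lemma projective_resolution_exists:
  assumes "M \<in> modA A" "projective A ((syzygy A ^^ n) M)"
  shows "\<exists>C d. projective_resolution A M n C d"
  using assms
proof (induction n arbitrary: M)
  case 0
  then show ?case using projective_resolution_0 by auto
next
  case (Suc n)
  obtain P p where cov: "projective_cover A M P p" and syz: "syzygy A M = P\<lparr>carrier := a_kernel P M p\<rparr>"
    by (rule syzygy_cover[OF Suc.prems(1)]) blast
  have "projective A ((syzygy A ^^ n) (syzygy A M))"
    using Suc.prems(2) by (simp only: funpow_Suc_right comp_apply)
  then obtain C d where "projective_resolution A (syzygy A M) n C d"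
    using Suc.IH[OF syzygy_modA[OF Suc.prems(1)]] by auto
  then show ?case
    unfolding syz using projective_resolution_Suc[OF projective_coverD(1-3)[OF cov]] by (intro exI)
qed

text \<open>The kernel \<open>L\<close> of the first map of the resolution may differ from the
  chosen syzygy by a projective summand, but both have the same class. By
  \<open>projective_syzygy_pow_iff\<close> the class decides whether the \<open>n\<close>-th syzygy
  is projective.\<close>

lemma projective_resolution_imp:
  assumes "M \<in> modA A" "projective_resolution A M n C d"
  shows "projective A ((syzygy A ^^ n) M)"
  using assms
proof (induction n arbitrary: M C d)
  case 0
  then have C: "projective A (C (Suc 0))" and d: "d 0 \<in> rmod_hom A (C (Suc 0)) M"
    "d 0 ` carrier (C (Suc 0)) = carrier M" "inj_on (d 0) (carrier (C (Suc 0)))"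
    by (auto simp: projective_resolution_def)
  then have "rmod_iso A (C (Suc 0)) M" by (auto simp: rmod_iso_def bij_betw_def)
  from rmod_iso_sym[OF this] show ?case
    using projective_iso[OF _ C 0(1)] modA_right_module[OF projective_modA[OF C]] modA_right_module[OF 0(1)] by simp
next
  case (Suc n)
  note M = Suc.prems(1)
  have C0: "C 0 = M" and C: "\<And>i. i \<le> Suc n \<Longrightarrow> projective A (C (Suc i))"
    and d: "\<And>i. i \<le> Suc n \<Longrightarrow> d i \<in> rmod_hom A (C (Suc i)) (C i)"
    and d0: "d 0 ` carrier (C (Suc 0)) = carrier M"
    and ex: "\<And>i. i < Suc n \<Longrightarrow> d (Suc i) ` carrier (C (Suc (Suc i))) = a_kernel (C (Suc i)) (C i) (d i)"
    and inj: "inj_on (d (Suc n)) (carrier (C (Suc (Suc n))))"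
    using Suc.prems(2) by (auto simp: projective_resolution_def)
  define L where "L = (C (Suc 0))\<lparr>carrier := a_kernel (C (Suc 0)) M (d 0)\<rparr>"
  have d0M: "d 0 \<in> rmod_hom A (C (Suc 0)) M" using d[of 0] C0 by simp
  have mL: "L \<in> modA A" unfolding L_def by (rule modA_kernel[OF projective_modA[OF C] M d0M]) simp
  have d1: "d (Suc 0) \<in> rmod_hom A (C (Suc (Suc 0))) L"
    unfolding L_def using d[of "Suc 0"] ex[of 0] C0 by (intro rmod_hom_codomain) auto
  \<comment> \<open>The family is shifted by one. At position 0 the shift would give the projective
    \<open>C 1\<close>, and \<open>L\<close>, a submodule of it, is put there instead.\<close>
  have "projective_resolution A L n (\<lambda>i. if i = 0 then L else C (Suc i)) (\<lambda>i. d (Suc i))"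
    unfolding projective_resolution_def
  proof (intro conjI allI impI)
    fix i assume i: "i \<le> n"
    show "projective A (if Suc i = 0 then L else C (Suc (Suc i)))" using C[of "Suc i"] i by simp
    show "d (Suc i) \<in> rmod_hom A (if Suc i = 0 then L else C (Suc (Suc i))) (if i = 0 then L else C (Suc i))"
      using d[of "Suc i"] d1 i by auto
  next
    fix i assume i: "i < n"
    show "d (Suc (Suc i)) ` carrier (if Suc (Suc i) = 0 then L else C (Suc (Suc (Suc i)))) =
      a_kernel (if Suc i = 0 then L else C (Suc (Suc i))) (if i = 0 then L else C (Suc i)) (d (Suc i))"
      using ex[of "Suc i"] i by (auto simp: a_kernel_eq L_def)
  qed (use ex[of 0] C0 inj in \<open>auto simp: L_def\<close>)
  then have "projective A ((syzygy A ^^ n) L)" by (rule Suc.IH[OF mL])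
  then have "(Omega_bar A ^^ n) (K0_class A L) = \<one>\<^bsub>K0 A\<^esub>" by (simp add: projective_syzygy_pow_iff[OF mL])
  also have "K0_class A L = K0_class A (syzygy A M)"
    unfolding L_def by (rule K0_class_kernel[OF M C d0M d0]) simp
  finally have "projective A ((syzygy A ^^ n) (syzygy A M))"
    by (simp add: projective_syzygy_pow_iff[OF syzygy_modA[OF M]])
  then show ?case by (simp only: funpow_Suc_right comp_apply)
qed

text \<open>The set whose infimum is \<open>proj_dim A M\<close> consists of the \<open>k\<close>
  with projective \<open>k\<close>-th syzygy. It is nonempty, as the empty infimum is infinite, and
  a nonempty infimum in \<open>enat\<close> is a least element.\<close>

lemma proj_dim_eq_enatD:
  assumes M: "M \<in> modA A" and pd: "proj_dim A M = enat n"
  shows "projective A ((syzygy A ^^ n) M)" "\<And>k. k < n \<Longrightarrow> \<not> projective A ((syzygy A ^^ k) M)"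
proof -
  let ?S = "{enat n | n. \<exists>C d. projective_resolution A M n C d}"
  have inS: "enat k \<in> ?S \<longleftrightarrow> projective A ((syzygy A ^^ k) M)" for k
    using projective_resolution_exists[OF M, of k] projective_resolution_imp[OF M, of k] by blast
  have "?S \<noteq> {}"
  proof
    assume "?S = {}"
    then have "proj_dim A M = \<infinity>" unfolding proj_dim_def by (simp only: Inf_enat_def if_P)
    then show False using pd by simp
  qed
  then obtain x where x: "x \<in> ?S" by blast
  have "Inf ?S = (LEAST x. x \<in> ?S)" using \<open>?S \<noteq> {}\<close> by (simp only: Inf_enat_def if_False)
  then have "Inf ?S \<in> ?S" using LeastI[of "\<lambda>x. x \<in> ?S", OF x] by simp
  then show "projective A ((syzygy A ^^ n) M)" using pd inS[of n] by (simp only: proj_dim_def)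
  fix k assume k: "k < n"
  show "\<not> projective A ((syzygy A ^^ k) M)"
  proof
    assume "projective A ((syzygy A ^^ k) M)"
    then have "Inf ?S \<le> enat k" using inS[of k] by (intro Inf_lower) simp
    then have "proj_dim A M \<le> enat k" unfolding proj_dim_def .
    then show False using pd k by simp
  qed
qed

section \<open>The Igusa--Todorov function\<close>

text \<open>Retractions compose, so this form gives transitivity without rearranging nested direct
  sums.\<close>

lemma direct_summand_iff_retract:
  assumes M: "M \<in> modA A"
  shows "direct_summand A N M \<longleftrightarrow> N \<in> modA A \<and>
    (\<exists>i\<in>rmod_hom A N M. \<exists>r\<in>rmod_hom A M N. \<forall>x\<in>carrier N. r (i x) = x)"
    (is "_ \<longleftrightarrow> ?R")
proof
  note rM = modA_right_module[OF M]
  assume "direct_summand A N M"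
  then obtain N' where N: "N \<in> modA A" "N' \<in> modA A" "rmod_iso A M (direct_sum N N')"
    by (auto simp: direct_summand_def)
  note rN = modA_right_module[OF N(1)] and rN' = modA_right_module[OF N(2)]
  interpret N': right_module A N' by (rule rN')
  obtain u v where u: "u \<in> rmod_hom A M (direct_sum N N')" and v: "v \<in> rmod_hom A (direct_sum N N') M"
    and uv: "\<And>z. z \<in> carrier (direct_sum N N') \<Longrightarrow> u (v z) = z"
    by (rule rmod_isoE[OF N(3) rM right_module_direct_sum[OF rN rN']]) blast
  have "fst (u (v (x, \<zero>\<^bsub>N'\<^esub>))) = x" if "x \<in> carrier N" for x using uv that by simp
  then show ?R
    using N(1) by (intro conjI bexI[OF _ rmod_hom_comp[OF rmod_hom_inl[OF rN'] v]]
        bexI[OF _ rmod_hom_comp[OF u rmod_hom_fst]]) auto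
next
  assume ?R
  then obtain i r where N: "N \<in> modA A" and i: "i \<in> rmod_hom A N M" and r: "r \<in> rmod_hom A M N"
    and ri: "\<And>x. x \<in> carrier N \<Longrightarrow> r (i x) = x" by blast
  have "rmod_iso A M (direct_sum N (M\<lparr>carrier := a_kernel M N r\<rparr>))"
    by (rule retract_direct_sum[OF modA_right_module[OF M] modA_right_module[OF N] i r]) (simp add: ri)
  then show "direct_summand A N M"
    unfolding direct_summand_def using N modA_kernel[OF M N r] by blast
qed

lemma direct_summand_trans:
  assumes "direct_summand A L N" "direct_summand A N M" "M \<in> modA A"
  shows "direct_summand A L M"
proof -
  have N: "N \<in> modA A" using assms(2) by (simp add: direct_summand_def)
  obtain i r where L: "L \<in> modA A" and i: "i \<in> rmod_hom A L N" and r: "r \<in> rmod_hom A N L"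
    and ri: "\<And>x. x \<in> carrier L \<Longrightarrow> r (i x) = x"
    using assms(1) unfolding direct_summand_iff_retract[OF N] by blast
  obtain j s where j: "j \<in> rmod_hom A N M" and s: "s \<in> rmod_hom A M N"
    and sj: "\<And>x. x \<in> carrier N \<Longrightarrow> s (j x) = x"
    using assms(2) unfolding direct_summand_iff_retract[OF assms(3)] by blast
  have "r (s (j (i x))) = x" if "x \<in> carrier L" for x
    using that by (simp add: sj ri rmod_hom_closed[OF i])
  then show ?thesis
    unfolding direct_summand_iff_retract[OF assms(3)]
    using L by (intro conjI bexI[OF _ rmod_hom_comp[OF i j]] bexI[OF _ rmod_hom_comp[OF s r]]) auto
qed

lemma direct_summand_components:
  assumes M: "M \<in> modA A" and N: "N1 \<in> modA A" "N2 \<in> modA A" and iso: "rmod_iso A M (direct_sum N1 N2)"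
  shows "direct_summand A N1 M" "direct_summand A N2 M"
proof -
  show "direct_summand A N1 M" using N iso by (auto simp: direct_summand_def)
  note r = modA_right_module[OF N(1)] modA_right_module[OF N(2)]
  interpret N1: right_module A N1 by (rule r(1))
  interpret N2: right_module A N2 by (rule r(2))
  have "rmod_iso A (direct_sum N1 N2) (direct_sum N2 N1)"
    by (rule rmod_isoI[OF rmod_hom_Pair[OF rmod_hom_snd rmod_hom_fst] rmod_hom_Pair[OF rmod_hom_snd rmod_hom_fst]])
      auto
  from rmod_iso_trans[OF iso this] show "direct_summand A N2 M"
    using N by (auto simp: direct_summand_def)
qed

lemma direct_summand_refl: "M \<in> modA A \<Longrightarrow> direct_summand A M M"
  unfolding direct_summand_iff_retract
  by (intro conjI bexI[OF _ rmod_hom_id] bexI[OF _ rmod_hom_id]) auto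

section \<open>The subgroup generated by the indecomposable summands\<close>

lemma add_generators_closed:
  "{K0_class A N |N. indecomposable A N \<and> direct_summand A N M} \<subseteq> carrier (K0 A)"
  by (auto simp: direct_summand_def intro: K0_class_closed)

lemma add_subgroup_subgroup: "subgroup (add_subgroup A M) (K0 A)"
  unfolding add_subgroup_def by (rule K0.generate_is_subgroup[OF add_generators_closed])

lemma add_subgroup_mono:
  assumes "direct_summand A N M" "M \<in> modA A"
  shows "add_subgroup A N \<subseteq> add_subgroup A M"
  unfolding add_subgroup_def
  using direct_summand_trans[OF _ assms] by (intro K0.mono_generate) auto

lemma len_pos:
  assumes "M \<in> modA A" "carrier M \<noteq> {\<zero>\<^bsub>M\<^esub>}"
  shows "0 < len A M"
proof -
  note rM = modA_right_module[OF assms(1)]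
  have "{\<zero>\<^bsub>M\<^esub>} \<subset> carrier M" using assms(2) submodule_zero[OF submodule_carrier[OF rM]] by auto
  from len_strict_mono[OF rM submodule_zero_set[OF rM] submodule_carrier[OF rM] this]
  show ?thesis using modA_finite_length[OF assms(1)] by simp
qed

text \<open>The generators are classes of indecomposable summands, so \<open>M\<close> has to be
  broken up: a nonzero decomposable module splits into two shorter ones. The zero module is not
  indecomposable, but its class is trivial.\<close>

lemma K0_class_in_add_subgroup:
  assumes "M \<in> modA A"
  shows "K0_class A M \<in> add_subgroup A M"
  using assms
proof (induction "len A M" arbitrary: M rule: less_induct)
  case less
  note M = less.prems
  consider "carrier M = {\<zero>\<^bsub>M\<^esub>}" | "indecomposable A M"
    | N1 N2 where "N1 \<in> modA A" "N2 \<in> modA A" "rmod_iso A M (direct_sum N1 N2)"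
        "carrier N1 \<noteq> {\<zero>\<^bsub>N1\<^esub>}" "carrier N2 \<noteq> {\<zero>\<^bsub>N2\<^esub>}"
    using M unfolding indecomposable_def by blast
  then show ?case
  proof cases
    case 1
    then show ?thesis
      using K0_class_projective[OF projective_zero_module[OF M]] subgroup.one_closed[OF add_subgroup_subgroup]
      by simp
  next
    case 2
    then show ?thesis
      unfolding add_subgroup_def using direct_summand_refl[OF M] by (auto intro: generate.incl)
  next
    case (3 N1 N2)
    note r = modA_right_module[OF 3(1)] modA_right_module[OF 3(2)]
    have "len A M = len A N1 + len A N2"
      using len_iso[OF 3(3) modA_right_module[OF M] right_module_direct_sum[OF r] modA_finite_length[OF M]]
        len_direct_sum[OF r modA_finite_length[OF 3(1)] modA_finite_length[OF 3(2)]] by simp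
    then have "len A N1 < len A M" "len A N2 < len A M"
      using len_pos[OF 3(1,4)] len_pos[OF 3(2,5)] by auto
    then have "K0_class A N1 \<in> add_subgroup A N1" "K0_class A N2 \<in> add_subgroup A N2"
      using less.hyps 3 by auto
    then have "K0_class A N1 \<in> add_subgroup A M" "K0_class A N2 \<in> add_subgroup A M"
      using add_subgroup_mono[OF direct_summand_components(1)[OF M 3(1-3)] M]
        add_subgroup_mono[OF direct_summand_components(2)[OF M 3(1-3)] M] by auto
    then show ?thesis
      unfolding K0_class_direct_sum[OF M 3(1-3)] by (rule subgroup.m_closed[OF add_subgroup_subgroup])
  qed
qed

text \<open>The kernel of the iterate is a subgroup, so generators suffice. For a summand
  \<open>N\<close> with complement \<open>N'\<close>, the \<open>n\<close>-th syzygies of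
  \<open>N\<close> and \<open>N'\<close> have classes that add up to zero;
  \<open>K0_class_summand\<close> makes each of them vanish.\<close>

lemma Omega_bar_pow_add_subgroup:
  assumes M: "M \<in> modA A" and n: "projective A ((syzygy A ^^ n) M)" and x: "x \<in> add_subgroup A M"
  shows "(Omega_bar A ^^ n) x = \<one>\<^bsub>K0 A\<^esub>"
proof -
  interpret h: group_hom "K0 A" "K0 A" "Omega_bar A ^^ n"
    by (intro group_hom.intro group_hom_axioms.intro K0.group_axioms Omega_bar_pow_hom)
  have one: "(Omega_bar A ^^ n) (K0_class A N) = \<one>\<^bsub>K0 A\<^esub>" if NM: "direct_summand A N M" for N
  proof -
    obtain N' where N: "N \<in> modA A" "N' \<in> modA A" "rmod_iso A M (direct_sum N N')"
      using NM by (auto simp: direct_summand_def)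
    have "(Omega_bar A ^^ n) (K0_class A N) \<otimes>\<^bsub>K0 A\<^esub> (Omega_bar A ^^ n) (K0_class A N') = \<one>\<^bsub>K0 A\<^esub>"
      using n h.hom_mult[OF K0_class_closed[OF N(1)] K0_class_closed[OF N(2)]]
      by (simp add: projective_syzygy_pow_iff[OF M] K0_class_direct_sum[OF M N])
    then show ?thesis
      using K0_class_summand[OF syzygy_pow_modA[OF N(1)] syzygy_pow_modA[OF N(2)]]
      by (simp add: Omega_bar_pow_class N)
  qed
  have "add_subgroup A M \<subseteq> kernel (K0 A) (K0 A) (Omega_bar A ^^ n)"
    unfolding add_subgroup_def
    by (rule K0.generate_subgroup_incl[OF _ h.subgroup_kernel])
      (use one in \<open>auto simp: kernel_def direct_summand_def intro: K0_class_closed\<close>)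
  then show ?thesis using x by (auto simp: kernel_def)
qed

lemma IT_phi_eq:
  assumes M: "M \<in> modA A" and n: "projective A ((syzygy A ^^ n) M)"
    and less: "\<And>k. k < n \<Longrightarrow> \<not> projective A ((syzygy A ^^ k) M)"
  shows "IT_phi A M = n"
  unfolding IT_phi_def
proof (rule Least_equality)
  let ?G = "add_subgroup A M"
  show "\<forall>s. inj_on (Omega_bar A) ((Omega_bar A ^^ (n + s)) ` ?G)"
  proof
    fix s
    \<comment> \<open>From \<open>n\<close> on, the iterated images contain the unit only, and
      injectivity is trivial.\<close>
    have "(Omega_bar A ^^ (n + s)) x = \<one>\<^bsub>K0 A\<^esub>" if "x \<in> ?G" for x
      using Omega_bar_pow_add_subgroup[OF M n that] Omega_bar_pow_one[of s]
      by (simp add: add.commute[of n] funpow_add)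
    then show "inj_on (Omega_bar A) ((Omega_bar A ^^ (n + s)) ` ?G)" by (auto intro!: inj_onI)
  qed
  fix l assume l: "\<forall>s. inj_on (Omega_bar A) ((Omega_bar A ^^ (l + s)) ` ?G)"
  show "n \<le> l"
  proof (rule ccontr)
    assume "\<not> n \<le> l"
    \<comment> \<open>Injectivity must fail at \<open>k = n - 1\<close>, which \<open>l\<close>
      covers with \<open>s = k - l\<close>: both \<open>?x\<close> and the unit lie in the
      \<open>k\<close>-th image and are sent to the unit, but \<open>?x\<close> is not the unit
      because the \<open>k\<close>-th syzygy is not projective.\<close>
    then obtain k where k: "n = Suc k" "l \<le> k" by (metis Suc_le_D not_less_eq_eq)
    have inj: "inj_on (Omega_bar A) ((Omega_bar A ^^ k) ` ?G)" using l[rule_format, of "k - l"] k by simp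
    let ?x = "(Omega_bar A ^^ k) (K0_class A M)"
    have 1: "\<one>\<^bsub>K0 A\<^esub> \<in> (Omega_bar A ^^ k) ` ?G"
      using subgroup.one_closed[OF add_subgroup_subgroup, of M]
      by (intro image_eqI[where x = "\<one>\<^bsub>K0 A\<^esub>"]) (simp_all add: Omega_bar_pow_one)
    have x: "?x \<in> (Omega_bar A ^^ k) ` ?G" using K0_class_in_add_subgroup[OF M] by simp
    have "Omega_bar A ?x = Omega_bar A \<one>\<^bsub>K0 A\<^esub>"
      using n Omega_bar_pow_one[of 1] unfolding projective_syzygy_pow_iff[OF M] k(1) by simp
    then have "?x = \<one>\<^bsub>K0 A\<^esub>" using inj_onD[OF inj _ x 1] by simp
    then show False using less[of k] k(1) by (simp add: projective_syzygy_pow_iff[OF M])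
  qed
qed

section \<open>Gaps, finitistic dimension and \<open>\<phi>\<close>-dimension\<close>

lemma IT_phi_syzygy:
  assumes M: "M \<in> modA A" and pd: "proj_dim A M = enat n" and t: "t \<le> n"
  shows "IT_phi A ((syzygy A ^^ (n - t)) M) = t"
proof (rule IT_phi_eq)
  have pow: "(syzygy A ^^ k) ((syzygy A ^^ (n - t)) M) = (syzygy A ^^ (k + (n - t))) M" for k
    by (simp add: funpow_add)
  show "projective A ((syzygy A ^^ t) ((syzygy A ^^ (n - t)) M))"
    using proj_dim_eq_enatD(1)[OF M pd] t by (simp add: pow)
  show "\<not> projective A ((syzygy A ^^ k) ((syzygy A ^^ (n - t)) M))" if "k < t" for k
    unfolding pow using t that by (intro proj_dim_eq_enatD(2)[OF M pd]) simp
qed (rule syzygy_pow_modA[OF M])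

lemma findim_less_gap:
  assumes gap: "gap A t"
  shows "findim A < enat t"
proof (rule ccontr)
  assume ge: "\<not> findim A < enat t"
  have no: "IT_phi A M \<noteq> t" if "M \<in> modA A" for M
    using gap that by (auto simp: gap_def admissible_def)
  have pd: "proj_dim A M < enat t" if M: "M \<in> modA A" and fin: "proj_dim A M < \<infinity>" for M
  proof (rule ccontr)
    assume "\<not> proj_dim A M < enat t"
    moreover obtain n where n: "proj_dim A M = enat n" using fin by auto
    ultimately have "IT_phi A ((syzygy A ^^ (n - t)) M) = t" by (intro IT_phi_syzygy[OF M]) auto
    then show False using no[OF syzygy_pow_modA[OF M]] by simp
  qed
  \<comment> \<open>Zero is never a gap, since \<open>\<phi>\<close> of a projective module is 0. So
    \<open>t\<close> has a predecessor \<open>s\<close>, and bounding all finite projective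
    dimensions by \<open>s\<close> keeps the inequality strict when passing to the supremum.\<close>
  obtain Z where "projective A Z" by (rule zero_module_exists)
  then have "t \<noteq> 0" using no[of Z] IT_phi_eq[of Z 0] by (auto simp: projective_modA)
  then obtain s where s: "t = Suc s" by (cases t) auto
  have "findim A \<le> enat s"
    unfolding findim_def
  proof (rule Sup_least)
    fix x assume "x \<in> {proj_dim A M |M. M \<in> modA A \<and> proj_dim A M < \<infinity>}"
    then have "x < enat t" using pd by auto
    then show "x \<le> enat s" by (cases x) (auto simp: s)
  qed
  also have "enat s < enat t" by (simp add: s)
  finally show False using ge by simp
qed

lemma gap_less_phidim:
  assumes gap: "gap A t"
  shows "enat t < phidim A"
proof (rule ccontr)
  assume "\<not> enat t < phidim A"
  then have eq: "phidim A = enat t" using gap by (auto simp: gap_def)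
  let ?S = "(\<lambda>M. enat (IT_phi A M)) ` modA A"
  obtain Z where "projective A Z" by (rule zero_module_exists)
  then have ne: "?S \<noteq> {}" using projective_modA by blast
  have "x \<le> enat t" if "x \<in> ?S" for x using that unfolding eq[symmetric] phidim_def by (rule Sup_upper)
  \<comment> \<open>A set of extended naturals below a finite bound is finite, and
    \<open>Sup_enat_def\<close> evaluates the supremum of a nonempty finite set as its maximum. The
    value \<open>t\<close> would then be attained, which a gap excludes.\<close>
  then have "finite ?S" by (rule finite_enat_bounded)
  then have "Sup ?S \<in> ?S" using ne by (simp add: Sup_enat_def)
  then show False using gap eq by (auto simp: gap_def admissible_def phidim_def)
qed

end

theorem theorem4p9:
  fixes K :: "('k, 'c) ring_scheme" and A :: "('k, 'a, 'b) module_scheme"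
  assumes "fd_algebra K A"
    and "\<exists>t. gap A t"
  shows "(\<forall>t. gap A t \<longrightarrow> findim A < enat t \<and> enat t < phidim A) \<and> findim A < \<infinity>"
proof -
  interpret finite_length_ring A by (rule fd_algebra.finite_length_ring[OF assms(1)])
  obtain t where "gap A t" using assms(2) by blast
  then have "findim A < \<infinity>" using findim_less_gap order_less_trans enat_ord_simps(4) by metis
  then show ?thesis using findim_less_gap gap_less_phidim by blast
qed

end
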